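(* Let $\alpha>0$ and $K>0$. Then the random dynamical system $\mathbf{Y}:\mathbb{R}^+\times\Omega\times\mathbf{E}\to\mathbf{E}$, $\mathbf{Y}(t,\omega,Y_0\ (\mathrm{mod}\,p_0))=Y(t,\omega,Y_0)\ (\mathrm{mod}\,p_0)$, induced on the cylinder $\mathbf{E}=(E_1/p_0\mathbb{Z})\times E_2$ by the solutions $Y(t,\omega,Y_0)$ of the random system $\dot u=v+z(\theta_t\omega)$, $\dot v=-KAu-\alpha v+f-\beta g(u)+(1-\alpha)z(\theta_t\omega)$, has a global random attractor $\omega\mapsto\mathbf{A_0}(\omega)$.
   Context: Data. $N\ge2$, $d\ge1$ are integers, $\mathbb{Z}^d_N=\{j\in\mathbb{Z}^d:1\le j_1,\dots,j_d\le N\}$; $\alpha,K>0$, $\beta\in\mathbb{R}$, and $f=(f_j)$, $(\epsilon_j)$ are constant vectors in $\mathbb{R}^{N^d}$ indexed by $\mathbb{Z}^d_N$. $A$ is an $N^d\times N^d$ nonnegative definite symmetric matrix with eigenvalues $0=\lambda_0<\lambda_1\le\dots\le\lambda_{N^d-1}$, with $\lambda_0=0$ algebraically simple and $(1,\dots,1)^\top$ an eigenvector for $\lambda_0$. $g\in C^1(\mathbb{R},\mathbb{R})$ satisfies $g(x+\kappa)=g(x)$, $|g(x)|\le c_1$, $|g'(x)|\le c_2$ for all $x$, where $c_1,c_2>0$ and $\kappa>0$ is the smallest positive period of $g$; $g(u)=(g(u_j))_j$ for $u\in\mathbb{R}^{N^d}$. Noise. $\Omega_0=\{\omega_0\in C(\mathbb{R},\mathbb{R}):\omega_0(0)=0\}$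 with the compact-open topology, Borel $\sigma$-algebra and (two-sided) Wiener measure; $(\Omega,\mathcal{F},\mathbb{P})$ is the product of copies of this space over $j\in\mathbb{Z}^d_N$; $\theta_t\omega(\cdot)=\omega(\cdot+t)-\omega(t)$. $W(t)=(\epsilon_jW_j(t))_j$ with $W_j(t)(\omega)=\omega_j(t)$. $z(\theta_t\omega)=(z_j(\theta_t\omega))_j$ is the unique stationary solution of $dz+z\,dt=dW(t)$ in $\mathbb{R}^{N^d}$ (explicitly $z_j(\omega)=-\epsilon_j\int_{-\infty}^0e^s\omega_j(s)\,ds$). $\Omega$ is replaced, without change of notation, by a $\theta_t$-invariant full-measure subset on which every $t\mapsto z_j(\theta_t\omega)$ is continuous and $\lim_{|t|\to\infty}e^{-\epsilon|t|}|z_j(\theta_t\omega)|=0$ for every $\epsilon>0$. System. $E=\mathbb{R}^{N^d}\times\mathbb{R}^{N^d}$; $Y(t,\omega,Y_0)$, $t\ge0$, is the solution $(u,v)^\top$ of the random system in the claim with $Y(0,\omega,Y_0)=Y_0\in E$. $\eta_0=(1,\dots,1,0,\dots,0)^\top$, $\eta_{-1}=(1,\dots,1,-\alpha,\dots,-\alpha)^\top\in E$; $E_1=\mathrm{span}\{\eta_0\}$, $E_{-1}=\mathrm{span}\{\eta_{-1}\}$, $E_{11}=E_1+E_{-1}$, $E_{22}=E_{11}^\perp$ (Euclidean orthogonal complement in $E$), $E_2=E_{-1}\oplus E_{22}$, so $E=E_1\oplus E_2$. $p_0=\kappa\eta_0$ and $p_0\mathbb{Z}=\{kp_0:k\in\mathbb{Z}\}$.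 Since $Y(t,\omega,Y_0+kp_0)=Y(t,\omega,Y_0)+kp_0$ for $k\in\mathbb{Z}$, $\mathbf{Y}$ is well defined. $\mathbf{E}$ carries the metric induced from any norm on $E$ (all are equivalent). Random dynamical systems and random sets. Let $(X,d)$ be a complete separable metric space. A (continuous) random dynamical system on $X$ over $(\Omega,\mathcal{F},\mathbb{P},(\theta_t)_{t\in\mathbb{R}})$ is a jointly measurable map $\varphi:\mathbb{R}^+\times\Omega\times X\to X$ with $\varphi(0,\omega,x)=x$, $\varphi(t+s,\omega,\cdot)=\varphi(t,\theta_s\omega,\varphi(s,\omega,\cdot))$ for all $s,t\ge0$, $\omega\in\Omega$, and $x\mapsto\varphi(t,\omega,x)$ continuous for all $t\ge0$, $\omega\in\Omega$. $d_H(S,S')=\sup_{x\in S}\inf_{y\in S'}d(x,y)$. A map $\omega\mapsto D(\omega)\subset X$ is a random set if $\omega\mapsto d(x,D(\omega))=\inf_{y\in D(\omega)}d(x,y)$ is measurable for every $x\in X$; it is a random compact set if moreover each $D(\omega)$ is compact. It is tempered if for some $x_0\in X$ and $\mathbb{P}$-a.e. $\omega\in\Omega$, $\lim_{t\to\infty}e^{-bt}\sup\{d(x,x_0):x\in D(\theta_{-t}\omega)\}=0$ for all $b>0$. A random set $B_1$ is a random attracting set if for every tempered random set $D$, $\lim_{t\to\infty}d_H(\varphi(t,\theta_{-t}\omega,D(\theta_{-t}\omega)),B_1(\omega))=0$ for all $\omega\in\Omega$. A global random attractor is a random compact set $\omega\mapsto\mathcal{A}(\omega)$ that is a random attracting set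 and satisfies $\varphi(t,\omega,\mathcal{A}(\omega))=\mathcal{A}(\theta_t\omega)$ for all $\omega\in\Omega$, $t\ge0$.
   Formalization: Attraction of a tempered random set D is required only at those ω where D satisfies the temperedness growth condition, not at all ω, since D may grow arbitrarily fast along a null orbit, where no compact set can attract it. *)

theory Defs
  imports "HOL-Probability.Probability"
begin

section \<open>Random dynamical systems and random attractors\<close>

text \<open>
  A metric space is a carrier \<open>X\<close> with a distance \<open>d\<close>; the probability space is a measure
  \<open>M\<close> with sample space \<^term>\<open>space M\<close>.  Suprema and infima of distances are taken in
  \<^typ>\<open>ennreal\<close>, so that \<open>\<infinity>\<close> is the infimum over the empty set and
  the supremum over an unbounded set.
\<close>

definition metric_borel :: "'x set \<Rightarrow> ('x \<Rightarrow> 'x \<Rightarrow> real) \<Rightarrow> 'x measure" where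
  "metric_borel X d = sigma X {U. openin (Metric_space.mtopology X d) U}"

definition rds ::
  "'w measure \<Rightarrow> (real \<Rightarrow> 'w \<Rightarrow> 'w) \<Rightarrow> 'x set \<Rightarrow> ('x \<Rightarrow> 'x \<Rightarrow> real)
    \<Rightarrow> (real \<Rightarrow> 'w \<Rightarrow> 'x \<Rightarrow> 'x) \<Rightarrow> bool" where
  "rds M \<theta> X d \<phi> \<longleftrightarrow>
     Metric_space X d \<and> Metric_space.mcomplete X d \<and>
     separable_space (Metric_space.mtopology X d) \<and>
     (\<lambda>(t, \<omega>, x). \<phi> t \<omega> x) \<in>
       restrict_space borel {0..} \<Otimes>\<^sub>M (M \<Otimes>\<^sub>M metric_borel X d) \<rightarrow>\<^sub>M metric_borel X d \<and>
     (\<forall>\<omega>\<in>space M. \<forall>x\<in>X. \<phi> 0 \<omega> x = x) \<and>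
     (\<forall>\<omega>\<in>space M. \<forall>s\<ge>0. \<forall>t\<ge>0. \<forall>x\<in>X. \<phi> (t + s) \<omega> x = \<phi> t (\<theta> s \<omega>) (\<phi> s \<omega> x)) \<and>
     (\<forall>\<omega>\<in>space M. \<forall>t\<ge>0.
        continuous_map (Metric_space.mtopology X d) (Metric_space.mtopology X d) (\<phi> t \<omega>))"

definition point_dist :: "('x \<Rightarrow> 'x \<Rightarrow> real) \<Rightarrow> 'x \<Rightarrow> 'x set \<Rightarrow> ennreal" where
  "point_dist d x S = (INF y\<in>S. ennreal (d x y))"

definition semi_hausdorff :: "('x \<Rightarrow> 'x \<Rightarrow> real) \<Rightarrow> 'x set \<Rightarrow> 'x set \<Rightarrow> ennreal" where
  "semi_hausdorff d S S' = (SUP x\<in>S. point_dist d x S')"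

definition random_set ::
  "'w measure \<Rightarrow> 'x set \<Rightarrow> ('x \<Rightarrow> 'x \<Rightarrow> real) \<Rightarrow> ('w \<Rightarrow> 'x set) \<Rightarrow> bool" where
  "random_set M X d D \<longleftrightarrow>
     (\<forall>\<omega>\<in>space M. D \<omega> \<subseteq> X) \<and>
     (\<forall>x\<in>X. (\<lambda>\<omega>. point_dist d x (D \<omega>)) \<in> borel_measurable M)"

definition random_compact_set ::
  "'w measure \<Rightarrow> 'x set \<Rightarrow> ('x \<Rightarrow> 'x \<Rightarrow> real) \<Rightarrow> ('w \<Rightarrow> 'x set) \<Rightarrow> bool" where
  "random_compact_set M X d D \<longleftrightarrow>
     random_set M X d D \<and> (\<forall>\<omega>\<in>space M. compactin (Metric_space.mtopology X d) (D \<omega>))"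

definition tempered_at ::
  "(real \<Rightarrow> 'w \<Rightarrow> 'w) \<Rightarrow> ('x \<Rightarrow> 'x \<Rightarrow> real) \<Rightarrow> ('w \<Rightarrow> 'x set) \<Rightarrow> 'x \<Rightarrow> 'w \<Rightarrow> bool" where
  "tempered_at \<theta> d D x0 \<omega> \<longleftrightarrow>
     (\<forall>b>0. ((\<lambda>t. ennreal (exp (- b * t)) * (SUP x\<in>D (\<theta> (- t) \<omega>). ennreal (d x x0)))
               \<longlongrightarrow> 0) at_top)"

definition tempered ::
  "'w measure \<Rightarrow> (real \<Rightarrow> 'w \<Rightarrow> 'w) \<Rightarrow> 'x set \<Rightarrow> ('x \<Rightarrow> 'x \<Rightarrow> real) \<Rightarrow> ('w \<Rightarrow> 'x set) \<Rightarrow> bool" where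
  "tempered M \<theta> X d D \<longleftrightarrow> (\<exists>x0\<in>X. AE \<omega> in M. tempered_at \<theta> d D x0 \<omega>)"

text \<open>
  Temperedness only constrains \<open>D\<close> along almost every orbit of \<open>\<theta>\<close>.  Nothing can be attracted
  along the exceptional orbits, where \<open>D\<close> may grow faster than any exponential; accordingly \<open>B\<close>
  has to attract \<open>D\<close> at every \<open>\<omega>\<close> at which \<open>D\<close> satisfies the growth condition.  (If \<open>D\<close> is
  tempered at every \<open>\<omega>\<close>, then these are all \<open>\<omega>\<close>; in any case they have full measure.)
\<close>

definition random_attracting_set ::
  "'w measure \<Rightarrow> (real \<Rightarrow> 'w \<Rightarrow> 'w) \<Rightarrow> 'x set \<Rightarrow> ('x \<Rightarrow> 'x \<Rightarrow> real)
    \<Rightarrow> (real \<Rightarrow> 'w \<Rightarrow> 'x \<Rightarrow> 'x) \<Rightarrow> ('w \<Rightarrow> 'x set) \<Rightarrow> bool" where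
  "random_attracting_set M \<theta> X d \<phi> B \<longleftrightarrow>
     random_set M X d B \<and>
     (\<forall>D. random_set M X d D \<and> tempered M \<theta> X d D \<longrightarrow>
        (\<forall>\<omega>\<in>space M. (\<exists>x0\<in>X. tempered_at \<theta> d D x0 \<omega>) \<longrightarrow>
           ((\<lambda>t. semi_hausdorff d (\<phi> t (\<theta> (- t) \<omega>) ` D (\<theta> (- t) \<omega>)) (B \<omega>)) \<longlongrightarrow> 0) at_top))"

definition global_random_attractor ::
  "'w measure \<Rightarrow> (real \<Rightarrow> 'w \<Rightarrow> 'w) \<Rightarrow> 'x set \<Rightarrow> ('x \<Rightarrow> 'x \<Rightarrow> real)
    \<Rightarrow> (real \<Rightarrow> 'w \<Rightarrow> 'x \<Rightarrow> 'x) \<Rightarrow> ('w \<Rightarrow> 'x set) \<Rightarrow> bool" where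
  "global_random_attractor M \<theta> X d \<phi> B \<longleftrightarrow>
     random_compact_set M X d B \<and>
     random_attracting_set M \<theta> X d \<phi> B \<and>
     (\<forall>\<omega>\<in>space M. \<forall>t\<ge>0. \<phi> t \<omega> ` B \<omega> = B (\<theta> t \<omega>))"


section \<open>The noise\<close>

definition path_set :: "(real \<Rightarrow> real) set" where
  "path_set = {\<omega>. continuous_on UNIV \<omega> \<and> \<omega> 0 = 0}"

definition compact_open_topology :: "(real \<Rightarrow> real) topology" where
  "compact_open_topology =
     topology_generated_by {{\<omega>\<in>path_set. \<omega> ` K \<subseteq> U} | K U. compact K \<and> open U}"

text \<open>
  Two-sided Wiener measure, characterised as the law on the path space of a process with
  independent, centred Gaussian increments of variance \<open>t - s\<close>.
\<close>

definition wiener_measure :: "(real \<Rightarrow> real) measure \<Rightarrow> bool" where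
  "wiener_measure P \<longleftrightarrow>
     prob_space P \<and>
     space P = path_set \<and>
     sets P = sigma_sets path_set {U. openin compact_open_topology U} \<and>
     (\<forall>s t. s < t \<longrightarrow>
        distributed P lborel (\<lambda>\<omega>. \<omega> t - \<omega> s) (normal_density 0 (sqrt (t - s)))) \<and>
     (\<forall>(n::nat) (\<tau>::nat \<Rightarrow> real). (\<forall>i<n. \<tau> i < \<tau> (Suc i)) \<longrightarrow>
        prob_space.indep_vars P (\<lambda>_. borel) (\<lambda>i \<omega>. \<omega> (\<tau> (Suc i)) - \<omega> (\<tau> i)) {..<n})"

definition shift :: "real \<Rightarrow> ('j \<Rightarrow> real \<Rightarrow> real) \<Rightarrow> 'j \<Rightarrow> real \<Rightarrow> real" where
  "shift t \<omega> = (\<lambda>j s. \<omega> j (s + t) - \<omega> j t)"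

text \<open>
  The Henstock-Kurzweil integral over \<open>(-\<infinity>, 0]\<close> of a continuous path includes the
  improper (conditionally convergent) integral.
\<close>

definition ou :: "real^'j \<Rightarrow> ('j::finite \<Rightarrow> real \<Rightarrow> real) \<Rightarrow> real^'j" where
  "ou \<epsilon> \<omega> = (\<chi> j. - (\<epsilon> $ j) * integral {..0} (\<lambda>s. exp s * \<omega> j s))"

definition product_noise :: "(real \<Rightarrow> real) measure \<Rightarrow> ('j::finite \<Rightarrow> real \<Rightarrow> real) measure" where
  "product_noise P = PiM UNIV (\<lambda>_. P)"

text \<open>
  The shift-invariant sets of full measure to which the sample space may be reduced.  The
  integrability condition says that the integral in \<^const>\<open>ou\<close> exists.
\<close>

definition good_noise_set ::
  "(real \<Rightarrow> real) measure \<Rightarrow> real^'j \<Rightarrow> ('j::finite \<Rightarrow> real \<Rightarrow> real) set \<Rightarrow> bool" where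
  "good_noise_set P \<epsilon> \<Omega> \<longleftrightarrow>
     \<Omega> \<in> sets (product_noise P) \<and> emeasure (product_noise P) \<Omega> = 1 \<and>
     (\<forall>t. shift t ` \<Omega> = \<Omega>) \<and>
     (\<forall>\<omega>\<in>\<Omega>. \<forall>j.
        (\<lambda>s. exp s * \<omega> j s) integrable_on {..0} \<and>
        continuous_on UNIV (\<lambda>t. ou \<epsilon> (shift t \<omega>) $ j) \<and>
        (\<forall>e>0. ((\<lambda>t. exp (- e * \<bar>t\<bar>) * \<bar>ou \<epsilon> (shift t \<omega>) $ j\<bar>) \<longlongrightarrow> 0) at_infinity))"

definition noise_space ::
  "(real \<Rightarrow> real) measure \<Rightarrow> ('j::finite \<Rightarrow> real \<Rightarrow> real) set \<Rightarrow> ('j \<Rightarrow> real \<Rightarrow> real) measure" where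
  "noise_space P \<Omega> = restrict_space (product_noise P) \<Omega>"


section \<open>The random system and the cylinder\<close>

type_synonym 'j phase = "(real^'j) \<times> (real^'j)"

text \<open>
  The characteristic polynomial \<open>det (x I - A)\<close> splits with roots \<open>lam 0, ..., lam (n - 1)\<close>,
  that is, these are the eigenvalues repeated according to algebraic multiplicity.
  Algebraic simplicity of \<open>lam 0 = 0\<close> is then \<open>0 < lam 1\<close>.
\<close>

definition eigenvalues_with_mult :: "real^'j^'j \<Rightarrow> (nat \<Rightarrow> real) \<Rightarrow> bool" where
  "eigenvalues_with_mult A lam \<longleftrightarrow> (\<forall>x. det (mat x - A) = (\<Prod>i<CARD('j). x - lam i))"

definition random_field ::
  "real^'j^'j \<Rightarrow> real \<Rightarrow> real \<Rightarrow> real \<Rightarrow> real^'j \<Rightarrow> (real \<Rightarrow> real) \<Rightarrow> real^'j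
    \<Rightarrow> 'j phase \<Rightarrow> 'j phase" where
  "random_field A K \<alpha> \<beta> f g z = (\<lambda>(u, v).
     (v + z,
      - (K *\<^sub>R (A *v u)) - \<alpha> *\<^sub>R v + f - \<beta> *\<^sub>R (\<chi> j. g (u $ j)) + (1 - \<alpha>) *\<^sub>R z))"

definition random_solution ::
  "real^'j^'j \<Rightarrow> real \<Rightarrow> real \<Rightarrow> real \<Rightarrow> real^'j \<Rightarrow> (real \<Rightarrow> real) \<Rightarrow> real^'j
    \<Rightarrow> ('j::finite \<Rightarrow> real \<Rightarrow> real) \<Rightarrow> 'j phase \<Rightarrow> (real \<Rightarrow> 'j phase) \<Rightarrow> bool" where
  "random_solution A K \<alpha> \<beta> f g \<epsilon> \<omega> Y0 y \<longleftrightarrow>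
     y 0 = Y0 \<and>
     (\<forall>t\<ge>0. (y has_vector_derivative random_field A K \<alpha> \<beta> f g (ou \<epsilon> (shift t \<omega>)) (y t))
              (at t within {0..}))"

definition eta0 :: "'j::finite phase" where
  "eta0 = (\<chi> j. 1, 0)"

definition eta_neg :: "real \<Rightarrow> 'j::finite phase" where
  "eta_neg \<alpha> = (\<chi> j. 1, \<chi> j. - \<alpha>)"

definition E1 :: "'j::finite phase set" where
  "E1 = span {eta0}"

definition E_neg :: "real \<Rightarrow> 'j::finite phase set" where
  "E_neg \<alpha> = span {eta_neg \<alpha>}"

definition E11 :: "real \<Rightarrow> 'j::finite phase set" where
  "E11 \<alpha> = E1 + E_neg \<alpha>"

definition E22 :: "real \<Rightarrow> 'j::finite phase set" where
  "E22 \<alpha> = (E11 \<alpha>)\<^sup>\<bottom>"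

definition E2 :: "real \<Rightarrow> 'j::finite phase set" where
  "E2 \<alpha> = E_neg \<alpha> + E22 \<alpha>"

definition p0_coset :: "real \<Rightarrow> 'j::finite phase \<Rightarrow> 'j phase set" where
  "p0_coset \<kappa> a = {a + real_of_int k *\<^sub>R (\<kappa> *\<^sub>R eta0) | k. True}"

text \<open>The cylinder \<open>(E\<^sub>1 / p\<^sub>0\<int>) \<times> E\<^sub>2\<close>; elements of \<open>E\<^sub>1 / p\<^sub>0\<int>\<close> are cosets.\<close>

definition cylinder :: "real \<Rightarrow> real \<Rightarrow> ('j::finite phase set \<times> 'j phase) set" where
  "cylinder \<alpha> \<kappa> = (p0_coset \<kappa> ` E1) \<times> E2 \<alpha>"

definition mod_p0 :: "real \<Rightarrow> real \<Rightarrow> 'j::finite phase \<Rightarrow> 'j phase set \<times> 'j phase" where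
  "mod_p0 \<alpha> \<kappa> y = (THE p. \<exists>a\<in>E1. \<exists>b\<in>E2 \<alpha>. y = a + b \<and> p = (p0_coset \<kappa> a, b))"

definition is_norm :: "('a::real_vector \<Rightarrow> real) \<Rightarrow> bool" where
  "is_norm \<nu> \<longleftrightarrow>
     (\<forall>x. \<nu> x = 0 \<longleftrightarrow> x = 0) \<and> (\<forall>c x. \<nu> (c *\<^sub>R x) = \<bar>c\<bar> * \<nu> x) \<and>
     (\<forall>x y. \<nu> (x + y) \<le> \<nu> x + \<nu> y)"

text \<open>
  The quotient metric.  As for \<^const>\<open>setdist\<close>, the value is \<open>0\<close> if one of the sets is
  empty, which does not happen on the cylinder.
\<close>

definition cylinder_dist ::
  "('j::finite phase \<Rightarrow> real) \<Rightarrow> 'j phase set \<times> 'j phase \<Rightarrow> 'j phase set \<times> 'j phase \<Rightarrow> real" where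
  "cylinder_dist \<nu> = (\<lambda>(C, w) (C', w').
     if C = {} \<or> C' = {} then 0
     else Inf {\<nu> ((a + w) - (a' + w')) | a a'. a \<in> C \<and> a' \<in> C'})"

definition cylinder_flow ::
  "real \<Rightarrow> real \<Rightarrow> (real \<Rightarrow> 'w \<Rightarrow> 'j::finite phase \<Rightarrow> 'j phase)
    \<Rightarrow> real \<Rightarrow> 'w \<Rightarrow> 'j phase set \<times> 'j phase \<Rightarrow> 'j phase set \<times> 'j phase" where
  "cylinder_flow \<alpha> \<kappa> Y t \<omega> X =
     (THE Z. \<exists>Y0. X = mod_p0 \<alpha> \<kappa> Y0 \<and> Z = mod_p0 \<alpha> \<kappa> (Y t \<omega> Y0))"

end

theory Submission
  imports Defs
begin

text \<open>
  The phase space splits into the line \<^const>\<open>E1\<close>, along which the vector field is periodic, and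
  the complement \<^const>\<open>E2\<close>, on which its linear part is exponentially stable.  Passing to the
  cylinder makes the first factor a circle, so that only the second one needs an estimate.

  Dissipation: since \<open>0\<close> is a simple eigenvalue of the nonnegative symmetric matrix \<open>A\<close> with eigenvector
  \<open>(1, \<dots>, 1)\<close>, the matrix is coercive on vectors of mean zero.  This yields a quadratic form, degenerate
  exactly along \<^const>\<open>eta0\<close>, that decays exponentially under the linear part (\<open>dissipative_form\<close>).
  As \<open>g\<close> is bounded, the form evaluated at a solution, its energy \<open>E\<close>, satisfies
  \<open>E' \<le> - \<delta> E + C (1 + |z|\<^sup>2)\<close> with \<open>z\<close> the stationary Ornstein-Uhlenbeck process.  The noise grows
  subexponentially, and \<open>R \<omega> = sup {exp (\<delta> / 2 * s) (1 + |z(\<theta>\<^sub>s \<omega>)|\<^sup>2). s \<le> 0}\<close> is finite.  It decreases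
  along orbits only at rate \<open>\<delta> / 2\<close>, so that a suitable multiple of it is a supersolution
  (\<open>energy_decay\<close>).  Therefore the sets \<open>B \<omega>\<close> of energy at most a constant times \<open>R \<omega>\<close> are forward
  invariant, compact in the cylinder, and absorb every tempered set.

  Attractor: \<open>A \<omega>\<close> is the intersection of the decreasing compact sets
  \<open>\<phi> n (\<theta> (- n) \<omega>) ` B (\<theta> (- n) \<omega>)\<close> (\<open>absorbing_compact_imp_attractor\<close>).  Its distance function is the
  supremum of theirs, and each of these is an infimum over a countable dense set of initial values.

  Measurability: solutions are pointwise limits of Picard iterates, which are jointly measurable in
  time, noise and initial value (\<open>measurable_lipschitz_ode_solution\<close>), and a Borel section of the
  projection carries this over to the cylinder.
\<close>

section \<open>Random attractors from compact absorbing sets\<close>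

lemma nested_compact_Int_closedin:
  assumes haus: "Hausdorff_space T" and comp: "\<And>n. compactin T (K n)" and dec: "decseq K"
    and F: "closedin T F" and ne: "\<And>n::nat. K n \<inter> F \<noteq> {}"
  shows "(\<Inter>n. K n) \<inter> F \<noteq> {}"
proof -
  have "compact_space (subtopology T (K 0))"
    using comp by (simp add: compact_space_subtopology)
  moreover have "closedin (subtopology T (K 0)) (K n \<inter> F)" for n
    using dec F compactin_imp_closedin[OF haus comp]
    by (intro closedin_subset_topspace closedin_Int) (auto simp: decseq_def)
  moreover have "decseq (\<lambda>n. K n \<inter> F)"
    using dec by (fastforce simp: decseq_def)
  ultimately have "(\<Inter>n. K n \<inter> F) \<noteq> {}"
    using ne by (intro compact_space_imp_nest) auto
  then show ?thesis by auto
qed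

lemma point_dist_antimono: "S \<subseteq> S' \<Longrightarrow> point_dist d x S' \<le> point_dist d x S"
  unfolding point_dist_def by (rule INF_superset_mono) auto

text \<open>
  For a decreasing sequence of compact sets the distance to the intersection is a countable
  supremum; this is where measurability of the attractor comes from.
\<close>

lemma point_dist_nested_Inter:
  assumes "Metric_space X d" and x: "x \<in> X"
    and comp: "\<And>n. compactin (Metric_space.mtopology X d) (K n)" and dec: "decseq K"
  shows "point_dist d x (\<Inter>n. K n) = (SUP n::nat. point_dist d x (K n))"
proof (rule antisym)
  interpret Metric_space X d by fact
  show "(SUP n. point_dist d x (K n)) \<le> point_dist d x (\<Inter>n. K n)"
    by (intro SUP_least point_dist_antimono) auto
  show "point_dist d x (\<Inter>n. K n) \<le> (SUP n. point_dist d x (K n))"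
  proof (rule dense_ge)
    fix s assume s: "(SUP n. point_dist d x (K n)) < s"
    show "point_dist d x (\<Inter>n. K n) \<le> s"
    proof (cases "s = \<infinity>")
      case False
      then obtain r where r: "s = ennreal r" "0 \<le> r" by (cases s) auto
      have "K n \<inter> mcball x r \<noteq> {}" for n
      proof -
        have "point_dist d x (K n) < s"
          using s by (meson SUP_upper UNIV_I le_less_trans)
        then obtain y where y: "y \<in> K n" "ennreal (d x y) < s"
          unfolding point_dist_def INF_less_iff by auto
        then have "d x y \<le> r" using r by (simp add: ennreal_less_iff)
        moreover have "y \<in> X"
          using y comp compactin_subset_topspace topspace_mtopology by blast
        ultimately show ?thesis using x y by auto
      qed
      then have "(\<Inter>n. K n) \<inter> mcball x r \<noteq> {}"
        by (rule nested_compact_Int_closedin[OF Hausdorff_space_mtopology comp dec closedin_mcball])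
      then obtain y where "y \<in> (\<Inter>n. K n)" "d x y \<le> r" by auto
      then show ?thesis
        unfolding point_dist_def r(1) by (intro INF_lower2[of y]) (auto intro: ennreal_leI)
    qed simp
  qed
qed

text \<open>
  The attractor is the decreasing intersection of the images \<open>K t \<omega>\<close>, under the flow up to time
  \<open>0\<close>, of the absorbing set \<open>B\<close> placed at time \<open>- t\<close>.  Forward invariance of \<open>B\<close> makes
  \<open>K t \<omega>\<close> decreasing in \<open>t\<close>, so that integer times suffice.  No measurability of \<open>\<theta>\<close> is used, and
  absorption is only required at those \<open>\<omega>\<close> at which the growth condition holds.
\<close>

theorem absorbing_compact_imp_attractor:
  assumes rds: "rds M \<theta> X d \<phi>"
    and \<theta>_in: "\<And>\<omega> t. \<omega> \<in> space M \<Longrightarrow> \<theta> t \<omega> \<in> space M"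
    and \<theta>_add: "\<And>\<omega> s t. \<omega> \<in> space M \<Longrightarrow> \<theta> s (\<theta> t \<omega>) = \<theta> (s + t) \<omega>"
    and \<theta>_0: "\<And>\<omega>. \<omega> \<in> space M \<Longrightarrow> \<theta> 0 \<omega> = \<omega>"
    and comp: "\<And>\<omega>. \<omega> \<in> space M \<Longrightarrow> compactin (Metric_space.mtopology X d) (B \<omega>)"
    and inv: "\<And>\<omega> t. \<omega> \<in> space M \<Longrightarrow> 0 \<le> t \<Longrightarrow> \<phi> t \<omega> ` B \<omega> \<subseteq> B (\<theta> t \<omega>)"
    and meas: "\<And>x n. x \<in> X \<Longrightarrow>
      (\<lambda>\<omega>. point_dist d x (\<phi> (real n) (\<theta> (- real n) \<omega>) ` B (\<theta> (- real n) \<omega>))) \<in> borel_measurable M"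
    and absorb: "\<And>\<omega> D x0. \<omega> \<in> space M \<Longrightarrow> (\<And>\<omega>. \<omega> \<in> space M \<Longrightarrow> D \<omega> \<subseteq> X) \<Longrightarrow> x0 \<in> X \<Longrightarrow>
      tempered_at \<theta> d D x0 \<omega> \<Longrightarrow>
      \<exists>T\<ge>0. \<forall>t\<ge>T. \<phi> t (\<theta> (- t) \<omega>) ` D (\<theta> (- t) \<omega>) \<subseteq> B \<omega>"
  shows "\<exists>A. global_random_attractor M \<theta> X d \<phi> A"
proof -
  interpret Metric_space X d using rds by (simp add: rds_def)
  have cont: "continuous_map mtopology mtopology (\<phi> t \<omega>)" if "\<omega> \<in> space M" "0 \<le> t" for t \<omega>
    using rds that by (simp add: rds_def)
  have cocycle: "\<phi> (t + s) \<omega> x = \<phi> t (\<theta> s \<omega>) (\<phi> s \<omega> x)"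
    if "\<omega> \<in> space M" "0 \<le> s" "0 \<le> t" "x \<in> X" for t s \<omega> x
    using rds that by (simp add: rds_def)
  have BX: "B \<omega> \<subseteq> X" if "\<omega> \<in> space M" for \<omega>
    using compactin_subset_topspace[OF comp[OF that]] by simp
  define K where "K t \<omega> = \<phi> t (\<theta> (- t) \<omega>) ` B (\<theta> (- t) \<omega>)" for t \<omega>
  define A where "A \<omega> = (\<Inter>n. K (real n) \<omega>)" for \<omega>
  have K_comp: "compactin mtopology (K t \<omega>)" if "\<omega> \<in> space M" "0 \<le> t" for t \<omega>
    unfolding K_def using that by (intro image_compactin[OF comp cont] \<theta>_in)
  have KX: "K t \<omega> \<subseteq> X" if "\<omega> \<in> space M" "0 \<le> t" for t \<omega>
    using compactin_subset_topspace[OF K_comp[OF that]] by simp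
  \<comment> \<open>pulling a set from time \<open>- (t + s)\<close> to \<open>0\<close> passes through time \<open>- s\<close>\<close>
  have pull: "\<phi> (t + s) (\<theta> (- (t + s)) \<omega>) ` S = \<phi> t (\<theta> (- t) \<omega>) ` (\<phi> s (\<theta> (- s) (\<theta> (- t) \<omega>)) ` S)"
    if "\<omega> \<in> space M" "0 \<le> s" "0 \<le> t" "S \<subseteq> X" for s t \<omega> S
  proof -
    have "\<phi> (t + s) (\<theta> (- (t + s)) \<omega>) x = \<phi> t (\<theta> (- t) \<omega>) (\<phi> s (\<theta> (- s) (\<theta> (- t) \<omega>)) x)" if "x \<in> S" for x
      using cocycle[of "\<theta> (- (t + s)) \<omega>" s t x] that \<open>S \<subseteq> X\<close> \<open>0 \<le> s\<close> \<open>0 \<le> t\<close> \<open>\<omega> \<in> space M\<close>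
      by (auto simp: \<theta>_in \<theta>_add algebra_simps)
    then show ?thesis by (force simp: image_image)
  qed
  have K_dec: "K (t + s) \<omega> \<subseteq> K t \<omega>" if "\<omega> \<in> space M" "0 \<le> s" "0 \<le> t" for s t \<omega>
  proof -
    have "\<phi> s (\<theta> (- s) (\<theta> (- t) \<omega>)) ` B (\<theta> (- s) (\<theta> (- t) \<omega>)) \<subseteq> B (\<theta> s (\<theta> (- s) (\<theta> (- t) \<omega>)))"
      by (intro inv \<theta>_in that)
    also have "\<theta> s (\<theta> (- s) (\<theta> (- t) \<omega>)) = \<theta> (- t) \<omega>"
      using that by (simp add: \<theta>_add \<theta>_in \<theta>_0)
    finally have "\<phi> t (\<theta> (- t) \<omega>) ` (\<phi> s (\<theta> (- s) (\<theta> (- t) \<omega>)) ` B (\<theta> (- s) (\<theta> (- t) \<omega>)))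
        \<subseteq> \<phi> t (\<theta> (- t) \<omega>) ` B (\<theta> (- t) \<omega>)"
      by (rule image_mono)
    moreover have "B (\<theta> (- (t + s)) \<omega>) \<subseteq> X" "\<theta> (- s) (\<theta> (- t) \<omega>) = \<theta> (- (t + s)) \<omega>"
      using that by (simp_all add: BX \<theta>_in \<theta>_add algebra_simps)
    ultimately show ?thesis
      unfolding K_def using pull[OF that(1,2,3), of "B (\<theta> (- (t + s)) \<omega>)"] by simp
  qed
  have K_decseq: "decseq (\<lambda>n. K (real n) \<omega>)" if "\<omega> \<in> space M" for \<omega>
    unfolding decseq_Suc_iff using K_dec[OF that, of 1 "real _"] by (simp add: add.commute)
  have A_comp: "compactin mtopology (A \<omega>)" if "\<omega> \<in> space M" for \<omega>
  proof (rule closed_compactin)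
    show "compactin mtopology (K (real 0) \<omega>)" using that by (intro K_comp) auto
    show "closedin mtopology (A \<omega>)"
      unfolding A_def using that
      by (intro closedin_INT compactin_imp_closedin[OF Hausdorff_space_mtopology] K_comp) auto
    show "A \<omega> \<subseteq> K (real 0) \<omega>" unfolding A_def by (rule INT_lower) simp
  qed
  have AX: "A \<omega> \<subseteq> X" if "\<omega> \<in> space M" for \<omega>
    using compactin_subset_topspace[OF A_comp[OF that]] by simp
  have A_set: "random_set M X d A"
    unfolding random_set_def
  proof (intro conjI ballI)
    fix x assume x: "x \<in> X"
    have "(\<lambda>\<omega>. SUP n. point_dist d x (K (real n) \<omega>)) \<in> borel_measurable M"
      using meas[OF x] unfolding K_def by (intro borel_measurable_SUP) auto
    also have "?this \<longleftrightarrow> (\<lambda>\<omega>. point_dist d x (A \<omega>)) \<in> borel_measurable M"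
      unfolding A_def using x
      by (intro measurable_cong point_dist_nested_Inter[OF Metric_space_axioms, symmetric] K_decseq K_comp) auto
    finally show "(\<lambda>\<omega>. point_dist d x (A \<omega>)) \<in> borel_measurable M" .
  qed (rule AX)
  have A_inv: "\<phi> t \<omega> ` A \<omega> = A (\<theta> t \<omega>)" if \<omega>: "\<omega> \<in> space M" and t: "0 \<le> t" for t \<omega>
  proof -
    have push: "\<phi> t \<omega> ` K s \<omega> = K (t + s) (\<theta> t \<omega>)" if s: "0 \<le> s" for s
      using pull[of "\<theta> t \<omega>" s t "B (\<theta> (- s) \<omega>)"] \<omega> t s
      by (simp add: K_def \<theta>_in \<theta>_add \<theta>_0 BX)
    show ?thesis
    proof (intro antisym subsetI)
      fix y assume "y \<in> \<phi> t \<omega> ` A \<omega>"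
      then obtain x where x: "y = \<phi> t \<omega> x" "\<And>n. x \<in> K (real n) \<omega>" by (auto simp: A_def)
      have "y \<in> K (real n) (\<theta> t \<omega>)" for n
      proof -
        have "y \<in> K (t + real n) (\<theta> t \<omega>)"
          using x push[of "real n"] by auto
        then show ?thesis using K_dec[of "\<theta> t \<omega>" t "real n"] \<omega> t \<theta>_in by (auto simp: algebra_simps)
      qed
      then show "y \<in> A (\<theta> t \<omega>)" by (simp add: A_def)
    next
      fix y assume y: "y \<in> A (\<theta> t \<omega>)"
      \<comment> \<open>the fibre over \<open>y\<close> meets every \<open>K n \<omega>\<close>, hence also their intersection\<close>
      define F where "F = {x \<in> X. \<phi> t \<omega> x \<in> {y}}"
      have F: "closedin mtopology F"
      proof -
        have "y \<in> X" using y AX[of "\<theta> t \<omega>"] \<omega> \<theta>_in by auto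
        then have "closedin mtopology {y}"
          by (simp add: closedin_Hausdorff_sing_eq Hausdorff_space_mtopology)
        from closedin_continuous_map_preimage[OF cont[OF \<omega> t] this] show ?thesis
          by (simp add: F_def)
      qed
      have "K (real n) \<omega> \<inter> F \<noteq> {}" for n
      proof -
        obtain m :: nat where m: "real m \<ge> t + real n" using real_arch_simple by blast
        have "y \<in> K (real m) (\<theta> t \<omega>)" using y by (simp add: A_def)
        then have "y \<in> K (t + real n) (\<theta> t \<omega>)"
          using K_dec[of "\<theta> t \<omega>" "real m - (t + real n)" "t + real n"] m t \<omega> \<theta>_in by auto
        then obtain x where "x \<in> K (real n) \<omega>" "\<phi> t \<omega> x = y"
          using push[of "real n"] by (metis imageE of_nat_0_le_iff)
        then show ?thesis using KX[OF \<omega>, of "real n"] by (auto simp: F_def)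
      qed
      then have "(\<Inter>n. K (real n) \<omega>) \<inter> F \<noteq> {}"
        using \<omega> by (intro nested_compact_Int_closedin[OF Hausdorff_space_mtopology _ K_decseq F] K_comp) auto
      then show "y \<in> \<phi> t \<omega> ` A \<omega>" by (auto simp: A_def F_def)
    qed
  qed
  have A_attr: "((\<lambda>t. semi_hausdorff d (\<phi> t (\<theta> (- t) \<omega>) ` D (\<theta> (- t) \<omega>)) (A \<omega>)) \<longlongrightarrow> 0) at_top"
    if DX: "\<And>\<omega>. \<omega> \<in> space M \<Longrightarrow> D \<omega> \<subseteq> X" and \<omega>: "\<omega> \<in> space M" and x0: "x0 \<in> X"
      and temp: "tempered_at \<theta> d D x0 \<omega>" for D \<omega> x0
  proof (rule order_tendstoI)
    fix e :: ennreal assume e: "0 < e"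
    then obtain r' where r': "0 < r'" "r' < e" using dense by blast
    then obtain r where r: "r' = ennreal r" "0 < r"
      by (cases r') (auto simp: ennreal_less_iff top_unique)
    \<comment> \<open>by compactness, one of the sets \<open>K n \<omega>\<close> already lies in the \<open>r\<close>-neighbourhood of \<open>A \<omega>\<close>\<close>
    define F where "F = X - (\<Union>a\<in>A \<omega>. mball a r)"
    have F: "closedin mtopology F"
      unfolding F_def using closedin_diff[OF closedin_topspace, of mtopology] by auto
    have "(\<Inter>n. K (real n) \<omega>) \<inter> F = {}"
      using r AX[OF \<omega>] by (auto simp: F_def A_def[symmetric] subset_iff)
    then obtain n where n: "K (real n) \<omega> \<inter> F = {}"
      using nested_compact_Int_closedin[OF Hausdorff_space_mtopology _ K_decseq[OF \<omega>] F] K_comp[OF \<omega>]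
      by (meson of_nat_0_le_iff)
    \<comment> \<open>absorption is applied at \<open>\<theta> (- n) \<omega>\<close>, where the growth condition still holds\<close>
    have temp': "tempered_at \<theta> d D x0 (\<theta> (- real n) \<omega>)"
      unfolding tempered_at_def
    proof (intro allI impI)
      fix b :: real assume b: "0 < b"
      define h where "h t = ennreal (exp (- b * t)) * (SUP x\<in>D (\<theta> (- t) \<omega>). ennreal (d x x0))" for t
      have "(h \<longlongrightarrow> 0) at_top"
        using temp b unfolding tempered_at_def h_def by blast
      moreover have "filterlim (\<lambda>t. t + real n) at_top at_top"
        using filterlim_tendsto_add_at_top[OF tendsto_const filterlim_ident, of "real n"]
        by (simp add: add.commute)
      ultimately have "((\<lambda>t. h (t + real n)) \<longlongrightarrow> 0) at_top"
        by (rule filterlim_compose)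
      then have "((\<lambda>t. ennreal (exp (b * real n)) * h (t + real n)) \<longlongrightarrow> ennreal (exp (b * real n)) * 0) at_top"
        by (intro tendsto_mult_ennreal tendsto_const) auto
      moreover have "ennreal (exp (b * real n)) * h (t + real n) =
          ennreal (exp (- b * t)) * (SUP x\<in>D (\<theta> (- t) (\<theta> (- real n) \<omega>)). ennreal (d x x0))" for t
      proof -
        have "ennreal (exp (b * real n)) * ennreal (exp (- b * (t + real n))) = ennreal (exp (- b * t))"
          by (simp add: ennreal_mult[symmetric] exp_add[symmetric] algebra_simps)
        moreover have "\<theta> (- t) (\<theta> (- real n) \<omega>) = \<theta> (- (t + real n)) \<omega>"
          using \<omega> by (simp add: \<theta>_add)
        ultimately show ?thesis by (simp add: h_def mult.assoc[symmetric])
      qed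
      ultimately show "((\<lambda>t. ennreal (exp (- b * t)) *
          (SUP x\<in>D (\<theta> (- t) (\<theta> (- real n) \<omega>)). ennreal (d x x0))) \<longlongrightarrow> 0) at_top"
        by simp
    qed
    obtain T where T: "0 \<le> T"
      "\<And>t. T \<le> t \<Longrightarrow> \<phi> t (\<theta> (- t) (\<theta> (- real n) \<omega>)) ` D (\<theta> (- t) (\<theta> (- real n) \<omega>)) \<subseteq> B (\<theta> (- real n) \<omega>)"
      using absorb[OF \<theta>_in[OF \<omega>] DX x0 temp'] by blast
    have "semi_hausdorff d (\<phi> t (\<theta> (- t) \<omega>) ` D (\<theta> (- t) \<omega>)) (A \<omega>) \<le> r'" if t: "T + real n \<le> t" for t
      unfolding semi_hausdorff_def
    proof (rule SUP_least)
      fix x assume "x \<in> \<phi> t (\<theta> (- t) \<omega>) ` D (\<theta> (- t) \<omega>)"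
      also have "\<dots> = \<phi> (real n) (\<theta> (- real n) \<omega>) ` (\<phi> (t - real n) (\<theta> (- (t - real n)) (\<theta> (- real n) \<omega>)) ` D (\<theta> (- t) \<omega>))"
        using pull[of \<omega> "t - real n" "real n" "D (\<theta> (- t) \<omega>)"] \<omega> t T(1) by (simp add: \<theta>_in DX)
      also have "D (\<theta> (- t) \<omega>) = D (\<theta> (- (t - real n)) (\<theta> (- real n) \<omega>))"
        using \<omega> by (simp add: \<theta>_add)
      also have "\<phi> (real n) (\<theta> (- real n) \<omega>) ` (\<phi> (t - real n) (\<theta> (- (t - real n)) (\<theta> (- real n) \<omega>)) ` \<dots>) \<subseteq> K (real n) \<omega>"
        unfolding K_def using t by (intro image_mono T) simp
      finally have "x \<in> K (real n) \<omega>" .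
      moreover have "x \<in> X" using calculation KX[OF \<omega>, of "real n"] by auto
      ultimately have "x \<in> (\<Union>a\<in>A \<omega>. mball a r)" using n unfolding F_def by blast
      then obtain a where a: "a \<in> A \<omega>" "d a x < r" by auto
      then show "point_dist d x (A \<omega>) \<le> r'"
        unfolding point_dist_def r(1)
        by (intro INF_lower2[OF a(1)] ennreal_leI) (simp add: commute)
    qed
    then show "\<forall>\<^sub>F t in at_top. semi_hausdorff d (\<phi> t (\<theta> (- t) \<omega>) ` D (\<theta> (- t) \<omega>)) (A \<omega>) < e"
      unfolding eventually_at_top_linorder using r'(2) by (meson le_less_trans)
  qed simp
  have "global_random_attractor M \<theta> X d \<phi> A"
    unfolding global_random_attractor_def random_compact_set_def random_attracting_set_def
    using A_set A_comp A_inv A_attr by (auto simp: random_set_def)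
  then show ?thesis by (rule exI[of _ A])
qed

section \<open>Quotients of Euclidean spaces by a translation\<close>

lemma is_norm_uminus: "is_norm \<nu> \<Longrightarrow> \<nu> (- x) = \<nu> x"
proof -
  assume "is_norm \<nu>"
  then have "\<nu> ((-1) *\<^sub>R x) = \<bar>-1\<bar> * \<nu> x" unfolding is_norm_def by blast
  then show ?thesis by simp
qed

lemma is_norm_minus_commute: "is_norm \<nu> \<Longrightarrow> \<nu> (x - y) = \<nu> (y - x)"
  using is_norm_uminus[of \<nu> "x - y"] by simp

lemma is_norm_triangle: "is_norm \<nu> \<Longrightarrow> \<nu> (x + y) \<le> \<nu> x + \<nu> y"
  unfolding is_norm_def by blast

lemma is_norm_scaleR: "is_norm \<nu> \<Longrightarrow> \<nu> (c *\<^sub>R x) = \<bar>c\<bar> * \<nu> x"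
  unfolding is_norm_def by blast

lemma is_norm_eq_0: "is_norm \<nu> \<Longrightarrow> \<nu> x = 0 \<longleftrightarrow> x = 0"
  unfolding is_norm_def by blast

lemma is_norm_0: "is_norm \<nu> \<Longrightarrow> \<nu> 0 = 0"
  by (simp add: is_norm_eq_0)

lemma is_norm_nonneg: "is_norm \<nu> \<Longrightarrow> 0 \<le> \<nu> x"
  using is_norm_triangle[of \<nu> x "- x"] is_norm_uminus[of \<nu> x] is_norm_eq_0[of \<nu> 0] by simp

lemma is_norm_sum: "is_norm \<nu> \<Longrightarrow> \<nu> (sum h I) \<le> (\<Sum>i\<in>I. \<nu> (h i))"
proof (induction I rule: infinite_finite_induct)
  case (insert i I)
  then show ?case using is_norm_triangle[of \<nu> "h i" "sum h I"] by simp
qed (simp_all add: is_norm_0)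

lemma is_norm_bounded_above:
  fixes \<nu> :: "'a::euclidean_space \<Rightarrow> real"
  assumes "is_norm \<nu>"
  obtains b where "b > 0" "\<And>x. \<nu> x \<le> b * norm x"
proof
  show "0 < 1 + (\<Sum>i\<in>Basis. \<nu> i)"
    by (intro add_pos_nonneg sum_nonneg is_norm_nonneg assms) simp
  fix x
  have "\<nu> x = \<nu> (\<Sum>i\<in>Basis. (x \<bullet> i) *\<^sub>R i)" by (simp add: euclidean_representation)
  also have "\<dots> \<le> (\<Sum>i\<in>Basis. \<nu> ((x \<bullet> i) *\<^sub>R i))" by (rule is_norm_sum[OF assms])
  also have "\<dots> \<le> (\<Sum>i\<in>Basis. norm x * \<nu> i)"
    by (intro sum_mono) (auto simp: is_norm_scaleR[OF assms] Basis_le_norm is_norm_nonneg[OF assms] intro!: mult_right_mono)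
  also have "\<dots> \<le> (1 + (\<Sum>i\<in>Basis. \<nu> i)) * norm x"
    by (simp add: sum_distrib_left algebra_simps)
  finally show "\<nu> x \<le> (1 + (\<Sum>i\<in>Basis. \<nu> i)) * norm x" .
qed

lemma is_norm_continuous:
  fixes \<nu> :: "'a::euclidean_space \<Rightarrow> real"
  assumes "is_norm \<nu>"
  shows "continuous_on S \<nu>"
proof -
  obtain b where b: "b > 0" "\<And>x. \<nu> x \<le> b * norm x" using is_norm_bounded_above[OF assms] by blast
  have "\<bar>\<nu> x - \<nu> y\<bar> \<le> b * norm (x - y)" for x y
    using is_norm_triangle[OF assms, of "x - y" y] is_norm_triangle[OF assms, of "y - x" x]
      b(2)[of "x - y"] is_norm_minus_commute[OF assms, of x y] by simp
  then have "b-lipschitz_on S \<nu>"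
    using b(1) by (intro lipschitz_onI) (auto simp: dist_norm)
  then show ?thesis by (rule lipschitz_on_continuous_on)
qed

text \<open>All norms on a Euclidean space are equivalent: the lower bound is compactness of the sphere.\<close>

lemma is_norm_bounded_below:
  fixes \<nu> :: "'a::euclidean_space \<Rightarrow> real"
  assumes "is_norm \<nu>"
  obtains a where "a > 0" "\<And>x. a * norm x \<le> \<nu> x"
proof -
  have "sphere (0::'a) 1 \<noteq> {}" using norm_Basis[OF SOME_Basis] by force
  then obtain s where s: "s \<in> sphere 0 1" "\<And>x. x \<in> sphere 0 1 \<Longrightarrow> \<nu> s \<le> \<nu> x"
    using continuous_attains_inf[OF compact_sphere _ is_norm_continuous[OF assms]] by metis
  have "0 < \<nu> s"
    using s(1) is_norm_nonneg[OF assms, of s] is_norm_eq_0[OF assms, of s] by (auto simp: less_le)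
  moreover have "\<nu> s * norm x \<le> \<nu> x" for x
  proof (cases "x = 0")
    case False
    then have "\<nu> s \<le> \<nu> ((1 / norm x) *\<^sub>R x)" by (intro s(2)) simp
    then show ?thesis using False by (simp add: is_norm_scaleR[OF assms] field_simps)
  qed (simp add: is_norm_0[OF assms])
  ultimately show ?thesis by (rule that)
qed

text \<open>
  The quotient of a Euclidean space by the translations \<open>y \<mapsto> y + k e\<close>, \<open>k \<in> \<int>\<close>, presented by its
  projection \<open>p\<close>, with the quotient \<open>d\<close> of a norm \<open>\<nu>\<close>.  The linear functional \<open>c\<close> with \<open>c e = 1\<close>
  measures the coordinate along \<open>e\<close>.  Nonnegativity and symmetry of \<open>d\<close> are assumed for all
  arguments, as \<^locale>\<open>Metric_space\<close> requires them also off the carrier \<open>range p\<close>.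
\<close>

locale cyclic_quotient =
  fixes p :: "'a::euclidean_space \<Rightarrow> 'x" and e :: 'a and c :: "'a \<Rightarrow> real"
    and \<nu> :: "'a \<Rightarrow> real" and d :: "'x \<Rightarrow> 'x \<Rightarrow> real"
  assumes norm_\<nu>: "is_norm \<nu>"
    and linear_c: "linear c" and c_e: "c e = 1"
    and p_eq_iff: "p y = p y' \<longleftrightarrow> (\<exists>k::int. y' = y + of_int k *\<^sub>R e)"
    and d_p: "d (p y) (p y') = (INF k::int. \<nu> (y - y' + of_int k *\<^sub>R e))"
    and d_nonneg: "0 \<le> d x x'" and d_commute: "d x x' = d x' x"
begin

lemma bdd_below_\<nu>: "bdd_below (range (\<lambda>k. \<nu> (h k)))"
  by (rule bdd_belowI2[of _ 0]) (rule is_norm_nonneg[OF norm_\<nu>])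

lemma d_le: "d (p y) (p y') \<le> \<nu> (y - y')"
  unfolding d_p using cINF_lower[OF bdd_below_\<nu>, of 0 "\<lambda>k::int. y - y' + of_int k *\<^sub>R e"] by simp

lemma d_lift:
  assumes "d (p y) (p y') < r"
  obtains y'' where "p y'' = p y'" "\<nu> (y - y'') < r"
proof -
  obtain k :: int where k: "\<nu> (y - y' + of_int k *\<^sub>R e) < r"
    using assms unfolding d_p by (auto simp: cINF_less_iff[OF _ bdd_below_\<nu>])
  have "p (y' - of_int k *\<^sub>R e) = p y'" by (auto simp: p_eq_iff intro: exI[of _ k])
  moreover have "\<nu> (y - (y' - of_int k *\<^sub>R e)) < r" using k by (simp add: algebra_simps)
  ultimately show ?thesis by (rule that)
qed

lemma \<nu>_e_pos: "0 < \<nu> e"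
proof -
  have "e \<noteq> 0" using c_e linear_0[OF linear_c] by auto
  then show ?thesis
    using is_norm_nonneg[OF norm_\<nu>, of e] is_norm_eq_0[OF norm_\<nu>, of e] by simp
qed

lemma d_eq_0_imp: "p y = p y'" if d0: "d (p y) (p y') = 0"
proof -
  have *: "\<exists>k::int. \<nu> (y - y' + of_int k *\<^sub>R e) < r" if "0 < r" for r
  proof -
    have "(INF k::int. \<nu> (y - y' + of_int k *\<^sub>R e)) < r" using that d0 by (simp add: d_p)
    then show ?thesis by (simp add: cINF_less_iff[OF _ bdd_below_\<nu>])
  qed
  obtain k :: int where k: "\<nu> (y - y' + of_int k *\<^sub>R e) < \<nu> e / 2" using *[of "\<nu> e / 2"] \<nu>_e_pos by auto
  \<comment> \<open>translates by \<open>e\<close> are \<open>\<nu> e\<close> apart, so that the same \<open>k\<close> serves for all smaller radii\<close>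
  have "\<nu> (y - y' + of_int k *\<^sub>R e) \<le> r" if r: "0 < r" for r
  proof -
    obtain k' :: int where k': "\<nu> (y - y' + of_int k' *\<^sub>R e) < min r (\<nu> e / 2)"
      using *[of "min r (\<nu> e / 2)"] r \<nu>_e_pos by auto
    have "\<bar>of_int (k - k')\<bar> * \<nu> e = \<nu> ((y - y' + of_int k *\<^sub>R e) + - (y - y' + of_int k' *\<^sub>R e))"
    proof -
      have "(y - y' + of_int k *\<^sub>R e) + - (y - y' + of_int k' *\<^sub>R e) = of_int (k - k') *\<^sub>R e"
        by (simp add: algebra_simps)
      then show ?thesis by (simp only: is_norm_scaleR[OF norm_\<nu>])
    qed
    also have "\<dots> \<le> \<nu> (y - y' + of_int k *\<^sub>R e) + \<nu> (y - y' + of_int k' *\<^sub>R e)"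
      using is_norm_triangle[OF norm_\<nu>] is_norm_uminus[OF norm_\<nu>] by metis
    also have "\<dots> < 1 * \<nu> e" using k k' by simp
    finally have "\<bar>real_of_int (k - k')\<bar> < 1" using \<nu>_e_pos by (simp only: mult_less_cancel_right_pos)
    then have "k = k'" by linarith
    then show ?thesis using k' by simp
  qed
  then have "\<nu> (y - y' + of_int k *\<^sub>R e) \<le> 0" by (rule dense_ge)
  then have "y - y' + of_int k *\<^sub>R e = 0"
    using is_norm_nonneg[OF norm_\<nu>, of "y - y' + of_int k *\<^sub>R e"] is_norm_eq_0[OF norm_\<nu>] by simp
  then have "(y - y' + of_int k *\<^sub>R e) + y' = y'" by simp
  then have "y' = y + of_int k *\<^sub>R e" by (simp add: algebra_simps)
  then show ?thesis by (auto simp: p_eq_iff)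
qed

sublocale Metric_space "range p" d
proof
  fix x y z assume "x \<in> range p" "y \<in> range p" "z \<in> range p"
  then obtain a b b' where x: "x = p a" and y: "y = p b" and z: "z = p b'" by auto
  show "d x y = 0 \<longleftrightarrow> x = y"
  proof
    assume "x = y"
    then show "d x y = 0"
      using d_le[of a a] d_nonneg[of x x] is_norm_eq_0[OF norm_\<nu>, of 0] x by simp
  qed (use d_eq_0_imp x y in auto)
  show "d x z \<le> d x y + d y z"
  proof (rule field_le_epsilon)
    fix r :: real assume r: "0 < r"
    have "d (p a) (p b) < d x y + r/2" "d (p b) (p b') < d y z + r/2" using r x y z by auto
    then obtain b1 where b1: "p b1 = p b" "\<nu> (a - b1) < d x y + r/2" by (blast elim: d_lift)
    have "d (p b1) (p b') < d y z + r/2" using r y z b1 by auto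
    then obtain b2 where b2: "p b2 = p b'" "\<nu> (b1 - b2) < d y z + r/2" by (blast elim: d_lift)
    have "d x z \<le> \<nu> (a - b2)" using d_le[of a b2] x z b2 by simp
    also have "\<dots> \<le> \<nu> (a - b1) + \<nu> (b1 - b2)"
      using is_norm_triangle[OF norm_\<nu>, of "a - b1" "b1 - b2"] by simp
    finally show "d x z \<le> d x y + d y z + r" using b1 b2 by simp
  qed
qed (rule d_nonneg d_commute)+

lemma continuous_map_p: "continuous_map euclidean mtopology p"
  unfolding continuous_map_to_metric
proof (intro ballI allI impI)
  fix y and r :: real assume r: "0 < r"
  obtain b where b: "b > 0" "\<And>x. \<nu> x \<le> b * norm x" using is_norm_bounded_above[OF norm_\<nu>] by blast
  show "\<exists>U. openin euclidean U \<and> y \<in> U \<and> (\<forall>y'\<in>U. p y' \<in> mball (p y) r)"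
  proof (intro exI conjI ballI)
    show "openin euclidean (ball y (r / b))" by simp
    fix y' assume "y' \<in> ball y (r / b)"
    then have "b * norm (y - y') < r" using b(1) by (simp add: dist_norm field_simps)
    then show "p y' \<in> mball (p y) r"
      using d_le[of y y'] b(2)[of "y - y'"] by simp
  qed (use r b(1) in simp)
qed

lemma compactin_image_p: "compact S \<Longrightarrow> compactin mtopology (p ` S)"
  by (rule image_compactin[OF _ continuous_map_p]) simp

text \<open>
  Points close in the quotient have representatives close in the Euclidean space.
\<close>

lemma continuous_map_descend:
  assumes cont: "continuous_on UNIV Y" and comm: "\<And>y. \<phi> (p y) = p (Y y)"
  shows "continuous_map mtopology mtopology \<phi>"
  unfolding continuous_map_to_metric
proof (intro ballI allI impI)
  fix x and r :: real assume "x \<in> topspace mtopology" and r: "0 < r"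
  then obtain y where x: "x = p y" by auto
  obtain a where a: "a > 0" "\<And>x. a * norm x \<le> \<nu> x" using is_norm_bounded_below[OF norm_\<nu>] by blast
  obtain b where b: "b > 0" "\<And>x. \<nu> x \<le> b * norm x" using is_norm_bounded_above[OF norm_\<nu>] by blast
  obtain s where s: "s > 0" "\<And>y'. dist y' y < s \<Longrightarrow> dist (Y y') (Y y) < r / b"
    using cont[unfolded continuous_on_iff, rule_format, OF UNIV_I divide_pos_pos[OF r b(1)], of y] by auto
  show "\<exists>U. openin mtopology U \<and> x \<in> U \<and> (\<forall>x'\<in>U. \<phi> x' \<in> mball (\<phi> x) r)"
  proof (intro exI conjI ballI)
    show "openin mtopology (mball x (a * s))" by simp
    show "x \<in> mball x (a * s)" using a(1) s(1) x by simp
    fix x' assume x': "x' \<in> mball x (a * s)"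
    then obtain y1 where y1: "x' = p y1" by auto
    obtain y' where y': "p y' = x'" "\<nu> (y - y') < a * s"
      using x' x y1 d_lift[of y y1 "a * s"] by auto
    then have "a * norm (y - y') < a * s" using a(2)[of "y - y'"] by linarith
    then have "dist y' y < s" using a(1) by (simp add: dist_norm norm_minus_commute)
    then have "b * norm (Y y - Y y') < r"
      using s(2)[of y'] b(1) by (simp add: dist_norm norm_minus_commute field_simps)
    then show "\<phi> x' \<in> mball (\<phi> x) r"
      using d_le[of "Y y" "Y y'"] b(2)[of "Y y - Y y'"] x y'(1) by (auto simp: comm)
  qed
qed

lemma mcomplete: "mcomplete"
  unfolding mcomplete_def
proof (intro allI impI)
  fix \<sigma> assume cau: "MCauchy \<sigma>"
  obtain a where a: "a > 0" "\<And>x. a * norm x \<le> \<nu> x" using is_norm_bounded_below[OF norm_\<nu>] by blast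
  have \<sigma>: "\<sigma> n \<in> range p" for n using cau by (auto simp: MCauchy_def)
  then have "\<forall>n. \<exists>y. \<sigma> n = p y" by auto
  then obtain y0 where y0: "\<And>n. \<sigma> n = p (y0 n)" by (auto simp: choice_iff)
  obtain N where "\<forall>n n'. N \<le> n \<longrightarrow> N \<le> n' \<longrightarrow> d (\<sigma> n) (\<sigma> n') < 1"
    using cau zero_less_one unfolding MCauchy_def by blast
  then have N: "\<And>n. n \<ge> N \<Longrightarrow> d (\<sigma> N) (\<sigma> n) < 1" by blast
  \<comment> \<open>lift the tail of the sequence to a bounded sequence\<close>
  have "\<exists>y. p y = \<sigma> n \<and> (n \<ge> N \<longrightarrow> \<nu> (y0 N - y) < 1)" for n
  proof (cases "n \<ge> N")
    case True
    then have "d (p (y0 N)) (p (y0 n)) < 1" using N y0 by metis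
    then obtain y where "p y = p (y0 n)" "\<nu> (y0 N - y) < 1" by (rule d_lift)
    then show ?thesis using y0 by auto
  qed (use y0 in auto)
  then have "\<forall>n. \<exists>y. p y = \<sigma> n \<and> (n \<ge> N \<longrightarrow> \<nu> (y0 N - y) < 1)" ..
  then obtain y where "\<forall>n. p (y n) = \<sigma> n \<and> (n \<ge> N \<longrightarrow> \<nu> (y0 N - y n) < 1)"
    unfolding choice_iff by blast
  then have y: "\<And>n. p (y n) = \<sigma> n" "\<And>n. n \<ge> N \<Longrightarrow> \<nu> (y0 N - y n) < 1" by auto
  have "y (n + N) \<in> cball (y0 N) (1 / a)" for n
    using y(2)[of "n + N"] a(2)[of "y0 N - y (n + N)"] a(1) by (simp add: dist_norm field_simps)
  then obtain l r where r: "strict_mono r" "((\<lambda>n. y (n + N)) \<circ> r) \<longlonglongrightarrow> l"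
    using compact_cball[of "y0 N" "1 / a"] unfolding compact_def by (metis (no_types, lifting))
  have "limitin euclidean ((\<lambda>n. y (n + N)) \<circ> r) l sequentially" using r by simp
  then have "limitin mtopology (p \<circ> ((\<lambda>n. y (n + N)) \<circ> r)) (p l) sequentially"
    by (rule continuous_map_limit[OF continuous_map_p])
  moreover have "p \<circ> ((\<lambda>n. y (n + N)) \<circ> r) = \<sigma> \<circ> (\<lambda>n. r n + N)" by (auto simp: y)
  moreover have "strict_mono (\<lambda>n. r n + N)" using r(1) by (auto simp: strict_mono_def)
  ultimately show "\<exists>x. limitin mtopology \<sigma> x sequentially"
    using MCauchy_convergent_subsequence[OF cau] by (metis (no_types, lifting))
qed

lemma separable: "separable_space mtopology"
proof (rule separable_space_continuous_map_image[OF _ continuous_map_p])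
  obtain D :: "'a set" where D: "countable D" "\<And>U. open U \<Longrightarrow> U \<noteq> {} \<Longrightarrow> \<exists>d\<in>D. d \<in> U"
    using countable_dense_setE by blast
  have "x \<in> closure D" for x
    unfolding closure_approachable
  proof (intro allI impI)
    fix r :: real assume "0 < r"
    then obtain y where "y \<in> D" "y \<in> ball x r"
      using D(2)[of "ball x r"] by auto
    then show "\<exists>y\<in>D. dist y x < r" by (auto simp: dist_commute)
  qed
  then have "closure D = UNIV" by auto
  then show "separable_space (euclidean :: 'a topology)"
    unfolding separable_space_def using D(1) by auto
qed simp

lemma openin_Pow: "{U. openin mtopology U} \<subseteq> Pow (range p)"
  using openin_subset[of mtopology] by auto

lemma open_in_metric_borel: "openin mtopology U \<Longrightarrow> U \<in> sets (metric_borel (range p) d)"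
  unfolding metric_borel_def
  by (subst sets_measure_of[OF openin_Pow]) auto

lemma space_metric_borel: "space (metric_borel (range p) d) = range p"
  unfolding metric_borel_def by (rule space_measure_of[OF openin_Pow])

lemma closed_in_metric_borel: "closedin mtopology C \<Longrightarrow> C \<in> sets (metric_borel (range p) d)"
proof -
  assume C: "closedin mtopology C"
  then have "range p - C \<in> sets (metric_borel (range p) d)"
    by (intro open_in_metric_borel) (auto simp: closedin_def)
  then have "space (metric_borel (range p) d) - (range p - C) \<in> sets (metric_borel (range p) d)"
    by (rule sets.compl_sets)
  moreover have "space (metric_borel (range p) d) - (range p - C) = C"
    using closedin_subset[OF C] by (auto simp: space_metric_borel)
  ultimately show ?thesis by simp
qed

lemma measurable_p: "p \<in> borel \<rightarrow>\<^sub>M metric_borel (range p) d"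
  unfolding metric_borel_def
proof (rule measurable_measure_of)
  fix U assume "U \<in> {U. openin mtopology U}"
  then have "openin euclidean {y \<in> topspace euclidean. p y \<in> U}"
    using continuous_map_p openin_continuous_map_preimage by blast
  then show "p -` U \<inter> space borel \<in> sets borel"
    by (simp add: vimage_def)
qed (use openin_Pow in auto)

text \<open>
  The section of \<open>p\<close> with values in the fundamental domain \<open>0 \<le> c y < 1\<close>.  It is discontinuous
  but Borel measurable: the fundamental domain is a countable union of closed strips, and the
  image under \<open>p\<close> of a compact piece of a strip is closed.
\<close>

definition sec :: "'x \<Rightarrow> 'a" where
  "sec x = (THE y. p y = x \<and> 0 \<le> c y \<and> c y < 1)"

lemma sec_eqI: "p y = x \<Longrightarrow> 0 \<le> c y \<Longrightarrow> c y < 1 \<Longrightarrow> sec x = y"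
  unfolding sec_def
proof (rule the_equality)
  fix y' assume y: "p y = x" "0 \<le> c y" "c y < 1" and y': "p y' = x \<and> 0 \<le> c y' \<and> c y' < 1"
  then obtain k :: int where k: "y' = y + of_int k *\<^sub>R e" using p_eq_iff by metis
  then have "c y' = c y + of_int k" by (simp add: linear_add[OF linear_c] linear_cmul[OF linear_c] c_e)
  with y y' have "k = 0" by linarith
  with k show "y' = y" by simp
qed auto

lemma sec: "p (sec (p y)) = p y" "0 \<le> c (sec (p y))" "c (sec (p y)) < 1"
proof -
  define y' where "y' = y - of_int \<lfloor>c y\<rfloor> *\<^sub>R e"
  have "p y' = p y" unfolding p_eq_iff y'_def by (rule exI[of _ "\<lfloor>c y\<rfloor>"]) simp
  moreover have "c y' = c y - of_int \<lfloor>c y\<rfloor>"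
    by (simp add: y'_def linear_diff[OF linear_c] linear_cmul[OF linear_c] c_e)
  then have "0 \<le> c y'" "c y' < 1" by linarith+
  ultimately show "p (sec (p y)) = p y" "0 \<le> c (sec (p y))" "c (sec (p y)) < 1"
    using sec_eqI by metis+
qed

lemma measurable_sec: "sec \<in> metric_borel (range p) d \<rightarrow>\<^sub>M borel"
proof (rule borel_measurableI)
  fix U :: "'a set" assume "open U"
  then obtain \<D> where \<D>: "countable \<D>" "\<And>X. X \<in> \<D> \<Longrightarrow> \<exists>a b. X = cbox a b" "\<Union>\<D> = U"
    using open_countable_Union_open_cbox by metis
  have cont: "continuous_on UNIV c" by (simp add: linear_c linear_continuous_on linear_conv_bounded_linear[symmetric])
  define F where "F n = {y. 0 \<le> c y \<and> c y \<le> 1 - 1 / real (Suc n)}" for n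
  have F_closed: "closed (F n)" for n
    unfolding F_def using cont by (intro closed_Collect_conj closed_Collect_le continuous_intros)
  have "sec -` U \<inter> space (metric_borel (range p) d) = (\<Union>X\<in>\<D>. \<Union>n. p ` (X \<inter> F n))"
  proof (intro antisym subsetI)
    fix x assume x: "x \<in> sec -` U \<inter> space (metric_borel (range p) d)"
    then obtain y where y: "x = p y" by (auto simp: space_metric_borel)
    obtain n where "inverse (real (Suc n)) < 1 - c (sec x)"
      using sec(3)[of y] y reals_Archimedean[of "1 - c (sec x)"] by auto
    then have "sec x \<in> F n" using sec(2)[of y] y by (auto simp: F_def field_simps)
    moreover obtain X where "X \<in> \<D>" "sec x \<in> X" using x \<D>(3) by auto
    moreover have "x = p (sec x)" using sec(1) y by simp
    ultimately show "x \<in> (\<Union>X\<in>\<D>. \<Union>n. p ` (X \<inter> F n))" by blast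
  next
    fix x assume "x \<in> (\<Union>X\<in>\<D>. \<Union>n. p ` (X \<inter> F n))"
    then obtain X n y where y: "X \<in> \<D>" "y \<in> X" "y \<in> F n" "x = p y" by auto
    have "1 - 1 / real (Suc n) < 1" by simp
    then have "0 \<le> c y" "c y < 1" using y(3) \<open>1 - 1 / real (Suc n) < 1\<close> unfolding F_def
      by (blast, blast intro: le_less_trans)
    then have "sec x = y" using y(4) by (intro sec_eqI) auto
    then show "x \<in> sec -` U \<inter> space (metric_borel (range p) d)"
      using y \<D>(3) by (auto simp: space_metric_borel)
  qed
  moreover have "p ` (X \<inter> F n) \<in> sets (metric_borel (range p) d)" if "X \<in> \<D>" for X n
  proof -
    have "compact X" using \<D>(2)[OF that] by auto
    then have "compactin mtopology (p ` (X \<inter> F n))"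
      by (intro compactin_image_p compact_Int_closed F_closed)
    then show ?thesis
      by (intro closed_in_metric_borel compactin_imp_closedin Hausdorff_space_mtopology)
  qed
  ultimately show "sec -` U \<inter> space (metric_borel (range p) d) \<in> sets (metric_borel (range p) d)"
    using \<D>(1) by auto
qed

lemma continuous_on_d: "x \<in> range p \<Longrightarrow> continuous_on S (\<lambda>y. d x (p y))"
proof -
  assume x: "x \<in> range p"
  obtain b where b: "b > 0" "\<And>x. \<nu> x \<le> b * norm x" using is_norm_bounded_above[OF norm_\<nu>] by blast
  have "\<bar>d x (p y) - d x (p y')\<bar> \<le> b * norm (y - y')" for y y'
    using triangle[of x "p y" "p y'"] triangle[of x "p y'" "p y"] x d_le[of y y'] b(2)[of "y - y'"]
      d_commute[of "p y" "p y'"] by simp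
  then have "b-lipschitz_on S (\<lambda>y. d x (p y))"
    using b(1) by (intro lipschitz_onI) (auto simp: dist_norm)
  then show ?thesis by (rule lipschitz_on_continuous_on)
qed

end

section \<open>A dissipative quadratic form\<close>

lemma inner_symmetric_matrix:
  fixes A :: "real^'j^'j"
  assumes "transpose A = A"
  shows "x \<bullet> (A *v y) = y \<bullet> (A *v x)"
proof -
  have "x \<bullet> (A *v y) = (x v* A) \<bullet> y" by (rule dot_lmul_matrix[symmetric])
  also have "x v* A = A *v x" using transpose_matrix_vector[of A x] assms by simp
  finally show ?thesis by (simp add: inner_commute)
qed

lemma psd_matrix_kernel:
  fixes A :: "real^'j^'j"
  assumes sym: "transpose A = A" and psd: "\<And>x. 0 \<le> x \<bullet> (A *v x)" and x: "x \<bullet> (A *v x) = 0"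
  shows "A *v x = 0"
proof -
  define w where "w = A *v x"
  define b where "b = w \<bullet> w"
  define a where "a = w \<bullet> (A *v w)"
  have a: "0 \<le> a" unfolding a_def by (rule psd)
  have "0 \<le> 2 * t * b + t\<^sup>2 * a" for t
  proof -
    have "w \<bullet> (A *v x) = b" by (simp add: b_def w_def)
    moreover have "x \<bullet> (A *v w) = b" using inner_symmetric_matrix[OF sym, of x w] by (simp add: b_def w_def)
    ultimately have "(x + t *\<^sub>R w) \<bullet> (A *v (x + t *\<^sub>R w)) = 2 * t * b + t\<^sup>2 * a"
      using x by (simp add: matrix_vector_right_distrib matrix_vector_mult_scaleR inner_add_left inner_add_right
          a_def algebra_simps power2_eq_square)
    then show ?thesis using psd[of "x + t *\<^sub>R w"] by simp
  qed
  then have nonneg: "0 \<le> (a + 1)\<^sup>2 * (2 * t * b + t\<^sup>2 * a)" for t by simp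
  define t where "t = - b / (a + 1)"
  have t: "(a + 1) * t = - b" using a by (simp add: t_def)
  have "(a + 1)\<^sup>2 * (2 * t * b + t\<^sup>2 * a) = 2 * (a + 1) * ((a + 1) * t) * b + ((a + 1) * t)\<^sup>2 * a"
    by (simp add: algebra_simps power2_eq_square)
  also have "\<dots> = - (b\<^sup>2 * (a + 2))"
    unfolding t by (simp add: algebra_simps power2_eq_square)
  finally have "b\<^sup>2 * (a + 2) \<le> 0" using nonneg[of t] by linarith
  moreover have "0 \<le> b\<^sup>2 * (a + 2)" using a by simp
  ultimately have "b\<^sup>2 * (a + 2) = 0" by (rule antisym)
  then have "b = 0" using a by auto
  then show ?thesis by (simp add: b_def w_def)
qed

lemma mat_mult_vector: "mat x *v w = x *s w"
  by (simp add: matrix_vector_mult_def mat_def vec_eq_iff if_distrib if_distribR cong: if_cong)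

text \<open>
  If \<open>A\<close> kills two orthogonal nonzero vectors, complete them to a basis; written in the rows of this
  basis, \<open>x I - A\<close> has two rows divisible by \<open>x\<close>.  Thus \<open>x\<^sup>2\<close> divides the characteristic polynomial,
  and \<open>0\<close> is not a simple root.
\<close>

lemma simple_zero_eigenvalue_kernel:
  fixes A :: "real^'j::finite^'j"
  assumes sym: "transpose A = A" and ev: "eigenvalues_with_mult A lam"
    and lam0: "lam 0 = 0" and lam_pos: "\<And>i. 1 \<le> i \<Longrightarrow> i < CARD('j) \<Longrightarrow> 0 < lam i"
    and a: "a \<noteq> 0" "A *v a = 0" and u: "A *v u = 0" "u \<bullet> a = 0"
  shows "u = 0"
proof (rule ccontr)
  assume u0: "u \<noteq> 0"
  have "a \<noteq> u" using u u0 by auto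
  have "pairwise orthogonal {a, u}"
    using u(2) by (auto simp: pairwise_def orthogonal_def inner_commute)
  then have ind: "independent {a, u}" using a(1) u0 by (intro pairwise_orthogonal_independent) auto
  define B where "B = extend_basis {a, u}"
  have B: "{a, u} \<subseteq> B" "independent B" "span B = UNIV"
    using extend_basis_superset[OF ind] independent_extend_basis[OF ind] span_extend_basis[OF ind]
    by (simp_all add: B_def)
  have "finite B" "card B = CARD('j)"
    using B(2,3) independent_imp_finite dim_span_eq_card_independent[OF B(2)]
    by (auto simp: dim_UNIV)
  then obtain h where h: "bij_betw h (UNIV :: 'j set) B"
    using finite_same_card_bij[of "UNIV :: 'j set" B] by auto
  define R :: "real^'j^'j" where "R = (\<chi> i. h i)"
  have "rows R = B"
    using h by (auto simp: rows_def row_def R_def bij_betw_def)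
  then obtain R' where "R' ** R = mat 1"
    using matrix_left_invertible_span_rows[of R] B(3) by auto
  then have "det R' * det R = 1" by (metis det_I det_mul)
  then have R: "det R \<noteq> 0" by auto
  obtain k l where kl: "h k = a" "h l = u" "k \<noteq> l"
    using h B(1) \<open>a \<noteq> u\<close> by (metis bij_betw_imp_surj_on imageE insert_subset)
  define M where "M x = (\<chi> i. if i \<in> {k, l} then h i else x *s h i - A *v h i)" for x
  have det_eq: "det R * det (mat x - A) = x\<^sup>2 * det (M x)" for x
  proof -
    have row: "h i v* (mat x - A) = (if i \<in> {k, l} then x else 1) *s
        (if i \<in> {k, l} then h i else x *s h i - A *v h i)" for i
    proof -
      have "h i v* (mat x - A) = transpose (mat x - A) *v h i" by (simp add: transpose_matrix_vector)
      also have "transpose (mat x - A) = mat x - A"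
        using sym by (simp add: transpose_def mat_def vec_eq_iff)
      also have "(mat x - A) *v h i = x *s h i - A *v h i"
        by (simp add: matrix_vector_mult_diff_rdistrib mat_mult_vector)
      finally show ?thesis using kl a u by auto
    qed
    have "R ** (mat x - A) = (\<chi> i. (if i \<in> {k, l} then x else 1) *s
        (if i \<in> {k, l} then h i else x *s h i - A *v h i))"
    proof -
      have "(R ** (mat x - A)) $ i = h i v* (mat x - A)" for i
        by (simp add: R_def matrix_matrix_mult_def vector_matrix_mult_def vec_eq_iff mult.commute)
      then show ?thesis using row by (simp add: vec_eq_iff)
    qed
    then have "det R * det (mat x - A) = (\<Prod>i\<in>UNIV. if i \<in> {k, l} then x else 1) * det (M x)"
      by (simp only: det_mul[symmetric] det_rows_mul M_def)
    also have "(\<Prod>i\<in>UNIV. if i \<in> {k, l} then x else 1) = x\<^sup>2"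
    proof -
      have "{i. i = k \<or> i = l} = {k, l}" by auto
      then show ?thesis using kl(3) by (simp add: prod.If_cases power2_eq_square)
    qed
    finally show ?thesis .
  qed
  define f where "f x = det R * (\<Prod>i\<in>{1..<CARD('j)}. x - lam i) - x * det (M x)" for x
  \<comment> \<open>the two expressions for the determinant agree after division by \<open>x\<close>, at \<open>x = 0\<close> by continuity\<close>
  have f_0: "f x = 0" if "x \<noteq> 0" for x
  proof -
    have "{..<CARD('j)} = insert 0 {1..<CARD('j)}" by auto
    then have "det (mat x - A) = x * (\<Prod>i\<in>{1..<CARD('j)}. x - lam i)"
      using ev lam0 by (simp add: eigenvalues_with_mult_def)
    then have "x * f x = 0" using det_eq[of x] by (simp add: f_def algebra_simps power2_eq_square)
    with that show ?thesis by simp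
  qed
  have M_cont: "continuous_on UNIV (\<lambda>x. M x $ i $ j)" for i j
    by (cases "i \<in> {k, l}") (auto simp: M_def scalar_mult_eq_scaleR intro!: continuous_intros)
  then have "continuous_on UNIV f"
    unfolding f_def det_def by (intro M_cont continuous_intros)
  then have "isCont f 0" by (simp add: continuous_on_eq_continuous_at)
  then have "f \<midarrow>0\<rightarrow> f 0" by (simp add: isCont_def)
  moreover have "f \<midarrow>0\<rightarrow> 0"
    by (rule Lim_transform_eventually[OF tendsto_const]) (auto simp: eventually_at f_0 intro: exI[of _ 1])
  ultimately have "f 0 = 0" by (rule LIM_unique)
  then have "(\<Prod>i\<in>{1..<CARD('j)}. - lam i) = 0" using R by (simp add: f_def)
  then show False using lam_pos by (fastforce simp: prod_zero_iff)
qed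

lemma quadratic_form_coercive:
  fixes q :: "'a::euclidean_space \<Rightarrow> 'a \<Rightarrow> real"
  assumes q: "bounded_bilinear q" and S: "subspace S"
    and pos: "\<And>x. x \<in> S \<Longrightarrow> x \<noteq> 0 \<Longrightarrow> 0 < q x x"
  obtains c where "c > 0" "\<And>x. x \<in> S \<Longrightarrow> c * (norm x)\<^sup>2 \<le> q x x"
proof (cases "S \<inter> sphere 0 1 = {}")
  case True
  have "x = 0" if "x \<in> S" for x
  proof (rule ccontr)
    assume "x \<noteq> 0"
    then have "(1 / norm x) *\<^sub>R x \<in> S \<inter> sphere 0 1"
      using that S by (auto simp: subspace_scale)
    with True show False by auto
  qed
  then have "1 * (norm x)\<^sup>2 \<le> q x x" if "x \<in> S" for x
    using \<open>\<And>x. x \<in> S \<Longrightarrow> x = 0\<close>[OF that] by (simp add: bounded_bilinear.zero_left[OF q])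
  then show ?thesis by (rule that[OF zero_less_one])
next
  case False
  have "compact (S \<inter> sphere 0 1)"
    using closed_subspace[OF S] by (intro closed_Int_compact compact_sphere)
  moreover have "continuous_on (S \<inter> sphere 0 1) (\<lambda>x. q x x)"
    by (intro bounded_bilinear.continuous_on[OF q] continuous_intros)
  ultimately obtain s where s: "s \<in> S \<inter> sphere 0 1" "\<And>x. x \<in> S \<inter> sphere 0 1 \<Longrightarrow> q s s \<le> q x x"
    using False continuous_attains_inf[of "S \<inter> sphere 0 1" "\<lambda>x. q x x"] by metis
  show ?thesis
  proof
    show "0 < q s s" using s(1) by (intro pos) auto
    fix x assume x: "x \<in> S"
    show "q s s * (norm x)\<^sup>2 \<le> q x x"
    proof (cases "x = 0")
      case False
      then have "(1 / norm x) *\<^sub>R x \<in> S \<inter> sphere 0 1" using x S by (auto simp: subspace_scale)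
      then have "q s s \<le> q ((1 / norm x) *\<^sub>R x) ((1 / norm x) *\<^sub>R x)" by (rule s(2))
      also have "\<dots> = q x x / (norm x)\<^sup>2"
        by (simp add: bounded_bilinear.scaleR_left[OF q] bounded_bilinear.scaleR_right[OF q] power2_eq_square)
      finally show ?thesis using False by (simp add: field_simps)
    qed (simp add: bounded_bilinear.zero_left[OF q])
  qed
qed

text \<open>
  The vector \<open>(1, \<dots>, 1)\<close>.
\<close>

definition ones :: "real^'j" where "ones = (\<chi> j. 1)"

lemma eta0_eq: "eta0 = (ones, 0)"
  by (simp add: eta0_def ones_def)

text \<open>
  The orthogonal projection onto the vectors of mean zero.
\<close>

definition center :: "real^'j \<Rightarrow> real^'j::finite" where
  "center u = u - ((u \<bullet> ones) / real CARD('j)) *\<^sub>R ones"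

lemma inner_ones_ones: "(ones :: real^'j::finite) \<bullet> ones = real CARD('j)"
  by (simp add: ones_def inner_vec_def)

lemma center_add: "center (u + v) = center u + center v"
  by (simp add: center_def inner_add_left add_divide_distrib scaleR_add_left)

lemma center_scaleR: "center (r *\<^sub>R u) = r *\<^sub>R center u"
  by (simp add: center_def algebra_simps)

lemma center_ones: "center ones = 0"
  by (simp add: center_def inner_ones_ones)

lemma center_orthogonal: "center u \<bullet> ones = 0"
  by (simp add: center_def inner_diff_left inner_ones_ones)

lemma eq_center_plus: "u = center u + ((u \<bullet> ones) / real CARD('j)) *\<^sub>R ones" for u :: "real^'j::finite"
  by (simp add: center_def)

lemma inner_center: "center u \<bullet> w = u \<bullet> center w"
  by (simp add: center_def inner_diff_left inner_diff_right inner_commute)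

lemma E2_iff:
  fixes y :: "'j::finite phase"
  assumes "\<alpha> \<noteq> 0"
  shows "y \<in> E2 \<alpha> \<longleftrightarrow> \<alpha> * (fst y \<bullet> ones) + snd y \<bullet> ones = 0"
proof -
  have eta: "eta0 = (ones, 0)" "eta_neg \<alpha> = (ones, - \<alpha> *\<^sub>R ones)"
    by (simp_all add: eta0_def eta_neg_def ones_def vec_eq_iff)
  have E22: "w \<in> E22 \<alpha> \<longleftrightarrow> fst w \<bullet> ones = 0 \<and> snd w \<bullet> ones = 0" for w :: "'j phase"
  proof
    assume "w \<in> E22 \<alpha>"
    then have *: "b \<bullet> w = 0" if "b \<in> E11 \<alpha>" for b
      using that by (simp add: E22_def orthogonal_comp_def orthogonal_def)
    have "eta0 + 0 \<in> E11 \<alpha>" "0 + eta_neg \<alpha> \<in> E11 \<alpha>"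
      unfolding E11_def E1_def E_neg_def by (intro set_plus_intro span_base span_zero; simp)+
    from this[THEN *] show "fst w \<bullet> ones = 0 \<and> snd w \<bullet> ones = 0"
      using assms by (auto simp: eta inner_prod_def inner_commute)
  next
    assume "fst w \<bullet> ones = 0 \<and> snd w \<bullet> ones = 0"
    then show "w \<in> E22 \<alpha>"
      by (auto simp: E22_def E11_def E1_def E_neg_def orthogonal_comp_def orthogonal_def set_plus_def
          span_singleton eta inner_prod_def inner_commute inner_add_left inner_add_right)
  qed
  show ?thesis
  proof
    assume "y \<in> E2 \<alpha>"
    then obtain a w where "y = a *\<^sub>R eta_neg \<alpha> + w" "w \<in> E22 \<alpha>"
      by (auto simp: E2_def E_neg_def set_plus_def span_singleton)
    then show "\<alpha> * (fst y \<bullet> ones) + snd y \<bullet> ones = 0"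
      by (simp add: E22 eta inner_add_left algebra_simps)
  next
    assume y: "\<alpha> * (fst y \<bullet> ones) + snd y \<bullet> ones = 0"
    define a where "a = (fst y \<bullet> ones) / real CARD('j)"
    have "a *\<^sub>R eta_neg \<alpha> \<in> E_neg \<alpha>" by (auto simp: E_neg_def span_singleton)
    moreover have "y - a *\<^sub>R eta_neg \<alpha> \<in> E22 \<alpha>"
      using y by (simp add: E22 eta inner_diff_left inner_add_left inner_ones_ones a_def algebra_simps)
    ultimately have "a *\<^sub>R eta_neg \<alpha> + (y - a *\<^sub>R eta_neg \<alpha>) \<in> E2 \<alpha>"
      unfolding E2_def by (rule set_plus_intro)
    then show "y \<in> E2 \<alpha>" by simp
  qed
qed

text \<open>
  The linear part \<open>(u, v) \<mapsto> (v, - K A u - \<alpha> v)\<close> contracts a quadratic form that is degenerate only in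
  the direction of \<^const>\<open>eta0\<close>, hence positive definite on \<^const>\<open>E2\<close>.  With \<open>u'\<close>, \<open>v'\<close> the
  mean-zero parts and \<open>s\<close> the sum of the entries of \<open>v\<close>, the form is
  \<open>K \<langle>u, A u\<rangle> - \<delta> (\<alpha> - \<delta>) |u'|\<^sup>2 + |v' + \<delta> u'|\<^sup>2 + s\<^sup>2\<close>.  The second term is there to cancel the mixed
  term \<open>\<langle>u', v' + \<delta> u'\<rangle>\<close> in the derivative; it is dominated by the first one, because \<open>A\<close> is
  coercive on the vectors of mean zero and \<open>\<delta>\<close> is small.
\<close>

lemma dissipative_form:
  fixes A :: "real^'j::finite^'j"
  assumes sym: "transpose A = A" and psd: "\<And>x. 0 \<le> x \<bullet> (A *v x)" and ones: "A *v ones = 0"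
    and ker: "\<And>u. A *v u = 0 \<Longrightarrow> u \<bullet> ones = 0 \<Longrightarrow> u = 0"
    and K: "K > 0" and \<alpha>: "\<alpha> > 0"
  obtains \<delta> c and q :: "'j phase \<Rightarrow> 'j phase \<Rightarrow> real"
  where "\<delta> > 0" "bounded_bilinear q" "\<And>x y. q x y = q y x" "\<And>y. 0 \<le> q y y"
    "\<And>u v. q (u, v) (v, - (K *\<^sub>R (A *v u)) - \<alpha> *\<^sub>R v) \<le> - \<delta> * q (u, v) (u, v)"
    "\<And>y. q eta0 y = 0" "c > 0" "\<And>y. y \<in> E2 \<alpha> \<Longrightarrow> c * (norm y)\<^sup>2 \<le> q y y"
proof -
  have A_bil: "bounded_bilinear (\<lambda>x y :: real^'j. x \<bullet> (A *v y))"
    by (rule bounded_bilinear.comp[OF bounded_bilinear_inner bounded_linear_ident matrix_vector_mul_bounded_linear])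
  have A_pos: "0 < u \<bullet> (A *v u)" if "u \<in> {u. u \<bullet> ones = 0}" "u \<noteq> 0" for u
    using that psd[of u] psd_matrix_kernel[OF sym psd, of u] ker[of u] by (auto simp: less_le)
  have "subspace {u :: real^'j. u \<bullet> ones = 0}"
    by (auto simp: subspace_def inner_add_left)
  then obtain \<mu> where \<mu>: "\<mu> > 0" "\<And>u. u \<in> {u. u \<bullet> ones = 0} \<Longrightarrow> \<mu> * (norm u)\<^sup>2 \<le> u \<bullet> (A *v u)"
    using quadratic_form_coercive[OF A_bil _ A_pos] by blast
  have A_center: "A *v center u = A *v u" for u
    by (simp add: center_def matrix_vector_mult_diff_distrib matrix_vector_mult_scaleR ones)
  have A_ones: "(A *v u) \<bullet> ones = 0" for u
    using inner_symmetric_matrix[OF sym, of ones u] by (simp add: ones inner_commute)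
  have center_A: "center (A *v u) = A *v u" for u
    by (simp add: center_def A_ones)
  have A_coercive: "\<mu> * (center u \<bullet> center u) \<le> u \<bullet> (A *v u)" for u
  proof -
    have "u \<bullet> (A *v u) = center u \<bullet> (A *v center u)"
      by (simp add: A_center inner_center center_A)
    then show ?thesis using \<mu>(2)[of "center u"] center_orthogonal[of u] by (simp add: power2_norm_eq_inner)
  qed
  \<comment> \<open>the first bound gives decay at rate \<open>\<delta>\<close>, the second one positivity of the form\<close>
  define \<delta> where "\<delta> = min (\<alpha> / 2) (K * \<mu> / (2 * \<alpha>))"
  have \<delta>: "0 < \<delta>" "2 * \<delta> \<le> \<alpha>" using K \<alpha> \<mu>(1) by (auto simp: \<delta>_def)
  have \<delta>': "\<delta> * (\<alpha> - \<delta>) \<le> K * \<mu> / 2"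
  proof -
    have "\<delta> * (\<alpha> - \<delta>) \<le> \<delta> * \<alpha>" using \<delta> by simp
    also have "\<dots> \<le> (K * \<mu> / (2 * \<alpha>)) * \<alpha>" using \<alpha> by (intro mult_right_mono) (auto simp: \<delta>_def)
    finally show ?thesis using \<alpha> by simp
  qed
  define q where "q y y' = K * (fst y \<bullet> (A *v fst y')) - \<delta> * (\<alpha> - \<delta>) * (center (fst y) \<bullet> center (fst y'))
     + (center (snd y) + \<delta> *\<^sub>R center (fst y)) \<bullet> (center (snd y') + \<delta> *\<^sub>R center (fst y'))
     + (snd y \<bullet> ones) * (snd y' \<bullet> ones)" for y y' :: "'j phase"
  have q_sym: "q x y = q y x" for x y
    unfolding q_def using inner_symmetric_matrix[OF sym, of "fst x" "fst y"] by (simp add: inner_commute mult.commute)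
  have q_lin: "linear (q x)" for x
    by (rule linearI) (simp_all add: q_def center_add center_scaleR matrix_vector_right_distrib
        matrix_vector_mult_scaleR inner_add_left inner_add_right algebra_simps)
  have "linear (\<lambda>x. q x y)" for y
    using q_lin[of y] by (simp add: q_sym[of _ y])
  then have q_bil: "bounded_bilinear q"
    using q_lin by (simp add: bilinear_conv_bounded_bilinear[symmetric] bilinear_def)
  have q_lower: "K * \<mu> / 2 * (norm (center (fst y)))\<^sup>2 + (norm (center (snd y) + \<delta> *\<^sub>R center (fst y)))\<^sup>2
      + (snd y \<bullet> ones)\<^sup>2 \<le> q y y" for y
  proof -
    define X where "X = center (fst y) \<bullet> center (fst y)"
    have "\<delta> * (\<alpha> - \<delta>) * X \<le> K * \<mu> / 2 * X"
      unfolding X_def by (rule mult_right_mono[OF \<delta>']) simp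
    moreover have "K * \<mu> * X \<le> K * (fst y \<bullet> (A *v fst y))"
      unfolding mult.assoc X_def using K by (intro mult_left_mono A_coercive) simp
    moreover have "K * \<mu> * X = K * \<mu> / 2 * X + K * \<mu> / 2 * X" by simp
    ultimately have "K * \<mu> / 2 * X \<le> K * (fst y \<bullet> (A *v fst y)) - \<delta> * (\<alpha> - \<delta>) * X" by linarith
    then show ?thesis
      unfolding q_def power2_norm_eq_inner power2_eq_square[of "snd y \<bullet> ones"] X_def by (intro add_right_mono)
  qed
  have q_nonneg: "0 \<le> q y y" for y
    by (rule order_trans[OF _ q_lower]) (use K \<mu>(1) in auto)
  have q_diss: "q (u, v) (v, - (K *\<^sub>R (A *v u)) - \<alpha> *\<^sub>R v) \<le> - \<delta> * q (u, v) (u, v)" for u v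
  proof -
    define a b b' m s where "a = center u \<bullet> center u" and "b = center u \<bullet> center v"
      and "b' = center v \<bullet> center v" and "m = u \<bullet> (A *v u)" and "s = v \<bullet> ones"
    define v' where "v' = - (K *\<^sub>R (A *v u)) - \<alpha> *\<^sub>R v"
    have v': "v' = (- K) *\<^sub>R (A *v u) + (- \<alpha>) *\<^sub>R v" by (simp add: v'_def)
    have cv': "center v' = (- K) *\<^sub>R (A *v u) + (- \<alpha>) *\<^sub>R center v"
      unfolding v' center_add center_scaleR center_A ..
    have sv': "v' \<bullet> ones = - \<alpha> * s" unfolding v' inner_add_left inner_scaleR_left A_ones s_def by simp
    have 1: "center v \<bullet> (A *v u) = u \<bullet> (A *v v)" "center u \<bullet> (A *v u) = m"
      by (simp_all add: inner_center center_A m_def inner_symmetric_matrix[OF sym, of v u])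
    have 2: "center v \<bullet> center u = b" by (simp add: b_def inner_commute)
    have q1: "q (u, v) (v, v') = - \<delta> * K * m - \<delta> * (\<alpha> - \<delta>) * b - (\<alpha> - \<delta>) * (b' + \<delta> * b) - \<alpha> * s\<^sup>2"
      unfolding q_def fst_conv snd_conv cv' sv'
      by (simp add: inner_add_left inner_add_right inner_diff_right inner_diff_left 1 2 a_def[symmetric] b_def[symmetric]
          b'_def[symmetric] s_def[symmetric] algebra_simps power2_eq_square)
    have q2: "q (u, v) (u, v) = K * m - \<delta> * (\<alpha> - \<delta>) * a + (b' + 2 * \<delta> * b + \<delta>\<^sup>2 * a) + s\<^sup>2"
      unfolding q_def fst_conv snd_conv
      by (simp add: inner_add_left inner_add_right 2 a_def[symmetric] b_def[symmetric]
          b'_def[symmetric] m_def[symmetric] s_def[symmetric] algebra_simps power2_eq_square)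
    have "b' + 2 * \<delta> * b + \<delta>\<^sup>2 * a = (norm (center v + \<delta> *\<^sub>R center u))\<^sup>2"
      unfolding power2_norm_eq_inner
      by (simp add: inner_add_left inner_add_right 2 a_def b_def b'_def algebra_simps power2_eq_square inner_commute)
    then have "0 \<le> b' + 2 * \<delta> * b + \<delta>\<^sup>2 * a" by simp
    then have "0 \<le> (\<alpha> - 2 * \<delta>) * (b' + 2 * \<delta> * b + \<delta>\<^sup>2 * a)"
      using \<delta> by (intro mult_nonneg_nonneg[of "\<alpha> - 2 * \<delta>"]) auto
    moreover have "0 \<le> (\<alpha> - \<delta>) * s\<^sup>2" using \<delta> by (intro mult_nonneg_nonneg) auto
    moreover have "- \<delta> * q (u, v) (u, v) - q (u, v) (v, v')
        = (\<alpha> - 2 * \<delta>) * (b' + 2 * \<delta> * b + \<delta>\<^sup>2 * a) + (\<alpha> - \<delta>) * s\<^sup>2"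
      unfolding q1 q2 by (simp add: algebra_simps power2_eq_square)
    ultimately have "q (u, v) (v, v') \<le> - \<delta> * q (u, v) (u, v)" by linarith
    then show ?thesis by (simp add: v'_def)
  qed
  have q_eta: "q eta0 y = 0" for y
  proof -
    have eta: "fst (eta0 :: 'j phase) = ones" "snd (eta0 :: 'j phase) = 0"
      by (simp_all add: eta0_def ones_def)
    have "ones \<bullet> (A *v fst y) = 0" using A_ones[of "fst y"] by (simp add: inner_commute)
    then show ?thesis unfolding q_def eta center_ones by (simp add: center_def)
  qed
  have E2_sub: "subspace (E2 \<alpha> :: 'j phase set)"
    unfolding subspace_def
  proof (intro conjI ballI allI)
    fix y y' :: "'j phase" and r :: real
    assume y: "y \<in> E2 \<alpha>" and y': "y' \<in> E2 \<alpha>"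
    have "\<alpha> * (fst (y + y') \<bullet> ones) + snd (y + y') \<bullet> ones
        = (\<alpha> * (fst y \<bullet> ones) + snd y \<bullet> ones) + (\<alpha> * (fst y' \<bullet> ones) + snd y' \<bullet> ones)"
      by (simp add: inner_add_left distrib_left)
    then show "y + y' \<in> E2 \<alpha>" using y y' \<alpha> by (simp add: E2_iff)
  next
    fix y :: "'j phase" and r :: real
    assume y: "y \<in> E2 \<alpha>"
    have "\<alpha> * (fst (r *\<^sub>R y) \<bullet> ones) + snd (r *\<^sub>R y) \<bullet> ones = r * (\<alpha> * (fst y \<bullet> ones) + snd y \<bullet> ones)"
      by (simp add: algebra_simps)
    then show "r *\<^sub>R y \<in> E2 \<alpha>" using y \<alpha> by (simp add: E2_iff)
  qed (use \<alpha> in \<open>simp add: E2_iff\<close>)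
  have q_pos: "0 < q y y" if "y \<in> E2 \<alpha>" "y \<noteq> 0" for y
  proof (rule ccontr)
    assume "\<not> 0 < q y y"
    moreover have "0 \<le> K * \<mu> / 2 * (norm (center (fst y)))\<^sup>2" using K \<mu>(1) by simp
    moreover have "0 \<le> (norm (center (snd y) + \<delta> *\<^sub>R center (fst y)))\<^sup>2" "0 \<le> (snd y \<bullet> ones)\<^sup>2" by simp_all
    ultimately have "K * \<mu> / 2 * (norm (center (fst y)))\<^sup>2 = 0" "(norm (center (snd y) + \<delta> *\<^sub>R center (fst y)))\<^sup>2 = 0"
      "(snd y \<bullet> ones)\<^sup>2 = 0"
      using q_lower[of y] by linarith+
    then have "center (fst y) = 0" "center (snd y) = 0" "snd y \<bullet> ones = 0"
      using K \<mu>(1) by auto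
    moreover from this have "fst y \<bullet> ones = 0" using that(1) \<alpha> by (simp add: E2_iff)
    ultimately have "fst y = 0" "snd y = 0" using eq_center_plus[of "fst y"] eq_center_plus[of "snd y"] by simp_all
    then show False using that(2) by (simp add: prod_eq_iff)
  qed
  obtain c where "c > 0" "\<And>y. y \<in> E2 \<alpha> \<Longrightarrow> c * (norm y)\<^sup>2 \<le> q y y"
    using quadratic_form_coercive[OF q_bil E2_sub q_pos] by blast
  then show ?thesis
    using that[OF \<delta>(1) q_bil q_sym q_nonneg q_diss q_eta] by blast
qed

section \<open>Measurable dependence of solutions on noise and initial values\<close>

lemma nonincreasing_from_0:
  fixes G :: "real \<Rightarrow> real"
  assumes G: "\<And>t. 0 \<le> t \<Longrightarrow> (G has_real_derivative G' t) (at t within {0..})"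
    and G': "\<And>t. 0 \<le> t \<Longrightarrow> t \<le> T \<Longrightarrow> G' t \<le> 0" and T: "0 \<le> T"
  shows "G T \<le> G 0"
proof (rule DERIV_nonpos_imp_decreasing_open[OF T])
  fix t :: real assume t: "0 < t" "t < T"
  then have "at t within {0..} = at t" by (intro at_within_interior) simp
  then show "\<exists>y. DERIV G t :> y \<and> y \<le> 0" using G[of t] G'[of t] t by auto
next
  have "continuous_on {0..} G"
    unfolding continuous_on_eq_continuous_within using DERIV_continuous[OF G] by auto
  then show "continuous_on {0..T} G" by (rule continuous_on_subset) auto
qed

lemma lipschitz_ode_dependence:
  fixes F :: "real \<Rightarrow> 'a::real_inner \<Rightarrow> 'a"
  assumes lip: "\<And>t x y. 0 \<le> t \<Longrightarrow> norm (F t x - F t y) \<le> L * norm (x - y)"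
    and y1: "\<And>t. 0 \<le> t \<Longrightarrow> (y1 has_vector_derivative F t (y1 t)) (at t within {0..})"
    and y2: "\<And>t. 0 \<le> t \<Longrightarrow> (y2 has_vector_derivative F t (y2 t)) (at t within {0..})"
    and T: "0 \<le> T"
  shows "norm (y1 T - y2 T) \<le> exp (L * T) * norm (y1 0 - y2 0)"
proof -
  define w where "w t = y1 t - y2 t" for t
  have w: "(w has_vector_derivative (F t (y1 t) - F t (y2 t))) (at t within {0..})" if "0 \<le> t" for t
    unfolding w_def using y1[OF that] y2[OF that] by (rule has_vector_derivative_diff)
  have "exp (- 2 * L * T) * (w T \<bullet> w T) \<le> exp (- 2 * L * 0) * (w 0 \<bullet> w 0)"
  proof (rule nonincreasing_from_0[OF _ _ T])
    fix t :: real assume t: "0 \<le> t"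
    have "((\<lambda>t. w t \<bullet> w t) has_vector_derivative (w t \<bullet> (F t (y1 t) - F t (y2 t)) + (F t (y1 t) - F t (y2 t)) \<bullet> w t))
        (at t within {0..})"
      by (rule bounded_bilinear.has_vector_derivative[OF bounded_bilinear_inner w[OF t] w[OF t]])
    then have "((\<lambda>t. w t \<bullet> w t) has_real_derivative 2 * (w t \<bullet> (F t (y1 t) - F t (y2 t)))) (at t within {0..})"
      by (simp add: has_real_derivative_iff_has_vector_derivative inner_commute)
    then show "((\<lambda>t. exp (- 2 * L * t) * (w t \<bullet> w t)) has_real_derivative
        exp (- 2 * L * t) * (2 * (w t \<bullet> (F t (y1 t) - F t (y2 t))) - 2 * L * (w t \<bullet> w t))) (at t within {0..})"
      by (auto intro!: derivative_eq_intros simp: algebra_simps)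
    have "w t \<bullet> (F t (y1 t) - F t (y2 t)) \<le> norm (w t) * norm (F t (y1 t) - F t (y2 t))"
      by (rule norm_cauchy_schwarz)
    also have "\<dots> \<le> norm (w t) * (L * norm (w t))"
      unfolding w_def by (intro mult_left_mono lip t norm_ge_zero)
    also have "\<dots> = L * (w t \<bullet> w t)"
      by (simp add: dot_square_norm power2_eq_square)
    finally show "exp (- 2 * L * t) * (2 * (w t \<bullet> (F t (y1 t) - F t (y2 t))) - 2 * L * (w t \<bullet> w t)) \<le> 0"
      by (intro mult_nonneg_nonpos) auto
  qed
  then have "exp (2 * L * T) * (exp (- 2 * L * T) * (w T \<bullet> w T)) \<le> exp (2 * L * T) * (w 0 \<bullet> w 0)"
    by (intro mult_left_mono) auto
  then have "(norm (w T))\<^sup>2 \<le> exp (2 * L * T) * (norm (w 0))\<^sup>2"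
    by (simp add: mult.assoc[symmetric] exp_add[symmetric] dot_square_norm)
  also have "\<dots> = (exp (L * T) * norm (w 0))\<^sup>2"
    by (simp add: power_mult_distrib exp_double[symmetric] mult.assoc)
  finally show ?thesis unfolding w_def by (rule power2_le_imp_le) simp
qed

lemma floor_approximation:
  "(\<lambda>n. real_of_int \<lfloor>real (Suc n) * t\<rfloor> / real (Suc n)) \<longlonglongrightarrow> t"
proof -
  have "norm (real_of_int \<lfloor>real (Suc n) * t\<rfloor> / real (Suc n) - t) < 1 / real (Suc n)" for n
  proof -
    have "real_of_int \<lfloor>real (Suc n) * t\<rfloor> / real (Suc n) - t
        = (real_of_int \<lfloor>real (Suc n) * t\<rfloor> - real (Suc n) * t) / real (Suc n)"
      by (simp add: diff_divide_distrib)
    moreover have "\<bar>real_of_int \<lfloor>real (Suc n) * t\<rfloor> - real (Suc n) * t\<bar> < 1" by linarith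
    ultimately show ?thesis by (simp only: real_norm_def abs_divide) (simp add: divide_strict_right_mono)
  qed
  then have "(\<lambda>n. real_of_int \<lfloor>real (Suc n) * t\<rfloor> / real (Suc n) - t) \<longlonglongrightarrow> 0" by (rule LIMSEQ_norm_0)
  then show ?thesis by (rule LIM_zero_cancel)
qed

text \<open>
  A Caratheodory function, continuous in \<open>t\<close> and measurable in \<open>\<omega>\<close>, is jointly measurable.
\<close>

lemma caratheodory_measurable:
  fixes f :: "real \<Rightarrow> 'w \<Rightarrow> 'b::metric_space"
  assumes meas: "\<And>t. f t \<in> borel_measurable M"
    and cont: "\<And>\<omega>. \<omega> \<in> space M \<Longrightarrow> continuous_on UNIV (\<lambda>t. f t \<omega>)"
  shows "(\<lambda>x. f (fst x) (snd x)) \<in> borel_measurable (borel \<Otimes>\<^sub>M M)"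
proof (rule borel_measurable_LIMSEQ_metric)
  define \<tau> where "\<tau> n t = real_of_int \<lfloor>real (Suc n) * t\<rfloor> / real (Suc n)" for n t
  show "(\<lambda>x. f (\<tau> n (fst x)) (snd x)) \<in> borel_measurable (borel \<Otimes>\<^sub>M M)" for n
    unfolding \<tau>_def
  proof (rule measurable_compose_countable[where f = "\<lambda>i x. f (real_of_int i / real (Suc n)) (snd x)"])
    show "(\<lambda>x. f (real_of_int i / real (Suc n)) (snd x)) \<in> borel_measurable (borel \<Otimes>\<^sub>M M)" for i
      by (rule measurable_compose[OF measurable_snd meas])
    show "(\<lambda>x. \<lfloor>real (Suc n) * fst x\<rfloor>) \<in> borel \<Otimes>\<^sub>M M \<rightarrow>\<^sub>M count_space UNIV"
      by measurable
  qed
  fix x :: "real \<times> 'w" assume x: "x \<in> space (borel \<Otimes>\<^sub>M M)"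
  have "(\<lambda>n. \<tau> n (fst x)) \<longlonglongrightarrow> fst x" unfolding \<tau>_def by (rule floor_approximation)
  moreover have "isCont (\<lambda>t. f t (snd x)) (fst x)"
    using cont x by (simp add: space_pair_measure continuous_on_eq_continuous_at mem_Times_iff)
  ultimately show "(\<lambda>n. f (\<tau> n (fst x)) (snd x)) \<longlonglongrightarrow> f (fst x) (snd x)"
    by (rule isCont_tendsto_compose[rotated])
qed

text \<open>
  Picard iterates of \<open>y' = F t \<omega> y\<close>, started at the constant path.  The Lebesgue integral makes them
  jointly measurable in time, noise and initial value; for negative \<open>t\<close> it is over the empty interval.
\<close>

primrec picard :: "(real \<Rightarrow> 'w \<Rightarrow> 'a::euclidean_space \<Rightarrow> 'a) \<Rightarrow> nat \<Rightarrow> real \<Rightarrow> 'w \<Rightarrow> 'a \<Rightarrow> 'a" where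
  "picard F 0 t \<omega> y = y"
| "picard F (Suc n) t \<omega> y =
     y + (LINT s|lborel. indicator {0..t} s *\<^sub>R F s \<omega> (picard F n s \<omega> y))"

lemma measurable_picard:
  fixes F :: "real \<Rightarrow> 'w \<Rightarrow> 'a::euclidean_space \<Rightarrow> 'a"
  assumes F: "(\<lambda>(t, \<omega>, y). F t \<omega> y) \<in> borel_measurable (borel \<Otimes>\<^sub>M (M \<Otimes>\<^sub>M borel))"
  shows "(\<lambda>(t, \<omega>, y). picard F n t \<omega> y) \<in> borel_measurable (borel \<Otimes>\<^sub>M (M \<Otimes>\<^sub>M borel))"
proof (induction n)
  case 0
  show ?case by simp
next
  case (Suc n)
  let ?N = "borel \<Otimes>\<^sub>M (M \<Otimes>\<^sub>M borel) :: (real \<times> 'w \<times> 'a) measure"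
  have arg: "(\<lambda>(x, s). (s, snd x)) \<in> ?N \<Otimes>\<^sub>M lborel \<rightarrow>\<^sub>M ?N" by measurable
  have [measurable]: "(\<lambda>(x, s). picard F n s (fst (snd x)) (snd (snd x))) \<in> borel_measurable (?N \<Otimes>\<^sub>M lborel)"
    using measurable_compose[OF arg Suc] by (simp add: case_prod_beta)
  have "(\<lambda>(x, s). (s, fst (snd x), picard F n s (fst (snd x)) (snd (snd x)))) \<in> ?N \<Otimes>\<^sub>M lborel \<rightarrow>\<^sub>M ?N"
    by measurable
  from measurable_compose[OF this F]
  have [measurable]: "(\<lambda>(x, s). F s (fst (snd x)) (picard F n s (fst (snd x)) (snd (snd x)))) \<in> borel_measurable (?N \<Otimes>\<^sub>M lborel)"
    by (simp add: case_prod_beta)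
  have "(\<lambda>(x, s). (if 0 \<le> s \<and> s \<le> fst x then F s (fst (snd x)) (picard F n s (fst (snd x)) (snd (snd x))) else 0))
      \<in> borel_measurable (?N \<Otimes>\<^sub>M lborel)"
    by measurable
  also have "(\<lambda>(x, s). (if 0 \<le> s \<and> s \<le> fst x then F s (fst (snd x)) (picard F n s (fst (snd x)) (snd (snd x))) else 0))
      = (\<lambda>(x, s). indicator {0..fst x} s *\<^sub>R F s (fst (snd x)) (picard F n s (fst (snd x)) (snd (snd x))))"
    by (auto simp: fun_eq_iff)
  finally have "(\<lambda>x. LINT s|lborel. indicator {0..fst x} s *\<^sub>R F s (fst (snd x)) (picard F n s (fst (snd x)) (snd (snd x))))
      \<in> borel_measurable ?N"
    by (rule sigma_finite_measure.borel_measurable_lebesgue_integral[OF sigma_finite_lborel])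
  then have "(\<lambda>x. snd (snd x) + (LINT s|lborel. indicator {0..fst x} s *\<^sub>R F s (fst (snd x)) (picard F n s (fst (snd x)) (snd (snd x)))))
      \<in> borel_measurable ?N"
    by measurable
  then show ?case by (simp add: case_prod_beta)
qed

text \<open>
  In the norm weighted by \<open>exp (- 2 L t)\<close> the Picard map halves distances on any \<open>[0, T]\<close>.
\<close>

lemma picard_converges:
  fixes F :: "real \<Rightarrow> 'w \<Rightarrow> 'a::euclidean_space \<Rightarrow> 'a"
  assumes cont: "continuous_on UNIV (\<lambda>(t, y). F t \<omega> y)"
    and lip: "\<And>t x y. 0 \<le> t \<Longrightarrow> norm (F t \<omega> x - F t \<omega> y) \<le> L * norm (x - y)" and L: "0 < L"
    and Y0: "Y 0 = y"
    and Y: "\<And>t. 0 \<le> t \<Longrightarrow> (Y has_vector_derivative F t \<omega> (Y t)) (at t within {0..})"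
    and T: "0 \<le> T"
  shows "(\<lambda>n. picard F n T \<omega> y) \<longlonglongrightarrow> Y T"
proof -
  have F_cont: "continuous_on {0..T} (\<lambda>s. F s \<omega> (h s))" if "continuous_on {0..T} h" for h and T :: real
    using continuous_on_compose2[OF cont continuous_on_Pair[OF continuous_on_id that]] by simp
  have picard_Suc: "picard F (Suc n) t \<omega> y = y + integral {0..t} (\<lambda>s. F s \<omega> (picard F n s \<omega> y))"
    if "continuous_on {0..t} (\<lambda>s. picard F n s \<omega> y)" for n t
    using set_borel_integral_eq_integral(2)[OF borel_integrable_atLeastAtMost'[OF F_cont[OF that]]]
    by (simp add: set_lebesgue_integral_def)
  have picard_cont: "continuous_on {0..t} (\<lambda>s. picard F n s \<omega> y)" for n t
  proof (induction n arbitrary: t)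
    case (Suc n)
    have "continuous_on {0..t} (\<lambda>s. y + integral {0..s} (\<lambda>s. F s \<omega> (picard F n s \<omega> y)))"
      by (intro continuous_intros indefinite_integral_continuous_1 integrable_continuous_real F_cont Suc)
    then show ?case using picard_Suc[OF Suc] by simp
  qed simp
  have Y_cont: "continuous_on {0..t} Y" for t
  proof -
    have "continuous_on {0..} Y"
      unfolding continuous_on_eq_continuous_within using has_vector_derivative_continuous[OF Y] by auto
    then show ?thesis by (rule continuous_on_subset) auto
  qed
  have Y_int: "Y t = y + integral {0..t} (\<lambda>s. F s \<omega> (Y s))" if "0 \<le> t" for t
  proof -
    have "((\<lambda>s. F s \<omega> (Y s)) has_integral (Y t - Y 0)) {0..t}"
      using that by (intro fundamental_theorem_of_calculus has_vector_derivative_within_subset[OF Y]) auto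
    then show ?thesis using Y0 by (simp add: integral_unique)
  qed
  have "bounded ((\<lambda>t. y - Y t) ` {0..T})"
    by (intro compact_imp_bounded compact_continuous_image continuous_intros Y_cont compact_Icc)
  then obtain C where "\<forall>t\<in>{0..T}. norm (y - Y t) \<le> C" unfolding bounded_iff by auto
  then have C: "norm (y - Y t) \<le> C" if "0 \<le> t" "t \<le> T" for t using that by simp
  then have C0: "0 \<le> C" using T norm_ge_zero order_trans by blast
  have err: "norm (picard F n t \<omega> y - Y t) \<le> C * (1/2) ^ n * exp (2 * L * t)" if "0 \<le> t" "t \<le> T" for n t
    using that
  proof (induction n arbitrary: t)
    case 0
    have "norm (y - Y t) * 1 \<le> C * exp (2 * L * t)"
      using C[OF 0] C0 0 L by (intro mult_mono) auto
    then show ?case by simp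
  next
    case (Suc n)
    let ?D = "\<lambda>s. F s \<omega> (picard F n s \<omega> y) - F s \<omega> (Y s)"
    let ?c = "C * (1/2) ^ n"
    have int: "(\<lambda>s. F s \<omega> (picard F n s \<omega> y)) integrable_on {0..t}" "(\<lambda>s. F s \<omega> (Y s)) integrable_on {0..t}"
      by (intro integrable_continuous_real F_cont picard_cont Y_cont)+
    have hi: "((\<lambda>s. L * (?c * exp (2 * L * s))) has_integral (?c / 2 * exp (2 * L * t) - ?c / 2 * exp (2 * L * 0))) {0..t}"
      using Suc.prems by (intro fundamental_theorem_of_calculus)
        (auto simp: has_real_derivative_iff_has_vector_derivative[symmetric] intro!: derivative_eq_intros)
    have "picard F (Suc n) t \<omega> y - Y t = integral {0..t} ?D"
      using picard_Suc[OF picard_cont] Y_int[OF Suc.prems(1)] by (simp add: integral_diff[OF int])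
    also have "norm \<dots> \<le> integral {0..t} (\<lambda>s. L * (?c * exp (2 * L * s)))"
    proof (rule integral_norm_bound_integral)
      show "?D integrable_on {0..t}" by (intro integrable_diff int)
      show "(\<lambda>s. L * (?c * exp (2 * L * s))) integrable_on {0..t}" using hi by blast
      fix s assume s: "s \<in> {0..t}"
      have "norm (?D s) \<le> L * norm (picard F n s \<omega> y - Y s)" using s by (intro lip) simp
      also have "\<dots> \<le> L * (?c * exp (2 * L * s))"
        using s Suc.prems L by (intro mult_left_mono Suc.IH) auto
      finally show "norm (?D s) \<le> L * (?c * exp (2 * L * s))" .
    qed
    also have "\<dots> = ?c / 2 * exp (2 * L * t) - ?c / 2" unfolding integral_unique[OF hi] by simp
    also have "\<dots> \<le> C * (1/2) ^ Suc n * exp (2 * L * t)" using C0 by simp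
    finally show ?case .
  qed
  have "(\<lambda>n. C * (1/2) ^ n * exp (2 * L * T)) \<longlonglongrightarrow> C * 0 * exp (2 * L * T)"
    by (intro tendsto_intros LIMSEQ_power_zero) simp
  then have bound_0: "(\<lambda>n. C * (1/2) ^ n * exp (2 * L * T)) \<longlonglongrightarrow> 0" by simp
  have "(\<lambda>n. picard F n T \<omega> y - Y T) \<longlonglongrightarrow> 0"
    by (rule Lim_null_comparison[OF always_eventually bound_0]) (use err[OF T order_refl] in blast)
  then show ?thesis by (rule LIM_zero_cancel)
qed

theorem measurable_lipschitz_ode_solution:
  fixes F :: "real \<Rightarrow> 'w \<Rightarrow> 'a::euclidean_space \<Rightarrow> 'a"
  assumes F: "(\<lambda>(t, \<omega>, y). F t \<omega> y) \<in> borel_measurable (borel \<Otimes>\<^sub>M (M \<Otimes>\<^sub>M borel))"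
    and cont: "\<And>\<omega>. \<omega> \<in> space M \<Longrightarrow> continuous_on UNIV (\<lambda>(t, y). F t \<omega> y)"
    and lip: "\<And>t \<omega> x y. \<omega> \<in> space M \<Longrightarrow> 0 \<le> t \<Longrightarrow> norm (F t \<omega> x - F t \<omega> y) \<le> L * norm (x - y)"
    and L: "0 < L"
    and Y0: "\<And>\<omega> y. \<omega> \<in> space M \<Longrightarrow> Y 0 \<omega> y = y"
    and Y: "\<And>\<omega> y t. \<omega> \<in> space M \<Longrightarrow> 0 \<le> t \<Longrightarrow>
      ((\<lambda>t. Y t \<omega> y) has_vector_derivative F t \<omega> (Y t \<omega> y)) (at t within {0..})"
  shows "(\<lambda>(t, \<omega>, y). Y t \<omega> y) \<in> borel_measurable (restrict_space borel {0..} \<Otimes>\<^sub>M (M \<Otimes>\<^sub>M borel))"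
proof (rule borel_measurable_LIMSEQ_metric)
  have "(\<lambda>x. (fst x, snd x)) \<in> restrict_space borel {0::real..} \<Otimes>\<^sub>M (M \<Otimes>\<^sub>M borel) \<rightarrow>\<^sub>M borel \<Otimes>\<^sub>M (M \<Otimes>\<^sub>M (borel :: 'a measure))"
    by (intro measurable_Pair measurable_compose[OF measurable_fst measurable_restrict_space1] measurable_snd; simp)
  from measurable_compose[OF this measurable_picard[OF F]]
  show "(\<lambda>(t, \<omega>, y). picard F n t \<omega> y) \<in> borel_measurable (restrict_space borel {0..} \<Otimes>\<^sub>M (M \<Otimes>\<^sub>M borel))" for n
    by (simp add: case_prod_beta)
  fix x :: "real \<times> 'w \<times> 'a" assume "x \<in> space (restrict_space borel {0..} \<Otimes>\<^sub>M (M \<Otimes>\<^sub>M borel))"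
  then obtain t \<omega> y where x: "x = (t, \<omega>, y)" "0 \<le> t" "\<omega> \<in> space M"
    by (auto simp: space_pair_measure space_restrict_space)
  show "(\<lambda>n. case x of (t, \<omega>, y) \<Rightarrow> picard F n t \<omega> y) \<longlonglongrightarrow> (case x of (t, \<omega>, y) \<Rightarrow> Y t \<omega> y)"
    unfolding x(1) prod.case
    by (rule picard_converges[OF cont lip L Y0 Y]) (use x in auto)
qed

section \<open>The stationary Ornstein-Uhlenbeck process\<close>

lemma measurable_path_eval:
  assumes "wiener_measure P"
  shows "(\<lambda>\<omega>. \<omega> s) \<in> borel_measurable P"
proof (rule borel_measurableI)
  fix U :: "real set" assume "open U"
  have P: "space P = path_set" "sets P = sigma_sets path_set {U. openin compact_open_topology U}"
    using assms by (auto simp: wiener_measure_def)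
  have "{\<omega> \<in> path_set. \<omega> ` {s} \<subseteq> U} \<in> {{\<omega> \<in> path_set. \<omega> ` K \<subseteq> U} | K U. compact K \<and> open U}"
    using \<open>open U\<close> by (intro CollectI exI[of _ "{s}"] exI[of _ U]) auto
  then have "openin compact_open_topology {\<omega> \<in> path_set. \<omega> ` {s} \<subseteq> U}"
    unfolding compact_open_topology_def by (rule topology_generated_by_Basis)
  then have "{\<omega> \<in> path_set. \<omega> ` {s} \<subseteq> U} \<in> sets P" by (auto simp: P)
  also have "{\<omega> \<in> path_set. \<omega> ` {s} \<subseteq> U} = (\<lambda>\<omega>. \<omega> s) -` U \<inter> space P" by (auto simp: P)
  finally show "(\<lambda>\<omega>. \<omega> s) -` U \<inter> space P \<in> sets P" .
qed

lemma shift_shift: "shift s (shift t \<omega>) = shift (s + t) \<omega>"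
  by (simp add: shift_def fun_eq_iff algebra_simps)

text \<open>
  The easy half of Hake's theorem.
\<close>

lemma tendsto_integral_atMost_0:
  fixes f :: "real \<Rightarrow> real"
  assumes "f integrable_on {..0}"
  shows "(\<lambda>n. integral {- real n..0} f) \<longlonglongrightarrow> integral {..0} f"
proof (rule LIMSEQ_I)
  fix e :: real assume "0 < e"
  moreover have "(f has_integral integral {..0} f) {..0}" using assms by (rule integrable_integral)
  ultimately obtain B where B: "B > 0" "\<And>a b. ball 0 B \<subseteq> cbox a b \<Longrightarrow>
      norm (integral (cbox a b) (\<lambda>x. if x \<in> {..0} then f x else 0) - integral {..0} f) < e"
    unfolding has_integral_alt' by blast
  obtain N :: nat where N: "B \<le> real N" using real_arch_simple by blast
  have "norm (integral {- real n..0} f - integral {..0} f) < e" if "N \<le> n" for n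
  proof -
    have "ball 0 B \<subseteq> cbox (- real n) (real n)"
      using N that by (auto simp: dist_real_def)
    moreover have "cbox (- real n) (real n) \<inter> {..0} = {- real n..0}" by auto
    ultimately show ?thesis
      using B(2)[of "- real n" "real n"] integral_restrict_Int[of "cbox (- real n) (real n)" "{..0}" f] by simp
  qed
  then show "\<exists>N. \<forall>n\<ge>N. norm (integral {- real n..0} f - integral {..0} f) < e" by blast
qed

lemma subexponential_bound:
  fixes h :: "real \<Rightarrow> real"
  assumes cont: "continuous_on UNIV h" and lim: "((\<lambda>t. exp (- e * \<bar>t\<bar>) * \<bar>h t\<bar>) \<longlongrightarrow> 0) at_infinity"
  obtains C where "0 \<le> C" "\<And>t. \<bar>h t\<bar> \<le> C * exp (e * \<bar>t\<bar>)"
proof -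
  have "eventually (\<lambda>t. exp (- e * \<bar>t\<bar>) * \<bar>h t\<bar> < 1) at_infinity"
    using lim by (rule order_tendstoD) simp
  then obtain b where b: "\<And>t. b \<le> norm t \<Longrightarrow> exp (- e * \<bar>t\<bar>) * \<bar>h t\<bar> < 1"
    unfolding eventually_at_infinity by blast
  have "continuous_on {- \<bar>b\<bar>..\<bar>b\<bar>} (\<lambda>t. exp (- e * \<bar>t\<bar>) * \<bar>h t\<bar>)"
    by (intro continuous_intros continuous_on_subset[OF cont]) auto
  then have "bounded ((\<lambda>t. exp (- e * \<bar>t\<bar>) * \<bar>h t\<bar>) ` {- \<bar>b\<bar>..\<bar>b\<bar>})"
    by (intro compact_imp_bounded compact_continuous_image) auto
  then obtain c where c: "\<And>t. t \<in> {- \<bar>b\<bar>..\<bar>b\<bar>} \<Longrightarrow> exp (- e * \<bar>t\<bar>) * \<bar>h t\<bar> \<le> c"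
    unfolding bounded_iff by fastforce
  show ?thesis
  proof
    show "0 \<le> max 1 c" by simp
    fix t
    have "exp (- e * \<bar>t\<bar>) * \<bar>h t\<bar> \<le> max 1 c"
    proof (cases "b \<le> norm t")
      case False
      then have "t \<in> {- \<bar>b\<bar>..\<bar>b\<bar>}" by auto
      then show ?thesis using c[of t] by simp
    qed (use b[of t] in simp)
    then have "exp (e * \<bar>t\<bar>) * (exp (- e * \<bar>t\<bar>) * \<bar>h t\<bar>) \<le> exp (e * \<bar>t\<bar>) * max 1 c"
      by (intro mult_left_mono) auto
    then show "\<bar>h t\<bar> \<le> max 1 c * exp (e * \<bar>t\<bar>)"
      by (simp add: exp_minus field_simps)
  qed
qed

text \<open>
  The noise on an admissible sample space \<open>\<Omega>\<close>.
\<close>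

locale good_noise =
  fixes P :: "(real \<Rightarrow> real) measure" and \<epsilon> :: "real^'j::finite" and \<Omega> :: "('j \<Rightarrow> real \<Rightarrow> real) set"
  assumes wiener: "wiener_measure P" and good: "good_noise_set P \<epsilon> \<Omega>"
begin

lemma space_noise: "space (noise_space P \<Omega>) = \<Omega>"
  using good sets.sets_into_space by (auto simp: noise_space_def space_restrict_space good_noise_set_def)

lemma shift_in: "\<omega> \<in> \<Omega> \<Longrightarrow> shift t \<omega> \<in> \<Omega>"
  using good unfolding good_noise_set_def by blast

lemma path: "\<omega> \<in> \<Omega> \<Longrightarrow> \<omega> j \<in> path_set"
proof -
  assume "\<omega> \<in> \<Omega>"
  then have "\<omega> \<in> space (product_noise P)"
    using good sets.sets_into_space by (auto simp: good_noise_set_def)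
  then show ?thesis
    using wiener by (auto simp: product_noise_def space_PiM wiener_measure_def PiE_iff)
qed

lemma shift_0: "\<omega> \<in> \<Omega> \<Longrightarrow> shift 0 \<omega> = \<omega>"
  using path by (auto simp: shift_def fun_eq_iff path_set_def)

lemma continuous_ou: "\<omega> \<in> \<Omega> \<Longrightarrow> continuous_on S (\<lambda>t. ou \<epsilon> (shift t \<omega>))"
proof -
  assume "\<omega> \<in> \<Omega>"
  then have "continuous_on UNIV (\<lambda>t. \<chi> j. ou \<epsilon> (shift t \<omega>) $ j)"
    using good by (intro continuous_on_vec_lambda) (auto simp: good_noise_set_def)
  then show ?thesis by (auto intro: continuous_on_subset)
qed

lemma measurable_coordinate: "(\<lambda>\<omega>. \<omega> j s) \<in> borel_measurable (noise_space P \<Omega>)"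
  unfolding noise_space_def product_noise_def
  by (intro measurable_restrict_space1 measurable_compose[OF measurable_component_singleton measurable_path_eval] wiener) simp

text \<open>
  The improper integral is a limit of integrals over \<open>[- n, 0]\<close>, which are measurable in \<open>\<omega>\<close> since the
  coordinates \<open>\<omega> j s\<close> are jointly measurable in \<open>s\<close> and \<open>\<omega>\<close>.
\<close>

lemma measurable_ou: "(\<lambda>\<omega>. ou \<epsilon> (shift t \<omega>)) \<in> borel_measurable (noise_space P \<Omega>)"
proof -
  let ?M = "noise_space P \<Omega>"
  have *: "(\<lambda>\<omega>. ou \<epsilon> (shift t \<omega>) $ j) \<in> borel_measurable ?M" for j
  proof -
    have cont: "continuous_on S (\<omega> j)" if "\<omega> \<in> \<Omega>" for \<omega> S
      using path[OF that, of j] by (auto simp: path_set_def intro: continuous_on_subset)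
    have [measurable]: "(\<lambda>x. snd x j (fst x)) \<in> borel_measurable (borel \<Otimes>\<^sub>M ?M)"
      by (rule caratheodory_measurable) (auto intro: measurable_coordinate cont simp: space_noise)
    note [measurable] = measurable_coordinate
    have "(\<lambda>x. (snd x + t, fst x)) \<in> ?M \<Otimes>\<^sub>M lborel \<rightarrow>\<^sub>M borel \<Otimes>\<^sub>M ?M" by measurable
    from measurable_compose[OF this, of "\<lambda>x. snd x j (fst x)" borel]
    have [measurable]: "(\<lambda>x. fst x j (snd x + t)) \<in> borel_measurable (?M \<Otimes>\<^sub>M lborel)" by simp
    define I where "I n \<omega> = (LINT s|lborel. indicator {- real n..0} s *\<^sub>R (exp s * (\<omega> j (s + t) - \<omega> j t)))" for n \<omega>
    have I: "I n \<in> borel_measurable ?M" for n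
      unfolding I_def
      by (rule sigma_finite_measure.borel_measurable_lebesgue_integral[OF sigma_finite_lborel])
        (simp add: case_prod_beta)
    have lim: "(\<lambda>n. - (\<epsilon> $ j) * I n \<omega>) \<longlonglongrightarrow> ou \<epsilon> (shift t \<omega>) $ j" if \<omega>: "\<omega> \<in> \<Omega>" for \<omega>
    proof -
      have "(\<lambda>s. exp s * shift t \<omega> j s) integrable_on {..0}"
        using good shift_in[OF \<omega>] unfolding good_noise_set_def by blast
      then have "(\<lambda>n. integral {- real n..0} (\<lambda>s. exp s * shift t \<omega> j s)) \<longlonglongrightarrow> integral {..0} (\<lambda>s. exp s * shift t \<omega> j s)"
        by (rule tendsto_integral_atMost_0)
      moreover have "integral {- real n..0} (\<lambda>s. exp s * shift t \<omega> j s) = I n \<omega>" for n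
      proof -
        have "continuous_on {- real n..0} (\<lambda>s. exp s * (\<omega> j (s + t) - \<omega> j t))"
          by (intro continuous_intros continuous_on_compose2[OF cont[OF \<omega>, of UNIV]]) auto
        from set_borel_integral_eq_integral(2)[OF borel_integrable_atLeastAtMost'[OF this]]
        show ?thesis by (simp add: I_def set_lebesgue_integral_def shift_def)
      qed
      ultimately have "(\<lambda>n. I n \<omega>) \<longlonglongrightarrow> integral {..0} (\<lambda>s. exp s * shift t \<omega> j s)" by simp
      from tendsto_mult[OF tendsto_const[of "- (\<epsilon> $ j)"] this] show ?thesis by (simp add: ou_def)
    qed
    show ?thesis
      by (rule borel_measurable_LIMSEQ_real[OF lim]) (use I in \<open>auto simp: space_noise\<close>)
  qed
  show ?thesis
    by (subst borel_measurable_euclidean_space) (auto simp: Basis_vec_def inner_axis *)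
qed

lemma measurable_ou_joint: "(\<lambda>x. ou \<epsilon> (shift (fst x) (snd x))) \<in> borel_measurable (borel \<Otimes>\<^sub>M noise_space P \<Omega>)"
  by (rule caratheodory_measurable[OF measurable_ou]) (simp add: continuous_ou space_noise)

lemma ou_subexponential:
  assumes \<omega>: "\<omega> \<in> \<Omega>" and e: "0 < e"
  obtains C where "0 \<le> C" "\<And>t. norm (ou \<epsilon> (shift t \<omega>)) \<le> C * exp (e * \<bar>t\<bar>)"
proof -
  have "\<exists>C\<ge>0. \<forall>t. \<bar>ou \<epsilon> (shift t \<omega>) $ j\<bar> \<le> C * exp (e * \<bar>t\<bar>)" for j
  proof -
    have "continuous_on UNIV (\<lambda>t. ou \<epsilon> (shift t \<omega>) $ j)"
      "((\<lambda>t. exp (- e * \<bar>t\<bar>) * \<bar>ou \<epsilon> (shift t \<omega>) $ j\<bar>) \<longlongrightarrow> 0) at_infinity"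
      using good \<omega> e unfolding good_noise_set_def by blast+
    from subexponential_bound[OF this] show ?thesis by metis
  qed
  then obtain C where C: "\<And>j. 0 \<le> C j" "\<And>j t. \<bar>ou \<epsilon> (shift t \<omega>) $ j\<bar> \<le> C j * exp (e * \<bar>t\<bar>)" by metis
  show ?thesis
  proof
    show "0 \<le> (\<Sum>j\<in>UNIV. C j)" by (intro sum_nonneg C)
    fix t
    have "norm (ou \<epsilon> (shift t \<omega>)) \<le> (\<Sum>j\<in>UNIV. \<bar>ou \<epsilon> (shift t \<omega>) $ j\<bar>)" by (rule norm_le_l1_cart)
    also have "\<dots> \<le> (\<Sum>j\<in>UNIV. C j * exp (e * \<bar>t\<bar>))" by (intro sum_mono C)
    finally show "norm (ou \<epsilon> (shift t \<omega>)) \<le> (\<Sum>j\<in>UNIV. C j) * exp (e * \<bar>t\<bar>)" by (simp add: sum_distrib_right)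
  qed
qed

end

section \<open>The cylinder and the vector field\<close>

text \<open>
  The coefficient of \<^const>\<open>eta0\<close> in the decomposition of the phase space into \<^const>\<open>E1\<close> and
  \<^const>\<open>E2\<close>.
\<close>

definition coord :: "real \<Rightarrow> 'j::finite phase \<Rightarrow> real" where
  "coord \<alpha> y = (fst y \<bullet> ones + (snd y \<bullet> ones) / \<alpha>) / real CARD('j)"

lemma linear_coord: "linear (coord \<alpha>)"
proof (rule linearI)
  fix x y :: "'a phase" and r :: real
  show "coord \<alpha> (x + y) = coord \<alpha> x + coord \<alpha> y"
    unfolding coord_def fst_add snd_add inner_add_left add_divide_distrib by simp
  show "coord \<alpha> (r *\<^sub>R x) = r *\<^sub>R coord \<alpha> x"
    by (simp add: coord_def add_divide_distrib distrib_left)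
qed

lemma coord_eta0: "coord \<alpha> (eta0 :: 'a::finite phase) = 1"
proof -
  have "fst (eta0 :: 'a phase) = ones" "snd (eta0 :: 'a phase) = 0"
    by (simp_all add: eta0_def ones_def)
  then show ?thesis by (simp add: coord_def inner_ones_ones)
qed

lemma E2_iff_coord: "\<alpha> \<noteq> 0 \<Longrightarrow> y \<in> E2 \<alpha> \<longleftrightarrow> coord \<alpha> y = 0"
  by (simp add: E2_iff coord_def field_simps)

lemma mod_p0_add:
  assumes \<alpha>: "\<alpha> \<noteq> 0" and a: "a \<in> E1" and b: "b \<in> E2 \<alpha>"
  shows "mod_p0 \<alpha> \<kappa> (a + b) = (p0_coset \<kappa> a, b)"
  unfolding mod_p0_def
proof (rule the_equality)
  fix X assume "\<exists>a'\<in>E1. \<exists>b'\<in>E2 \<alpha>. a + b = a' + b' \<and> X = (p0_coset \<kappa> a', b')"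
  then obtain a' b' where *: "a' \<in> E1" "b' \<in> E2 \<alpha>" "a + b = a' + b'" "X = (p0_coset \<kappa> a', b')" by blast
  from a *(1) obtain r r' where r: "a = r *\<^sub>R eta0" "a' = r' *\<^sub>R eta0"
    by (auto simp: E1_def span_singleton)
  have "coord \<alpha> (a + b) = r" "coord \<alpha> (a' + b') = r'"
    using b *(2) \<alpha> by (simp_all add: r linear_add[OF linear_coord] linear_cmul[OF linear_coord] coord_eta0 E2_iff_coord)
  with *(3) have "r = r'" by simp
  with r *(3,4) show "X = (p0_coset \<kappa> a, b)" by simp
qed (use a b in blast)

lemma mod_p0_eq:
  fixes y :: "'j::finite phase"
  assumes \<alpha>: "\<alpha> \<noteq> 0"
  shows "mod_p0 \<alpha> \<kappa> y = (p0_coset \<kappa> (coord \<alpha> y *\<^sub>R eta0), y - coord \<alpha> y *\<^sub>R eta0)"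
proof -
  have a: "coord \<alpha> y *\<^sub>R eta0 \<in> E1" by (auto simp: E1_def span_singleton)
  have b: "y - coord \<alpha> y *\<^sub>R eta0 \<in> E2 \<alpha>"
    using \<alpha> by (simp add: E2_iff_coord linear_diff[OF linear_coord] linear_cmul[OF linear_coord] coord_eta0)
  show ?thesis using mod_p0_add[OF \<alpha> a b, of \<kappa>] by simp
qed

lemma cylinder_eq_range:
  assumes \<alpha>: "\<alpha> \<noteq> 0"
  shows "cylinder \<alpha> \<kappa> = range (mod_p0 \<alpha> \<kappa> :: 'a::finite phase \<Rightarrow> _)"
proof (intro antisym subsetI)
  fix X :: "'a phase set \<times> 'a phase"
  assume "X \<in> cylinder \<alpha> \<kappa>"
  then obtain a b where ab: "a \<in> E1" "b \<in> E2 \<alpha>" "X = (p0_coset \<kappa> a, b)" by (auto simp: cylinder_def)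
  then have "X = mod_p0 \<alpha> \<kappa> (a + b)" by (simp add: mod_p0_add[OF \<alpha> ab(1,2)])
  then show "X \<in> range (mod_p0 \<alpha> \<kappa>)" by blast
next
  fix X :: "'a phase set \<times> 'a phase"
  assume "X \<in> range (mod_p0 \<alpha> \<kappa>)"
  then show "X \<in> cylinder \<alpha> \<kappa>"
    using \<alpha> by (auto simp: mod_p0_eq cylinder_def E1_def span_singleton E2_iff_coord
        linear_diff[OF linear_coord] linear_cmul[OF linear_coord] coord_eta0)
qed

lemma p0_coset_eq_iff: "p0_coset \<kappa> a = p0_coset \<kappa> a' \<longleftrightarrow> (\<exists>k::int. a' = a + of_int k *\<^sub>R (\<kappa> *\<^sub>R eta0))"
proof
  assume "p0_coset \<kappa> a = p0_coset \<kappa> a'"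
  moreover have "a' \<in> p0_coset \<kappa> a'" unfolding p0_coset_def by (intro CollectI exI[of _ 0]) simp
  ultimately show "\<exists>k::int. a' = a + of_int k *\<^sub>R (\<kappa> *\<^sub>R eta0)" by (auto simp: p0_coset_def)
next
  assume "\<exists>k::int. a' = a + of_int k *\<^sub>R (\<kappa> *\<^sub>R eta0)"
  then obtain k :: int where k: "a' = a + of_int k *\<^sub>R (\<kappa> *\<^sub>R eta0)" ..
  have "a + of_int l *\<^sub>R (\<kappa> *\<^sub>R eta0) = a' + of_int (l - k) *\<^sub>R (\<kappa> *\<^sub>R eta0)"
    "a' + of_int l *\<^sub>R (\<kappa> *\<^sub>R eta0) = a + of_int (l + k) *\<^sub>R (\<kappa> *\<^sub>R eta0)" for l
    by (simp_all add: k algebra_simps)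
  then show "p0_coset \<kappa> a = p0_coset \<kappa> a'" unfolding p0_coset_def by blast
qed

lemma cyclic_quotient_cylinder:
  fixes \<nu> :: "'j::finite phase \<Rightarrow> real"
  assumes \<alpha>: "\<alpha> \<noteq> 0" and \<kappa>: "0 < \<kappa>" and \<nu>: "is_norm \<nu>"
  shows "cyclic_quotient (mod_p0 \<alpha> \<kappa>) (\<kappa> *\<^sub>R eta0) (\<lambda>y. coord \<alpha> y / \<kappa>) \<nu> (cylinder_dist \<nu>)"
proof (rule cyclic_quotient.intro)
  show "linear (\<lambda>y :: 'j phase. coord \<alpha> y / \<kappa>)"
    by (rule linearI) (simp_all add: linear_add[OF linear_coord] linear_cmul[OF linear_coord] add_divide_distrib)
  show "coord \<alpha> (\<kappa> *\<^sub>R eta0 :: 'j phase) / \<kappa> = 1"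
    using \<kappa> by (simp add: linear_cmul[OF linear_coord] coord_eta0)
  fix y y' :: "'j phase"
  show "mod_p0 \<alpha> \<kappa> y = mod_p0 \<alpha> \<kappa> y' \<longleftrightarrow> (\<exists>k::int. y' = y + of_int k *\<^sub>R \<kappa> *\<^sub>R eta0)"
  proof
    assume "mod_p0 \<alpha> \<kappa> y = mod_p0 \<alpha> \<kappa> y'"
    then have C: "p0_coset \<kappa> (coord \<alpha> y *\<^sub>R eta0 :: 'j phase) = p0_coset \<kappa> (coord \<alpha> y' *\<^sub>R eta0)"
      and w: "y - coord \<alpha> y *\<^sub>R eta0 = y' - coord \<alpha> y' *\<^sub>R eta0"
      by (simp_all add: mod_p0_eq[OF \<alpha>])
    obtain k :: int where k: "coord \<alpha> y' *\<^sub>R eta0 = coord \<alpha> y *\<^sub>R eta0 + of_int k *\<^sub>R (\<kappa> *\<^sub>R eta0 :: 'j phase)"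
      using C unfolding p0_coset_eq_iff by blast
    have "y' = (y' - coord \<alpha> y' *\<^sub>R eta0) + coord \<alpha> y' *\<^sub>R eta0" by simp
    also have "\<dots> = (y - coord \<alpha> y *\<^sub>R eta0) + (coord \<alpha> y *\<^sub>R eta0 + of_int k *\<^sub>R (\<kappa> *\<^sub>R eta0))"
      by (rule arg_cong2[where f = "(+)", OF w[symmetric] k])
    also have "\<dots> = y + of_int k *\<^sub>R \<kappa> *\<^sub>R eta0" by simp
    finally have "y' = y + of_int k *\<^sub>R \<kappa> *\<^sub>R eta0" .
    then show "\<exists>k::int. y' = y + of_int k *\<^sub>R \<kappa> *\<^sub>R eta0" ..
  next
    assume "\<exists>k::int. y' = y + of_int k *\<^sub>R \<kappa> *\<^sub>R eta0"
    then obtain k :: int where k: "y' = y + of_int k *\<^sub>R \<kappa> *\<^sub>R eta0" ..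
    then have "coord \<alpha> y' = coord \<alpha> y + of_int k * \<kappa>"
      by (simp add: linear_add[OF linear_coord] linear_cmul[OF linear_coord] coord_eta0)
    then show "mod_p0 \<alpha> \<kappa> y = mod_p0 \<alpha> \<kappa> y'"
      unfolding mod_p0_eq[OF \<alpha>] prod.inject p0_coset_eq_iff by (auto simp: k scaleR_add_left intro!: exI[of _ k])
  qed
  show "cylinder_dist \<nu> (mod_p0 \<alpha> \<kappa> y) (mod_p0 \<alpha> \<kappa> y') = (INF k::int. \<nu> (y - y' + of_int k *\<^sub>R \<kappa> *\<^sub>R eta0))"
  proof -
    define w where "w y = y - coord \<alpha> y *\<^sub>R eta0" for y :: "'j phase"
    have y: "coord \<alpha> y *\<^sub>R eta0 + w y = y" for y by (simp add: w_def)
    have ne: "p0_coset \<kappa> a \<noteq> {}" for a :: "'j phase"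
      unfolding p0_coset_def by blast
    have "{\<nu> ((a + w y) - (a' + w y')) | a a'. a \<in> p0_coset \<kappa> (coord \<alpha> y *\<^sub>R eta0) \<and> a' \<in> p0_coset \<kappa> (coord \<alpha> y' *\<^sub>R eta0)}
        = range (\<lambda>k::int. \<nu> (y - y' + of_int k *\<^sub>R \<kappa> *\<^sub>R eta0))"
    proof (intro antisym subsetI)
      fix r assume "r \<in> {\<nu> ((a + w y) - (a' + w y')) | a a'. a \<in> p0_coset \<kappa> (coord \<alpha> y *\<^sub>R eta0) \<and> a' \<in> p0_coset \<kappa> (coord \<alpha> y' *\<^sub>R eta0)}"
      then obtain k k' :: int where "r = \<nu> ((coord \<alpha> y *\<^sub>R eta0 + of_int k *\<^sub>R \<kappa> *\<^sub>R eta0 + w y)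
          - (coord \<alpha> y' *\<^sub>R eta0 + of_int k' *\<^sub>R \<kappa> *\<^sub>R eta0 + w y'))"
        by (auto simp: p0_coset_def)
      also have "(coord \<alpha> y *\<^sub>R eta0 + of_int k *\<^sub>R \<kappa> *\<^sub>R eta0 + w y)
          - (coord \<alpha> y' *\<^sub>R eta0 + of_int k' *\<^sub>R \<kappa> *\<^sub>R eta0 + w y') = y - y' + of_int (k - k') *\<^sub>R \<kappa> *\<^sub>R eta0"
        by (simp add: w_def scaleR_diff_left left_diff_distrib)
      finally show "r \<in> range (\<lambda>k::int. \<nu> (y - y' + of_int k *\<^sub>R \<kappa> *\<^sub>R eta0))" by blast
    next
      fix r assume "r \<in> range (\<lambda>k::int. \<nu> (y - y' + of_int k *\<^sub>R \<kappa> *\<^sub>R eta0))"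
      then obtain k :: int where "r = \<nu> (y - y' + of_int k *\<^sub>R \<kappa> *\<^sub>R eta0)" by blast
      also have "y - y' + of_int k *\<^sub>R \<kappa> *\<^sub>R eta0 = (coord \<alpha> y *\<^sub>R eta0 + of_int k *\<^sub>R \<kappa> *\<^sub>R eta0 + w y)
          - (coord \<alpha> y' *\<^sub>R eta0 + of_int 0 *\<^sub>R \<kappa> *\<^sub>R eta0 + w y')"
        by (simp add: w_def)
      finally show "r \<in> {\<nu> ((a + w y) - (a' + w y')) | a a'. a \<in> p0_coset \<kappa> (coord \<alpha> y *\<^sub>R eta0) \<and> a' \<in> p0_coset \<kappa> (coord \<alpha> y' *\<^sub>R eta0)}"
        unfolding p0_coset_def by blast
    qed
    then show ?thesis
      unfolding mod_p0_eq[OF \<alpha>] w_def[symmetric] cylinder_dist_def prod.case by (simp add: ne)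
  qed
next
  fix X X' :: "'j phase set \<times> 'j phase"
  obtain S b S' b' where X: "X = (S, b)" "X' = (S', b')" by (cases X, cases X')
  show "0 \<le> cylinder_dist \<nu> X X'"
    unfolding X cylinder_dist_def prod.case
    by (auto intro!: cInf_greatest is_norm_nonneg[OF \<nu>])
  have "{\<nu> ((a + b) - (a' + b')) | a a'. a \<in> S \<and> a' \<in> S'} = {\<nu> ((a' + b') - (a + b)) | a' a. a' \<in> S' \<and> a \<in> S}"
    using is_norm_minus_commute[OF \<nu>] by blast
  then show "cylinder_dist \<nu> X X' = cylinder_dist \<nu> X' X"
    unfolding X cylinder_dist_def prod.case by auto
qed (rule \<nu>)

lemma random_field_split:
  "random_field A K \<alpha> \<beta> f g z (u, v) = (v, - (K *\<^sub>R (A *v u)) - \<alpha> *\<^sub>R v) +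
     (z, f - \<beta> *\<^sub>R (\<chi> j. g (u $ j)) + (1 - \<alpha>) *\<^sub>R z)"
  by (simp add: random_field_def algebra_simps)

lemma random_field_lipschitz:
  fixes A :: "real^'j::finite^'j"
  assumes g: "\<And>x y. \<bar>g x - g y\<bar> \<le> c * \<bar>x - y\<bar>" and c: "0 \<le> c"
  obtains L where "0 < L"
    "\<And>z x y. norm (random_field A K \<alpha> \<beta> f g z x - random_field A K \<alpha> \<beta> f g z y) \<le> L * norm (x - y)"
proof -
  define C where "C = (\<lambda>y :: 'j phase. (snd y, - (K *\<^sub>R (A *v fst y)) - \<alpha> *\<^sub>R snd y))"
  have "linear C"
    by (rule linearI) (simp_all add: C_def matrix_vector_right_distrib matrix_vector_mult_scaleR algebra_simps)
  then obtain B where B: "0 < B" "\<And>y. norm (C y) \<le> norm y * B"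
    using bounded_linear.pos_bounded linear_conv_bounded_linear by blast
  show ?thesis
  proof
    show "0 < B + \<bar>\<beta>\<bar> * c" using B(1) c by (intro add_pos_nonneg) auto
    fix z :: "real^'j" and x y :: "'j phase"
    have "random_field A K \<alpha> \<beta> f g z x - random_field A K \<alpha> \<beta> f g z y
        = C (x - y) - (0, \<beta> *\<^sub>R ((\<chi> j. g (fst x $ j)) - (\<chi> j. g (fst y $ j))))"
      by (cases x; cases y) (simp add: random_field_def C_def matrix_vector_mult_diff_distrib algebra_simps)
    also have "norm \<dots> \<le> norm (C (x - y)) + norm ((0 :: real^'j, \<beta> *\<^sub>R ((\<chi> j. g (fst x $ j)) - (\<chi> j. g (fst y $ j)))))"
      by (rule norm_triangle_ineq4)
    also have "norm ((0 :: real^'j, \<beta> *\<^sub>R ((\<chi> j. g (fst x $ j)) - (\<chi> j. g (fst y $ j)))))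
        = \<bar>\<beta>\<bar> * norm ((\<chi> j. g (fst x $ j)) - (\<chi> j. g (fst y $ j)))"
      by (simp add: norm_Pair)
    also have "norm (C (x - y)) + \<bar>\<beta>\<bar> * norm ((\<chi> j. g (fst x $ j)) - (\<chi> j. g (fst y $ j)))
        \<le> norm (x - y) * B + \<bar>\<beta>\<bar> * (c * norm (x - y))"
    proof (intro add_mono B mult_left_mono)
      have "norm ((\<chi> j. g (fst x $ j)) - (\<chi> j. g (fst y $ j))) \<le> norm (c *\<^sub>R (fst x - fst y))"
        using g c by (intro norm_le_componentwise_cart) (simp add: abs_mult)
      also have "\<dots> \<le> c * norm (x - y)"
        using c dist_fst_le[of x y] by (simp add: mult_left_mono dist_norm)
      finally show "norm ((\<chi> j. g (fst x $ j)) - (\<chi> j. g (fst y $ j))) \<le> c * norm (x - y)" .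
    qed simp
    also have "\<dots> = (B + \<bar>\<beta>\<bar> * c) * norm (x - y)" by (simp add: algebra_simps)
    finally show "norm (random_field A K \<alpha> \<beta> f g z x - random_field A K \<alpha> \<beta> f g z y) \<le> (B + \<bar>\<beta>\<bar> * c) * norm (x - y)" .
  qed
qed

lemma continuous_random_field:
  assumes "continuous_on UNIV g"
  shows "continuous_on UNIV (\<lambda>(z, y). random_field A K \<alpha> \<beta> f g z y)"
proof -
  have "continuous_on UNIV (\<lambda>x :: (real^'a) \<times> 'a phase. g (fst (snd x) $ j))" for j
    by (rule continuous_on_compose2[OF assms]) (auto intro!: continuous_intros)
  then show ?thesis
    unfolding random_field_def case_prod_beta
    by (intro continuous_intros linear_continuous_on_compose[OF _ matrix_vector_mul_linear]) auto
qed

lemma periodic_int: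
  fixes g :: "real \<Rightarrow> real"
  assumes "\<And>x. g (x + \<kappa>) = g x"
  shows "g (x + of_int k * \<kappa>) = g x"
proof -
  have nat: "g (x + real n * \<kappa>) = g x" for n x
    by (induction n) (use assms[of "x + real _ * \<kappa>"] in \<open>simp_all add: algebra_simps\<close>)
  show ?thesis
  proof (cases "0 \<le> k")
    case True
    then show ?thesis using nat[of x "nat k"] by simp
  next
    case False
    then show ?thesis using nat[of "x + of_int k * \<kappa>" "nat (- k)"] by simp
  qed
qed

lemma random_field_periodic:
  fixes A :: "real^'a::finite^'a"
  assumes A: "A *v ones = 0" and g: "\<And>x. g (x + \<kappa>) = g x"
  shows "random_field A K \<alpha> \<beta> f g z (y + of_int k *\<^sub>R (\<kappa> *\<^sub>R eta0)) = random_field A K \<alpha> \<beta> f g z y"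
proof -
  obtain u v where y: "y = (u, v)" by (cases y)
  have "(\<chi> j. g ((u + (of_int k * \<kappa>) *\<^sub>R ones) $ j)) = (\<chi> j. g (u $ j))"
    by (simp add: vec_eq_iff ones_def periodic_int[of g \<kappa>, OF g])
  then show ?thesis
    by (simp add: y eta0_eq random_field_def matrix_vector_right_distrib matrix_vector_mult_scaleR A)
qed

lemma INF_ennreal_dense:
  fixes h :: "'a::metric_space \<Rightarrow> real"
  assumes h: "continuous_on UNIV h" and T: "T \<subseteq> S" "S \<subseteq> closure T"
  shows "(INF y\<in>S. ennreal (h y)) = (INF y\<in>T. ennreal (h y))"
proof (rule antisym)
  show "(INF y\<in>S. ennreal (h y)) \<le> (INF y\<in>T. ennreal (h y))"
    using T(1) by (rule INF_superset_mono) auto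
  show "(INF y\<in>T. ennreal (h y)) \<le> (INF y\<in>S. ennreal (h y))"
  proof (rule INF_greatest)
    fix y assume "y \<in> S"
    then obtain s where s: "\<And>n. s n \<in> T" "s \<longlonglongrightarrow> y" using T(2) closure_sequential by blast
    have "isCont h y" using h by (simp add: continuous_on_eq_continuous_at)
    then have "(\<lambda>n. h (s n)) \<longlonglongrightarrow> h y" using s(2) by (rule isCont_tendsto_compose)
    then have "(\<lambda>n. ennreal (h (s n))) \<longlonglongrightarrow> ennreal (h y)" by (rule tendsto_ennrealI)
    then show "(INF y\<in>T. ennreal (h y)) \<le> ennreal (h y)"
      by (rule LIMSEQ_le_const) (auto intro: INF_lower s(1))
  qed
qed

section \<open>The flow on the cylinder and its attractor\<close>

text \<open>
  The random system for an arbitrary finite index set.  Simplicity of the eigenvalue \<open>0\<close>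
  of \<open>A\<close> enters only through the kernel, and \<open>g\<close> is only required to be bounded, Lipschitz and periodic.
\<close>

locale cylinder_system = good_noise P \<epsilon> \<Omega>
  for P :: "(real \<Rightarrow> real) measure" and \<epsilon> :: "real^'j::finite" and \<Omega> :: "('j \<Rightarrow> real \<Rightarrow> real) set" +
  fixes A :: "real^'j^'j" and K \<alpha> \<beta> \<kappa> c1 c2 :: real and f :: "real^'j" and g :: "real \<Rightarrow> real"
    and Y :: "real \<Rightarrow> ('j \<Rightarrow> real \<Rightarrow> real) \<Rightarrow> 'j phase \<Rightarrow> 'j phase" and \<nu> :: "'j phase \<Rightarrow> real"
  assumes \<alpha>_pos: "0 < \<alpha>" and K_pos: "0 < K" and \<kappa>_pos: "0 < \<kappa>"
    and A_sym: "transpose A = A" and A_psd: "0 \<le> x \<bullet> (A *v x)" and A_ones: "A *v ones = 0"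
    and A_kernel: "A *v u = 0 \<Longrightarrow> u \<bullet> ones = 0 \<Longrightarrow> u = 0"
    and g_bounded: "\<bar>g r\<bar> \<le> c1" and g_lipschitz: "\<bar>g r - g s\<bar> \<le> c2 * \<bar>r - s\<bar>" and c2: "0 \<le> c2"
    and g_periodic: "g (r + \<kappa>) = g r"
    and norm_\<nu>: "is_norm \<nu>"
    and solution: "\<omega> \<in> \<Omega> \<Longrightarrow> random_solution A K \<alpha> \<beta> f g \<epsilon> \<omega> Y0 (\<lambda>t. Y t \<omega> Y0)"
begin

abbreviation field :: "real \<Rightarrow> ('j \<Rightarrow> real \<Rightarrow> real) \<Rightarrow> 'j phase \<Rightarrow> 'j phase" where
  "field t \<omega> \<equiv> random_field A K \<alpha> \<beta> f g (ou \<epsilon> (shift t \<omega>))"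

abbreviation \<pi> :: "'j phase \<Rightarrow> 'j phase set \<times> 'j phase" where
  "\<pi> \<equiv> mod_p0 \<alpha> \<kappa>"

sublocale quot: cyclic_quotient "mod_p0 \<alpha> \<kappa>" "\<kappa> *\<^sub>R eta0" "\<lambda>y. coord \<alpha> y / \<kappa>" \<nu> "cylinder_dist \<nu>"
  using \<alpha>_pos by (intro cyclic_quotient_cylinder \<kappa>_pos norm_\<nu>) simp

lemma cylinder_range: "cylinder \<alpha> \<kappa> = range \<pi>"
  using \<alpha>_pos by (intro cylinder_eq_range) simp

lemma g_continuous: "continuous_on S g"
  by (rule lipschitz_on_continuous_on[of c2]) (auto intro!: lipschitz_onI simp: dist_real_def g_lipschitz c2)

lemma Y_0: "\<omega> \<in> \<Omega> \<Longrightarrow> Y 0 \<omega> y = y"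
  using solution by (simp add: random_solution_def)

lemma Y_deriv: "\<omega> \<in> \<Omega> \<Longrightarrow> 0 \<le> t \<Longrightarrow>
    ((\<lambda>t. Y t \<omega> y) has_vector_derivative field t \<omega> (Y t \<omega> y)) (at t within {0..})"
  using solution by (simp add: random_solution_def)

lemma field_lipschitz:
  obtains L where "0 < L"
    "\<And>z x y. norm (random_field A K \<alpha> \<beta> f g z x - random_field A K \<alpha> \<beta> f g z y) \<le> L * norm (x - y)"
  using random_field_lipschitz[OF g_lipschitz c2] by metis

lemma Y_unique:
  assumes \<omega>: "\<omega> \<in> \<Omega>" and t: "0 \<le> t" and 0: "y1 0 = y"
    and y1: "\<And>t. 0 \<le> t \<Longrightarrow> (y1 has_vector_derivative field t \<omega> (y1 t)) (at t within {0..})"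
  shows "Y t \<omega> y = y1 t"
proof -
  obtain L where L: "0 < L"
    "\<And>z x y. norm (random_field A K \<alpha> \<beta> f g z x - random_field A K \<alpha> \<beta> f g z y) \<le> L * norm (x - y)"
    using field_lipschitz by blast
  have "norm (Y t \<omega> y - y1 t) \<le> exp (L * t) * norm (Y 0 \<omega> y - y1 0)"
    by (rule lipschitz_ode_dependence[OF L(2) Y_deriv[OF \<omega>] y1 t])
  then show ?thesis by (simp add: Y_0[OF \<omega>] 0)
qed

lemma Y_translate:
  assumes \<omega>: "\<omega> \<in> \<Omega>" and t: "0 \<le> t"
  shows "Y t \<omega> (y + of_int k *\<^sub>R \<kappa> *\<^sub>R eta0) = Y t \<omega> y + of_int k *\<^sub>R \<kappa> *\<^sub>R eta0"
proof (rule Y_unique[OF \<omega> t])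
  fix t :: real assume "0 \<le> t"
  from has_vector_derivative_add[OF Y_deriv[OF \<omega> this, of y] has_vector_derivative_const]
  show "((\<lambda>t. Y t \<omega> y + of_int k *\<^sub>R \<kappa> *\<^sub>R eta0) has_vector_derivative
      field t \<omega> (Y t \<omega> y + of_int k *\<^sub>R \<kappa> *\<^sub>R eta0)) (at t within {0..})"
    by (simp only: random_field_periodic[OF A_ones, of g \<kappa>, OF g_periodic] add_0_right)
qed (simp add: Y_0[OF \<omega>])

lemma Y_cocycle:
  assumes \<omega>: "\<omega> \<in> \<Omega>" and s: "0 \<le> s" and t: "0 \<le> t"
  shows "Y (t + s) \<omega> y = Y t (shift s \<omega>) (Y s \<omega> y)"
proof (rule Y_unique[OF shift_in[OF \<omega>] t, symmetric])
  fix t :: real assume t: "0 \<le> t"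
  have "((\<lambda>t. t + s) has_vector_derivative 1) (at t within {0..})"
    by (auto intro!: derivative_eq_intros simp: has_real_derivative_iff_has_vector_derivative[symmetric])
  moreover have "((\<lambda>t. Y t \<omega> y) has_vector_derivative field (t + s) \<omega> (Y (t + s) \<omega> y)) (at (t + s) within (\<lambda>t. t + s) ` {0..})"
    using s t by (intro has_vector_derivative_within_subset[OF Y_deriv[OF \<omega>]]) auto
  ultimately have "((\<lambda>t. Y t \<omega> y) \<circ> (\<lambda>t. t + s) has_vector_derivative 1 *\<^sub>R field (t + s) \<omega> (Y (t + s) \<omega> y)) (at t within {0..})"
    by (rule vector_diff_chain_within)
  then show "((\<lambda>t. Y (t + s) \<omega> y) has_vector_derivative field t (shift s \<omega>) (Y (t + s) \<omega> y)) (at t within {0..})"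
    by (simp add: shift_shift o_def)
qed simp

lemma Y_continuous:
  assumes \<omega>: "\<omega> \<in> \<Omega>" and t: "0 \<le> t"
  shows "continuous_on UNIV (Y t \<omega>)"
proof -
  obtain L where L: "0 < L"
    "\<And>z x y. norm (random_field A K \<alpha> \<beta> f g z x - random_field A K \<alpha> \<beta> f g z y) \<le> L * norm (x - y)"
    using field_lipschitz by blast
  have "norm (Y t \<omega> y - Y t \<omega> y') \<le> exp (L * t) * norm (Y 0 \<omega> y - Y 0 \<omega> y')" for y y'
    by (rule lipschitz_ode_dependence[OF L(2) Y_deriv[OF \<omega>] Y_deriv[OF \<omega>] t])
  then have "(exp (L * t))-lipschitz_on UNIV (Y t \<omega>)"
    by (intro lipschitz_onI) (auto simp: dist_norm Y_0[OF \<omega>])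
  then show ?thesis by (rule lipschitz_on_continuous_on)
qed

text \<open>
  The noise is shifted by a fixed \<open>r\<close> in order to avoid measurability of the shift itself: the shifted
  solution is driven by the path \<open>t \<mapsto> ou \<epsilon> (shift (t + r) \<omega>)\<close>.
\<close>

lemma measurable_Y:
  "(\<lambda>(t, \<omega>, y). Y t (shift r \<omega>) y) \<in> borel_measurable (restrict_space borel {0..} \<Otimes>\<^sub>M (noise_space P \<Omega> \<Otimes>\<^sub>M borel))"
proof -
  let ?M = "noise_space P \<Omega>"
  define RF where "RF = (\<lambda>(z, y). random_field A K \<alpha> \<beta> f g z y)"
  have RF_cont: "continuous_on UNIV RF"
    unfolding RF_def by (rule continuous_random_field[OF g_continuous])
  obtain L where L: "0 < L"
    "\<And>z x y. norm (random_field A K \<alpha> \<beta> f g z x - random_field A K \<alpha> \<beta> f g z y) \<le> L * norm (x - y)"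
    using field_lipschitz by blast
  show ?thesis
  proof (rule measurable_lipschitz_ode_solution[where F = "\<lambda>t \<omega>. field (t + r) \<omega>", OF _ _ L(2) L(1)])
    have "(\<lambda>x :: real \<times> ('j \<Rightarrow> real \<Rightarrow> real) \<times> 'j phase. (fst x + r, fst (snd x))) \<in> borel \<Otimes>\<^sub>M (?M \<Otimes>\<^sub>M borel) \<rightarrow>\<^sub>M borel \<Otimes>\<^sub>M ?M"
      by measurable
    from measurable_compose[OF this measurable_ou_joint]
    have "(\<lambda>x :: real \<times> ('j \<Rightarrow> real \<Rightarrow> real) \<times> 'j phase. ou \<epsilon> (shift (fst x + r) (fst (snd x)))) \<in> borel_measurable (borel \<Otimes>\<^sub>M (?M \<Otimes>\<^sub>M borel))"
      by simp
    then have "(\<lambda>x :: real \<times> ('j \<Rightarrow> real \<Rightarrow> real) \<times> 'j phase. (ou \<epsilon> (shift (fst x + r) (fst (snd x))), snd (snd x))) \<in> borel_measurable (borel \<Otimes>\<^sub>M (?M \<Otimes>\<^sub>M borel))"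
      by (intro borel_measurable_Pair) auto
    from measurable_compose[OF this borel_measurable_continuous_onI[OF RF_cont]]
    show "(\<lambda>(t, \<omega>, y). field (t + r) \<omega> y) \<in> borel_measurable (borel \<Otimes>\<^sub>M (?M \<Otimes>\<^sub>M borel))"
      by (simp add: RF_def case_prod_beta)
  next
    fix \<omega> assume "\<omega> \<in> space ?M"
    then have \<omega>: "\<omega> \<in> \<Omega>" by (simp add: space_noise)
    have "continuous_on UNIV (\<lambda>x :: real \<times> 'j phase. (ou \<epsilon> (shift (fst x + r) \<omega>), snd x))"
      by (intro continuous_intros continuous_on_compose2[OF continuous_ou[OF \<omega>, of UNIV]]) auto
    from continuous_on_compose2[OF RF_cont this]
    show "continuous_on UNIV (\<lambda>(t, y). field (t + r) \<omega> y)"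
      by (simp add: RF_def case_prod_beta)
  next
    fix \<omega> y and t :: real assume "\<omega> \<in> space ?M"
    then have \<omega>: "\<omega> \<in> \<Omega>" by (simp add: space_noise)
    show "Y 0 (shift r \<omega>) y = y" by (rule Y_0[OF shift_in[OF \<omega>]])
    show "((\<lambda>t. Y t (shift r \<omega>) y) has_vector_derivative field (t + r) \<omega> (Y t (shift r \<omega>) y)) (at t within {0..})"
      if "0 \<le> t"
      using Y_deriv[OF shift_in[OF \<omega>] that] by (simp add: shift_shift)
  qed
qed

lemma cylinder_flow_mod: "cylinder_flow \<alpha> \<kappa> Y t \<omega> (\<pi> y) = \<pi> (Y t \<omega> y)" if "\<omega> \<in> \<Omega>" "0 \<le> t"
  unfolding cylinder_flow_def
proof (rule the_equality)
  fix Z assume "\<exists>y'. \<pi> y = \<pi> y' \<and> Z = \<pi> (Y t \<omega> y')"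
  then obtain y' where y': "\<pi> y = \<pi> y'" "Z = \<pi> (Y t \<omega> y')" by blast
  then obtain k :: int where "y' = y + of_int k *\<^sub>R \<kappa> *\<^sub>R eta0" using quot.p_eq_iff by blast
  then have "Y t \<omega> y' = Y t \<omega> y + of_int k *\<^sub>R \<kappa> *\<^sub>R eta0" using Y_translate[OF that] by simp
  then have "\<pi> (Y t \<omega> y) = \<pi> (Y t \<omega> y')" using quot.p_eq_iff by blast
  then show "Z = \<pi> (Y t \<omega> y)" using y' by simp
qed blast

theorem rds_cylinder_flow:
  "rds (noise_space P \<Omega>) shift (cylinder \<alpha> \<kappa>) (cylinder_dist \<nu>) (cylinder_flow \<alpha> \<kappa> Y)"
  unfolding rds_def cylinder_range
proof (intro conjI ballI allI impI)
  let ?M = "noise_space P \<Omega>" and ?X = "metric_borel (range \<pi>) (cylinder_dist \<nu>)"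
  let ?N = "restrict_space borel {0::real..} \<Otimes>\<^sub>M (?M \<Otimes>\<^sub>M ?X)"
  have "(\<lambda>x. (fst x, fst (snd x), quot.sec (snd (snd x)))) \<in> ?N \<rightarrow>\<^sub>M restrict_space borel {0..} \<Otimes>\<^sub>M (?M \<Otimes>\<^sub>M borel)"
    by (intro measurable_Pair measurable_compose[OF _ quot.measurable_sec]
        measurable_compose[OF measurable_snd measurable_fst] measurable_compose[OF measurable_snd measurable_snd] measurable_fst)
  from measurable_compose[OF measurable_compose[OF this measurable_Y[of 0]] quot.measurable_p]
  have "(\<lambda>x. \<pi> (Y (fst x) (shift 0 (fst (snd x))) (quot.sec (snd (snd x))))) \<in> ?N \<rightarrow>\<^sub>M ?X"
    by (simp add: case_prod_beta)
  also have "?this \<longleftrightarrow> (\<lambda>(t, \<omega>, x). cylinder_flow \<alpha> \<kappa> Y t \<omega> x) \<in> ?N \<rightarrow>\<^sub>M ?X"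
  proof (rule measurable_cong)
    fix x assume "x \<in> space ?N"
    then obtain t \<omega> y where x: "x = (t, \<omega>, \<pi> y)" "0 \<le> t" "\<omega> \<in> \<Omega>"
      by (auto simp: space_pair_measure space_restrict_space space_noise quot.space_metric_borel)
    have "cylinder_flow \<alpha> \<kappa> Y t \<omega> (\<pi> y) = cylinder_flow \<alpha> \<kappa> Y t \<omega> (\<pi> (quot.sec (\<pi> y)))"
      by (simp add: quot.sec)
    then show "\<pi> (Y (fst x) (shift 0 (fst (snd x))) (quot.sec (snd (snd x)))) = (case x of (t, \<omega>, x) \<Rightarrow> cylinder_flow \<alpha> \<kappa> Y t \<omega> x)"
      using x by (simp add: cylinder_flow_mod shift_0)
  qed
  finally show "(\<lambda>(t, \<omega>, x). cylinder_flow \<alpha> \<kappa> Y t \<omega> x) \<in> ?N \<rightarrow>\<^sub>M ?X" .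
next
  fix \<omega> and s t :: real and X assume "\<omega> \<in> space (noise_space P \<Omega>)" and s: "0 \<le> s" and t: "0 \<le> t" and "X \<in> range \<pi>"
  then obtain y where \<omega>: "\<omega> \<in> \<Omega>" and X: "X = \<pi> y" by (auto simp: space_noise)
  show "cylinder_flow \<alpha> \<kappa> Y (t + s) \<omega> X = cylinder_flow \<alpha> \<kappa> Y t (shift s \<omega>) (cylinder_flow \<alpha> \<kappa> Y s \<omega> X)"
    using \<omega> s t by (simp add: X cylinder_flow_mod shift_in Y_cocycle)
next
  fix \<omega> t assume "\<omega> \<in> space (noise_space P \<Omega>)" and t: "(0::real) \<le> t"
  then have \<omega>: "\<omega> \<in> \<Omega>" by (simp add: space_noise)
  show "continuous_map quot.mtopology quot.mtopology (cylinder_flow \<alpha> \<kappa> Y t \<omega>)"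
    by (rule quot.continuous_map_descend[OF Y_continuous[OF \<omega> t] cylinder_flow_mod[OF \<omega> t]])
qed (auto simp: quot.Metric_space_axioms quot.mcomplete quot.separable space_noise cylinder_flow_mod Y_0)

text \<open>
  The weighted supremum of \<open>1 + |z|\<^sup>2\<close> over the past, which serves as random radius.  It is taken over
  rational times to be measurable; by continuity it bounds the values at all times \<open>s \<le> 0\<close>.
\<close>

definition noise_sup :: "real \<Rightarrow> ('j \<Rightarrow> real \<Rightarrow> real) \<Rightarrow> real" where
  "noise_sup \<gamma> \<omega> = (SUP s\<in>{..0} \<inter> \<rat>. exp (\<gamma> * s) * (1 + (norm (ou \<epsilon> (shift s \<omega>)))\<^sup>2))"

lemma noise_sup_bdd:
  assumes \<omega>: "\<omega> \<in> \<Omega>" and \<gamma>: "0 < \<gamma>"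
  shows "bdd_above ((\<lambda>s. exp (\<gamma> * s) * (1 + (norm (ou \<epsilon> (shift s \<omega>)))\<^sup>2)) ` ({..0} \<inter> \<rat>))"
proof -
  obtain C where C: "0 \<le> C" "\<And>t. norm (ou \<epsilon> (shift t \<omega>)) \<le> C * exp (\<gamma> / 2 * \<bar>t\<bar>)"
    using ou_subexponential[OF \<omega>, of "\<gamma> / 2"] \<gamma> by auto
  show ?thesis
  proof (rule bdd_aboveI2)
    fix s :: real assume "s \<in> {..0} \<inter> \<rat>"
    then have s: "s \<le> 0" by simp
    have "(norm (ou \<epsilon> (shift s \<omega>)))\<^sup>2 \<le> (C * exp (\<gamma> / 2 * \<bar>s\<bar>))\<^sup>2"
      using C(2)[of s] by (rule power_mono) simp
    also have "\<dots> = C\<^sup>2 * exp (- \<gamma> * s)"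
      using s by (simp add: power_mult_distrib exp_double[symmetric])
    finally have "exp (\<gamma> * s) * (1 + (norm (ou \<epsilon> (shift s \<omega>)))\<^sup>2) \<le> exp (\<gamma> * s) * (1 + C\<^sup>2 * exp (- \<gamma> * s))"
      by simp
    also have "\<dots> = exp (\<gamma> * s) + C\<^sup>2" by (simp add: algebra_simps exp_minus)
    also have "\<dots> \<le> 1 + C\<^sup>2" using s \<gamma> by (simp add: mult_nonneg_nonpos)
    finally show "exp (\<gamma> * s) * (1 + (norm (ou \<epsilon> (shift s \<omega>)))\<^sup>2) \<le> 1 + C\<^sup>2" .
  qed
qed

lemma noise_sup_upper:
  assumes \<omega>: "\<omega> \<in> \<Omega>" and \<gamma>: "0 < \<gamma>" and s: "s \<le> 0"
  shows "exp (\<gamma> * s) * (1 + (norm (ou \<epsilon> (shift s \<omega>)))\<^sup>2) \<le> noise_sup \<gamma> \<omega>"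
proof (rule LIMSEQ_le_const2)
  let ?h = "\<lambda>s. exp (\<gamma> * s) * (1 + (norm (ou \<epsilon> (shift s \<omega>)))\<^sup>2)"
  let ?r = "\<lambda>n. real_of_int \<lfloor>real (Suc n) * s\<rfloor> / real (Suc n)"
  have "continuous_on UNIV ?h"
    by (intro continuous_intros continuous_ou[OF \<omega>])
  then have "isCont ?h s" by (simp add: continuous_on_eq_continuous_at)
  then show "(\<lambda>n. ?h (?r n)) \<longlonglongrightarrow> ?h s"
    by (rule isCont_tendsto_compose[OF _ floor_approximation])
  have "?h (?r n) \<le> noise_sup \<gamma> \<omega>" for n
  proof -
    have "real (Suc n) * s \<le> 0" using s by (intro mult_nonneg_nonpos) auto
    then have "?r n \<le> 0" by (simp add: divide_le_0_iff)
    then have "?r n \<in> {..0} \<inter> \<rat>" by auto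
    then show ?thesis
      unfolding noise_sup_def by (rule cSUP_upper[OF _ noise_sup_bdd[OF \<omega> \<gamma>]])
  qed
  then show "\<exists>N. \<forall>n\<ge>N. ?h (?r n) \<le> noise_sup \<gamma> \<omega>" by blast
qed

lemma noise_sup_ge_1:
  assumes "\<omega> \<in> \<Omega>" "0 < \<gamma>"
  shows "1 \<le> noise_sup \<gamma> \<omega>"
proof -
  have "1 + (norm (ou \<epsilon> (shift 0 \<omega>)))\<^sup>2 \<le> noise_sup \<gamma> \<omega>"
    using noise_sup_upper[OF assms order_refl] by simp
  then show ?thesis using zero_le_power2[of "norm (ou \<epsilon> (shift 0 \<omega>))"] by linarith
qed

text \<open>
  Along an orbit the radius decreases at rate at most \<open>\<gamma>\<close>.
\<close>

lemma noise_sup_shift: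
  assumes \<omega>: "\<omega> \<in> \<Omega>" and \<gamma>: "0 < \<gamma>" and t: "0 \<le> t"
  shows "noise_sup \<gamma> \<omega> \<le> exp (\<gamma> * t) * noise_sup \<gamma> (shift t \<omega>)"
  unfolding noise_sup_def[of \<gamma> \<omega>]
proof (rule cSUP_least)
  show "{..0} \<inter> \<rat> \<noteq> ({} :: real set)" using Rats_0 by blast
  fix s :: real assume "s \<in> {..0} \<inter> \<rat>"
  then have "s - t \<le> 0" using t by simp
  from noise_sup_upper[OF shift_in[OF \<omega>, of t] \<gamma> this]
  have "exp (\<gamma> * (s - t)) * (1 + (norm (ou \<epsilon> (shift s \<omega>)))\<^sup>2) \<le> noise_sup \<gamma> (shift t \<omega>)"
    by (simp add: shift_shift)
  then have "exp (\<gamma> * t) * (exp (\<gamma> * (s - t)) * (1 + (norm (ou \<epsilon> (shift s \<omega>)))\<^sup>2))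
      \<le> exp (\<gamma> * t) * noise_sup \<gamma> (shift t \<omega>)"
    by (rule mult_left_mono) simp
  moreover have "exp (\<gamma> * t) * exp (\<gamma> * (s - t)) = exp (\<gamma> * s)"
    by (simp add: exp_add[symmetric] algebra_simps)
  ultimately show "exp (\<gamma> * s) * (1 + (norm (ou \<epsilon> (shift s \<omega>)))\<^sup>2) \<le> exp (\<gamma> * t) * noise_sup \<gamma> (shift t \<omega>)"
    by (simp add: mult.assoc[symmetric])
qed

lemma measurable_noise_sup:
  assumes \<gamma>: "0 < \<gamma>"
  shows "(\<lambda>\<omega>. noise_sup \<gamma> (shift r \<omega>)) \<in> borel_measurable (noise_space P \<Omega>)"
  unfolding noise_sup_def shift_shift
proof (rule borel_measurable_cSUP)
  show "countable ({..0} \<inter> \<rat> :: real set)" by (intro countable_Int2 countable_rat)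
  show "(\<lambda>\<omega>. exp (\<gamma> * s) * (1 + (norm (ou \<epsilon> (shift (s + r) \<omega>)))\<^sup>2)) \<in> borel_measurable (noise_space P \<Omega>)" for s
    using measurable_ou[of "s + r"] by measurable
  fix \<omega> assume "\<omega> \<in> space (noise_space P \<Omega>)"
  then have "\<omega> \<in> \<Omega>" by (simp add: space_noise)
  from noise_sup_bdd[OF shift_in[OF this, of r] \<gamma>]
  show "bdd_above ((\<lambda>s. exp (\<gamma> * s) * (1 + (norm (ou \<epsilon> (shift (s + r) \<omega>)))\<^sup>2)) ` ({..0} \<inter> \<rat>))"
    by (simp add: shift_shift)
qed

text \<open>
  The energy \<open>q y y\<close> of a solution satisfies \<open>E' \<le> - \<delta> E + b \<delta> / 2 * (1 + |z|\<^sup>2)\<close>.  Up to a final time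
  \<open>T\<close>, the noise term is at most \<open>R exp (\<delta> / 2 * (T - t))\<close> with \<open>R\<close> the radius at time \<open>T\<close>, and a multiple
  of this exponential is a supersolution, since it decays only at rate \<open>\<delta> / 2\<close>.
\<close>

lemma energy_decay:
  obtains \<delta> b c and q :: "'j phase \<Rightarrow> 'j phase \<Rightarrow> real"
  where "0 < \<delta>" "0 \<le> b" "bounded_bilinear q" "\<And>x y. q x y = q y x" "\<And>y. 0 \<le> q y y"
    "\<And>y. q eta0 y = 0" "c > 0" "\<And>y. y \<in> E2 \<alpha> \<Longrightarrow> c * (norm y)\<^sup>2 \<le> q y y"
    "\<And>\<omega> y t. \<omega> \<in> \<Omega> \<Longrightarrow> 0 \<le> t \<Longrightarrow>
      exp (\<delta> * t) * q (Y t \<omega> y) (Y t \<omega> y)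
        \<le> b * noise_sup (\<delta> / 2) (shift t \<omega>) * (exp (\<delta> * t) - exp (\<delta> / 2 * t)) + q y y"
proof -
  obtain \<delta> c and q :: "'j phase \<Rightarrow> 'j phase \<Rightarrow> real"
    where \<delta>: "\<delta> > 0" and q: "bounded_bilinear q" and q_sym: "\<And>x y. q x y = q y x" and q_nonneg: "\<And>y. 0 \<le> q y y"
    and q_diss: "\<And>u v. q (u, v) (v, - (K *\<^sub>R (A *v u)) - \<alpha> *\<^sub>R v) \<le> - \<delta> * q (u, v) (u, v)"
    and q_eta: "\<And>y. q eta0 y = 0" and c: "c > 0" and q_coercive: "\<And>y. y \<in> E2 \<alpha> \<Longrightarrow> c * (norm y)\<^sup>2 \<le> q y y"
    using dissipative_form[OF A_sym A_psd A_ones A_kernel K_pos \<alpha>_pos] by metis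
  obtain Bq where Bq: "Bq > 0" "\<And>x y. norm (q x y) \<le> norm x * norm y * Bq"
    using bounded_bilinear.pos_bounded[OF q] by blast
  define H where "H = norm f + \<bar>\<beta>\<bar> * (real CARD('j) * c1) + 1 + \<bar>1 - \<alpha>\<bar>"
  have c1: "0 \<le> c1" using g_bounded[of 0] by linarith
  have H: "0 \<le> H" using c1 by (simp add: H_def)
  define h where "h z u = (z, f - \<beta> *\<^sub>R (\<chi> j. g (u $ j)) + (1 - \<alpha>) *\<^sub>R z)" for z u :: "real^'j"
  have h_bound: "norm (h z u) \<le> H * (1 + norm z)" for z u
  proof -
    have "norm (\<chi> j. g (u $ j)) \<le> (\<Sum>j\<in>UNIV. \<bar>(\<chi> j. g (u $ j)) $ j\<bar>)" by (rule norm_le_l1_cart)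
    also have "\<dots> \<le> (\<Sum>j\<in>(UNIV :: 'j set). c1)" by (intro sum_mono) (simp add: g_bounded)
    finally have g: "norm (\<chi> j. g (u $ j)) \<le> real CARD('j) * c1" by simp
    have "norm (h z u) \<le> norm z + norm (f - \<beta> *\<^sub>R (\<chi> j. g (u $ j)) + (1 - \<alpha>) *\<^sub>R z)"
      unfolding h_def by (rule norm_Pair_le)
    also have "norm (f - \<beta> *\<^sub>R (\<chi> j. g (u $ j)) + (1 - \<alpha>) *\<^sub>R z)
        \<le> norm f + norm (\<beta> *\<^sub>R (\<chi> j. g (u $ j))) + norm ((1 - \<alpha>) *\<^sub>R z)"
      by (meson norm_triangle_ineq norm_triangle_ineq4 norm_triangle_le add_right_mono order_trans)
    also have "\<dots> \<le> norm f + \<bar>\<beta>\<bar> * (real CARD('j) * c1) + \<bar>1 - \<alpha>\<bar> * norm z"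
      using g by (simp add: mult_left_mono)
    finally have "norm (h z u) \<le> (norm f + \<bar>\<beta>\<bar> * (real CARD('j) * c1)) + (1 + \<bar>1 - \<alpha>\<bar>) * norm z"
      by (simp add: algebra_simps)
    also have "\<dots> \<le> H * 1 + H * norm z"
      using c1 by (intro add_mono mult_right_mono) (simp_all add: H_def)
    finally show ?thesis by (simp add: algebra_simps)
  qed
  define b where "b = 2 * Bq * H\<^sup>2 / \<delta>"
  have b: "0 \<le> b" using Bq \<delta> by (simp add: b_def)
  have q_h: "q (h z u) (h z u) / \<delta> \<le> b * (1 + (norm z)\<^sup>2)" for z u
  proof -
    have "q (h z u) (h z u) \<le> Bq * (norm (h z u))\<^sup>2"
      using Bq(2)[of "h z u" "h z u"] by (simp add: power2_eq_square mult.commute)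
    also have "(norm (h z u))\<^sup>2 \<le> (H * (1 + norm z))\<^sup>2" by (intro power_mono h_bound) simp
    also have "\<dots> = H\<^sup>2 * (1 + norm z)\<^sup>2" by (rule power_mult_distrib)
    also have "(1 + norm z)\<^sup>2 \<le> 2 * (1 + (norm z)\<^sup>2)"
      using zero_le_power2[of "1 - norm z"] by (simp add: power2_eq_square algebra_simps)
    finally have "q (h z u) (h z u) \<le> Bq * (H\<^sup>2 * (2 * (1 + (norm z)\<^sup>2)))"
      using Bq(1) by (simp add: mult_left_mono)
    then have "q (h z u) (h z u) / \<delta> \<le> Bq * (H\<^sup>2 * (2 * (1 + (norm z)\<^sup>2))) / \<delta>"
      using \<delta> by (intro divide_right_mono) auto
    also have "\<dots> = b * (1 + (norm z)\<^sup>2)" by (simp add: b_def)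
    finally show ?thesis .
  qed
  have energy: "2 * q y (random_field A K \<alpha> \<beta> f g z y) \<le> - \<delta> * q y y + b * (1 + (norm z)\<^sup>2)" for y z
  proof -
    obtain u v where y: "y = (u, v)" by (cases y)
    have "0 \<le> q (\<delta> *\<^sub>R y - h z u) (\<delta> *\<^sub>R y - h z u)" by (rule q_nonneg)
    also have "\<dots> = \<delta> * (\<delta> * q y y - 2 * q y (h z u)) + q (h z u) (h z u)"
      by (simp add: bounded_bilinear.diff_left[OF q] bounded_bilinear.diff_right[OF q]
          bounded_bilinear.scaleR_left[OF q] bounded_bilinear.scaleR_right[OF q] q_sym[of "h z u" y] algebra_simps)
    finally have "2 * q y (h z u) - \<delta> * q y y \<le> q (h z u) (h z u) / \<delta>"
      using \<delta> by (simp add: field_simps)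
    also note q_h
    finally have 1: "2 * q y (h z u) \<le> \<delta> * q y y + b * (1 + (norm z)\<^sup>2)" by simp
    have "q y (random_field A K \<alpha> \<beta> f g z y) = q y (v, - (K *\<^sub>R (A *v u)) - \<alpha> *\<^sub>R v) + q y (h z u)"
      unfolding y random_field_split h_def by (rule bounded_bilinear.add_right[OF q])
    then show ?thesis using q_diss[of u v] 1 unfolding y by simp
  qed
  have decay: "exp (\<delta> * T) * q (Y T \<omega> y) (Y T \<omega> y)
        \<le> 2 * b / \<delta> * noise_sup (\<delta> / 2) (shift T \<omega>) * (exp (\<delta> * T) - exp (\<delta> / 2 * T)) + q y y"
    if \<omega>: "\<omega> \<in> \<Omega>" and T: "0 \<le> T" for \<omega> y T
  proof -
    define R where "R = noise_sup (\<delta> / 2) (shift T \<omega>)"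
    define z where "z t = ou \<epsilon> (shift t \<omega>)" for t
    define w where "w t = Y t \<omega> y" for t
    have noise: "1 + (norm (z t))\<^sup>2 \<le> R * exp (\<delta> / 2 * T) * exp (- (\<delta> / 2 * t))" if "t \<le> T" for t
    proof -
      have "exp (\<delta> / 2 * (t - T)) * (1 + (norm (z t))\<^sup>2) \<le> R"
        using noise_sup_upper[OF shift_in[OF \<omega>, of T], of "\<delta> / 2" "t - T"] \<delta> that
        by (simp add: shift_shift R_def z_def)
      then have "exp (\<delta> / 2 * (T - t)) * (exp (\<delta> / 2 * (t - T)) * (1 + (norm (z t))\<^sup>2)) \<le> exp (\<delta> / 2 * (T - t)) * R"
        by (rule mult_left_mono) simp
      also have "\<dots> = R * exp (\<delta> / 2 * T) * exp (- (\<delta> / 2 * t))"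
      proof -
        have "exp (\<delta> / 2 * (T - t)) = exp (\<delta> / 2 * T) * exp (- (\<delta> / 2 * t))"
          unfolding exp_add[symmetric] by (simp add: right_diff_distrib)
        then show ?thesis by (simp only: mult_ac)
      qed
      finally have "exp (\<delta> / 2 * (T - t)) * (exp (\<delta> / 2 * (t - T)) * (1 + (norm (z t))\<^sup>2))
          \<le> R * exp (\<delta> / 2 * T) * exp (- (\<delta> / 2 * t))" .
      moreover have "exp (\<delta> / 2 * (T - t)) * exp (\<delta> / 2 * (t - T)) = 1"
        unfolding exp_add[symmetric] distrib_left[symmetric] by simp
      ultimately show ?thesis by (simp only: mult.assoc[symmetric] mult_1_left)
    qed
    define \<rho> where "\<rho> = R * exp (\<delta> / 2 * T)"
    define G where "G t = exp (\<delta> * t) * q (w t) (w t) - 2 * b / \<delta> * \<rho> * exp (\<delta> / 2 * t)" for t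
    have "G T \<le> G 0"
    proof (rule nonincreasing_from_0[OF _ _ T])
      fix t :: real assume t: "0 \<le> t"
      have "((\<lambda>t. q (w t) (w t)) has_vector_derivative (q (w t) (field t \<omega> (w t)) + q (field t \<omega> (w t)) (w t)))
          (at t within {0..})"
        unfolding w_def by (rule bounded_bilinear.has_vector_derivative[OF q Y_deriv[OF \<omega> t] Y_deriv[OF \<omega> t]])
      then have "((\<lambda>t. q (w t) (w t)) has_real_derivative 2 * q (w t) (field t \<omega> (w t))) (at t within {0..})"
        by (simp add: has_real_derivative_iff_has_vector_derivative q_sym[of "field t \<omega> (w t)" "w t"])
      then show "(G has_real_derivative exp (\<delta> * t) * (\<delta> * q (w t) (w t) + 2 * q (w t) (field t \<omega> (w t)))
          - b * \<rho> * exp (\<delta> / 2 * t)) (at t within {0..})"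
        unfolding G_def using \<delta> by (auto intro!: derivative_eq_intros simp: algebra_simps)
    next
      fix t :: real assume t: "0 \<le> t" "t \<le> T"
      have "\<delta> * q (w t) (w t) + 2 * q (w t) (field t \<omega> (w t)) \<le> b * (1 + (norm (z t))\<^sup>2)"
        using energy[of "w t" "z t"] by (simp add: z_def)
      also have "\<dots> \<le> b * (\<rho> * exp (- (\<delta> / 2 * t)))"
        unfolding \<rho>_def by (intro mult_left_mono noise t b)
      finally have "exp (\<delta> * t) * (\<delta> * q (w t) (w t) + 2 * q (w t) (field t \<omega> (w t)))
          \<le> exp (\<delta> * t) * (b * (\<rho> * exp (- (\<delta> / 2 * t))))"
        by (rule mult_left_mono) simp
      also have "\<dots> = b * \<rho> * (exp (\<delta> * t) * exp (- (\<delta> / 2 * t)))" by simp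
      also have "exp (\<delta> * t) * exp (- (\<delta> / 2 * t)) = exp (\<delta> / 2 * t)"
        by (simp add: exp_add[symmetric])
      finally show "exp (\<delta> * t) * (\<delta> * q (w t) (w t) + 2 * q (w t) (field t \<omega> (w t))) - b * \<rho> * exp (\<delta> / 2 * t) \<le> 0"
        by simp
    qed
    then have "exp (\<delta> * T) * q (w T) (w T) - 2 * b / \<delta> * (\<rho> * exp (\<delta> / 2 * T)) \<le> q y y - 2 * b / \<delta> * \<rho>"
      by (simp add: G_def w_def Y_0[OF \<omega>] mult.assoc)
    moreover have "\<rho> * exp (\<delta> / 2 * T) = R * exp (\<delta> * T)"
      unfolding \<rho>_def mult.assoc exp_add[symmetric] by simp
    ultimately have "exp (\<delta> * T) * q (w T) (w T) \<le> 2 * b / \<delta> * (R * exp (\<delta> * T) - \<rho>) + q y y"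
      by (simp add: right_diff_distrib)
    also have "R * exp (\<delta> * T) - \<rho> = R * (exp (\<delta> * T) - exp (\<delta> / 2 * T))"
      unfolding \<rho>_def by (simp only: right_diff_distrib)
    finally show ?thesis unfolding w_def R_def mult.assoc .
  qed
  show ?thesis
    by (rule that[OF \<delta> _ q q_sym q_nonneg q_eta c q_coercive decay]) (use b \<delta> in auto)
qed

text \<open>
  The absorbing set consists of the points of energy at most \<open>(b + 1) R\<close>, with \<open>R\<close> the random radius.
  The energy is constant on cosets and controls the component in \<^const>\<open>E2\<close>; the remaining
  coordinate lives on a circle, so that these sets are compact in the cylinder.
\<close>

theorem attractor_exists:
  "\<exists>A0. global_random_attractor (noise_space P \<Omega>) shift (cylinder \<alpha> \<kappa>) (cylinder_dist \<nu>) (cylinder_flow \<alpha> \<kappa> Y) A0"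
proof -
  let ?M = "noise_space P \<Omega>" and ?flow = "cylinder_flow \<alpha> \<kappa> Y"
  obtain \<delta> b c and q :: "'j phase \<Rightarrow> 'j phase \<Rightarrow> real"
    where \<delta>: "0 < \<delta>" and b: "0 \<le> b" and q: "bounded_bilinear q" and q_sym: "\<And>x y. q x y = q y x"
    and q_nonneg: "\<And>y. 0 \<le> q y y" and q_eta: "\<And>y. q eta0 y = 0"
    and c: "c > 0" and q_coercive: "\<And>y. y \<in> E2 \<alpha> \<Longrightarrow> c * (norm y)\<^sup>2 \<le> q y y"
    and decay: "\<And>\<omega> y t. \<omega> \<in> \<Omega> \<Longrightarrow> 0 \<le> t \<Longrightarrow> exp (\<delta> * t) * q (Y t \<omega> y) (Y t \<omega> y)
        \<le> b * noise_sup (\<delta> / 2) (shift t \<omega>) * (exp (\<delta> * t) - exp (\<delta> / 2 * t)) + q y y"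
    by (rule energy_decay) (assumption | blast)+
  define Q where "Q y = q y y" for y
  define R where "R \<omega> = (b + 1) * noise_sup (\<delta> / 2) \<omega>" for \<omega>
  define B where "B \<omega> = \<pi> ` {y. Q y \<le> R \<omega>}" for \<omega>
  have noise_1: "1 \<le> noise_sup (\<delta> / 2) \<omega>" if "\<omega> \<in> \<Omega>" for \<omega>
    using noise_sup_ge_1[OF that] \<delta> by simp
  have R_pos: "0 < R \<omega>" if "\<omega> \<in> \<Omega>" for \<omega>
    using noise_1[OF that] b by (simp add: R_def)
  have Q_add_eta: "Q (y + r *\<^sub>R eta0) = Q y" for y r
  proof -
    have "q y eta0 = 0" for y using q_sym[of y eta0] by (simp add: q_eta)
    then show ?thesis
      by (simp add: Q_def q_eta bounded_bilinear.add_left[OF q] bounded_bilinear.add_right[OF q]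
          bounded_bilinear.scaleR_left[OF q] bounded_bilinear.scaleR_right[OF q])
  qed
  have Q_mod: "Q y = Q y'" if eq: "\<pi> y = \<pi> y'" for y y'
  proof -
    obtain k :: int where "y' = y + of_int k *\<^sub>R \<kappa> *\<^sub>R eta0" using eq unfolding quot.p_eq_iff by blast
    then have "y' = y + (of_int k * \<kappa>) *\<^sub>R eta0" by simp
    then show ?thesis by (simp only: Q_add_eta)
  qed
  have Q_scale: "Q (r *\<^sub>R y) = r\<^sup>2 * Q y" for r y
    by (simp add: Q_def bounded_bilinear.scaleR_left[OF q] bounded_bilinear.scaleR_right[OF q] power2_eq_square)
  have Q_cont: "continuous_on UNIV Q"
    unfolding Q_def by (intro bounded_bilinear.continuous_on[OF q] continuous_intros)
  obtain Bq where Bq: "Bq > 0" "\<And>x y. norm (q x y) \<le> norm x * norm y * Bq"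
    using bounded_bilinear.pos_bounded[OF q] by blast
  have Q_upper: "Q y \<le> Bq * (norm y)\<^sup>2" for y
    using Bq(2)[of y y] by (simp add: Q_def power2_eq_square mult.commute)
  have Q_decay: "Q (Y t \<omega> y) \<le> R (shift t \<omega>)"
    if \<omega>: "\<omega> \<in> \<Omega>" and t: "0 \<le> t"
      and y: "Q y \<le> (b * exp (\<delta> / 2 * t) + exp (\<delta> * t)) * noise_sup (\<delta> / 2) (shift t \<omega>)" for t \<omega> y
  proof -
    have "exp (\<delta> * t) * Q (Y t \<omega> y) \<le> exp (\<delta> * t) * R (shift t \<omega>)"
      using decay[OF \<omega> t, of y] y by (simp add: Q_def R_def algebra_simps)
    then show ?thesis by simp
  qed
  show ?thesis
  proof (rule absorbing_compact_imp_attractor[OF rds_cylinder_flow, where B = B])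
    show "shift t \<omega> \<in> space ?M" if "\<omega> \<in> space ?M" for \<omega> t
      using that by (simp add: space_noise shift_in)
    show "shift s (shift t \<omega>) = shift (s + t) \<omega>" for s t \<omega> by (rule shift_shift)
    show "shift 0 \<omega> = \<omega>" if "\<omega> \<in> space ?M" for \<omega>
      using that by (simp add: space_noise shift_0)
  next
    fix \<omega> assume "\<omega> \<in> space ?M"
    then have \<omega>: "\<omega> \<in> \<Omega>" by (simp add: space_noise)
    \<comment> \<open>a compact set of representatives\<close>
    define S where "S = {y. Q y \<le> R \<omega> \<and> 0 \<le> coord \<alpha> y / \<kappa> \<and> coord \<alpha> y / \<kappa> \<le> 1}"
    have coord_cont: "continuous_on UNIV (coord \<alpha> :: 'j phase \<Rightarrow> real)"
      by (rule linear_continuous_on) (simp add: linear_coord linear_conv_bounded_linear[symmetric])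
    have "closed S"
      unfolding S_def using \<kappa>_pos
      by (intro closed_Collect_conj closed_Collect_le continuous_intros Q_cont coord_cont) auto
    moreover have "bounded S"
      unfolding bounded_iff
    proof (intro exI ballI)
      fix y assume y: "y \<in> S"
      define w where "w = y - coord \<alpha> y *\<^sub>R eta0"
      have "w \<in> E2 \<alpha>"
        using \<alpha>_pos by (simp add: w_def E2_iff_coord linear_diff[OF linear_coord] linear_cmul[OF linear_coord] coord_eta0)
      then have "c * (norm w)\<^sup>2 \<le> Q w" using q_coercive by (simp add: Q_def)
      also have "Q w = Q y" using Q_add_eta[of y "- coord \<alpha> y"] by (simp add: w_def)
      also have "\<dots> \<le> R \<omega>" using y by (simp add: S_def)
      finally have "(norm w)\<^sup>2 \<le> R \<omega> / c" using c by (simp add: field_simps)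
      then have "norm w \<le> sqrt (R \<omega> / c)" by (rule real_le_rsqrt)
      moreover have "\<bar>coord \<alpha> y\<bar> \<le> \<kappa>" using y \<kappa>_pos by (simp add: S_def field_simps)
      then have "norm (coord \<alpha> y *\<^sub>R eta0 :: 'j phase) \<le> \<kappa> * norm (eta0 :: 'j phase)"
        by (simp add: mult_right_mono)
      moreover have "y = w + coord \<alpha> y *\<^sub>R eta0" by (simp add: w_def)
      ultimately show "norm y \<le> sqrt (R \<omega> / c) + \<kappa> * norm (eta0 :: 'j phase)"
        by (metis add_mono norm_triangle_le)
    qed
    ultimately have "compactin quot.mtopology (\<pi> ` S)"
      by (intro quot.compactin_image_p) (simp add: compact_eq_bounded_closed)
    moreover have "\<pi> ` S = B \<omega>"
    proof (intro antisym subsetI)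
      fix X assume "X \<in> B \<omega>"
      then obtain y where y: "X = \<pi> y" "Q y \<le> R \<omega>" by (auto simp: B_def)
      have "Q (quot.sec (\<pi> y)) = Q y" by (rule Q_mod) (rule quot.sec)
      then have "quot.sec (\<pi> y) \<in> S" using y quot.sec(2,3)[of y] by (simp add: S_def)
      then have "\<pi> (quot.sec (\<pi> y)) \<in> \<pi> ` S" by (rule imageI)
      then show "X \<in> \<pi> ` S" unfolding quot.sec(1) y(1) .
    qed (auto simp: S_def B_def)
    ultimately show "compactin (Metric_space.mtopology (cylinder \<alpha> \<kappa>) (cylinder_dist \<nu>)) (B \<omega>)"
      by (simp add: cylinder_range)
  next
    fix \<omega> and t :: real assume "\<omega> \<in> space ?M" and t: "0 \<le> t"
    then have \<omega>: "\<omega> \<in> \<Omega>" by (simp add: space_noise)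
    have "Q (Y t \<omega> y) \<le> R (shift t \<omega>)" if y: "Q y \<le> R \<omega>" for y
    proof (rule Q_decay[OF \<omega> t])
      let ?e = "exp (\<delta> / 2 * t)" and ?n = "noise_sup (\<delta> / 2) (shift t \<omega>)"
      have "Q y \<le> (b + 1) * (?e * ?n)"
        using y noise_sup_shift[OF \<omega> _ t, of "\<delta> / 2"] \<delta> b
        by (auto simp: R_def intro: order_trans mult_left_mono)
      also have "\<dots> = (b * ?e + ?e) * ?n" by (simp add: algebra_simps)
      also have "\<dots> \<le> (b * ?e + exp (\<delta> * t)) * ?n"
        using noise_1[OF shift_in[OF \<omega>], of t] \<delta> t by (intro mult_right_mono add_left_mono) auto
      finally show "Q y \<le> (b * ?e + exp (\<delta> * t)) * ?n" .
    qed
    then show "?flow t \<omega> ` B \<omega> \<subseteq> B (shift t \<omega>)"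
      using \<omega> t by (auto simp: B_def cylinder_flow_mod)
  next
    fix X :: "'j phase set \<times> 'j phase" and n :: nat assume "X \<in> cylinder \<alpha> \<kappa>"
    then have X: "X \<in> range \<pi>" by (simp add: cylinder_range)
    define r where "r = - real n"
    \<comment> \<open>\<open>B\<close> is a random multiple of a fixed set, which has a countable dense subset\<close>
    obtain T where T: "countable T" "T \<subseteq> {y. Q y \<le> 1}" "{y. Q y \<le> 1} \<subseteq> closure T"
      using separable by blast
    have eq: "point_dist (cylinder_dist \<nu>) X (?flow (real n) (shift r \<omega>) ` B (shift r \<omega>))
        = (INF y\<in>T. ennreal (cylinder_dist \<nu> X (\<pi> (Y (real n) (shift r \<omega>) (sqrt (R (shift r \<omega>)) *\<^sub>R y)))))"
      if "\<omega> \<in> space ?M" for \<omega>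
    proof -
      have \<omega>: "shift r \<omega> \<in> \<Omega>" using that by (simp add: space_noise shift_in)
      let ?R = "R (shift r \<omega>)"
      have R: "0 < ?R" by (rule R_pos[OF \<omega>])
      have "{y. Q y \<le> ?R} = (\<lambda>y. sqrt ?R *\<^sub>R y) ` {y. Q y \<le> 1}"
      proof (intro antisym subsetI)
        fix y assume y: "y \<in> {y. Q y \<le> ?R}"
        have "y = sqrt ?R *\<^sub>R ((1 / sqrt ?R) *\<^sub>R y)" using R by simp
        moreover have "Q ((1 / sqrt ?R) *\<^sub>R y) \<le> 1" using y R by (simp add: Q_scale power_divide)
        ultimately show "y \<in> (\<lambda>y. sqrt ?R *\<^sub>R y) ` {y. Q y \<le> 1}" by blast
      next
        fix y assume "y \<in> (\<lambda>y. sqrt ?R *\<^sub>R y) ` {y. Q y \<le> 1}"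
        then obtain y' where y': "y = sqrt ?R *\<^sub>R y'" "Q y' \<le> 1" by blast
        have "Q y = ?R * Q y'" unfolding y'(1) Q_scale using R by simp
        also have "\<dots> \<le> ?R * 1" using R y'(2) by (intro mult_left_mono) auto
        finally show "y \<in> {y. Q y \<le> ?R}" by simp
      qed
      then have "?flow (real n) (shift r \<omega>) ` B (shift r \<omega>)
          = (\<lambda>y. \<pi> (Y (real n) (shift r \<omega>) (sqrt ?R *\<^sub>R y))) ` {y. Q y \<le> 1}"
        by (simp add: B_def image_image cylinder_flow_mod[OF \<omega>])
      then have "point_dist (cylinder_dist \<nu>) X (?flow (real n) (shift r \<omega>) ` B (shift r \<omega>))
          = (INF y\<in>{y. Q y \<le> 1}. ennreal (cylinder_dist \<nu> X (\<pi> (Y (real n) (shift r \<omega>) (sqrt ?R *\<^sub>R y)))))"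
        by (simp add: point_dist_def image_image)
      also have "\<dots> = (INF y\<in>T. ennreal (cylinder_dist \<nu> X (\<pi> (Y (real n) (shift r \<omega>) (sqrt ?R *\<^sub>R y)))))"
      proof -
        have "continuous_on UNIV (\<lambda>y. Y (real n) (shift r \<omega>) (sqrt ?R *\<^sub>R y))"
          by (rule continuous_on_compose2[OF Y_continuous[OF \<omega>]]) (simp_all add: continuous_on_scaleR continuous_on_const continuous_on_id)
        then have "continuous_on UNIV (\<lambda>y. cylinder_dist \<nu> X (\<pi> (Y (real n) (shift r \<omega>) (sqrt ?R *\<^sub>R y))))"
          by (rule continuous_on_compose2[OF quot.continuous_on_d[OF X, of UNIV]]) simp
        then show ?thesis by (rule INF_ennreal_dense[OF _ T(2,3)])
      qed
      finally show ?thesis .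
    qed
    have "(\<lambda>\<omega>. ennreal (cylinder_dist \<nu> X (\<pi> (Y (real n) (shift r \<omega>) (sqrt (R (shift r \<omega>)) *\<^sub>R y)))))
        \<in> borel_measurable ?M" for y
    proof -
      have "(\<lambda>\<omega>. sqrt (R (shift r \<omega>)) *\<^sub>R y) \<in> borel_measurable ?M"
      proof -
        have [measurable]: "(\<lambda>\<omega>. noise_sup (\<delta> / 2) (shift r \<omega>)) \<in> borel_measurable ?M"
          using \<delta> by (intro measurable_noise_sup) simp
        show ?thesis unfolding R_def by (intro borel_measurable_scaleR) simp_all
      qed
      then have "(\<lambda>\<omega>. (real n, \<omega>, sqrt (R (shift r \<omega>)) *\<^sub>R y)) \<in> ?M \<rightarrow>\<^sub>M restrict_space borel {0..} \<Otimes>\<^sub>M (?M \<Otimes>\<^sub>M borel)"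
        by (intro measurable_Pair measurable_const) (auto simp: space_restrict_space)
      from measurable_compose[OF measurable_compose[OF this measurable_Y[of r]]
          borel_measurable_continuous_onI[OF quot.continuous_on_d[OF X, of UNIV]]]
      show ?thesis by simp
    qed
    then have "(\<lambda>\<omega>. INF y\<in>T. ennreal (cylinder_dist \<nu> X (\<pi> (Y (real n) (shift r \<omega>) (sqrt (R (shift r \<omega>)) *\<^sub>R y)))))
        \<in> borel_measurable ?M"
      by (intro borel_measurable_INF T(1))
    also have "?this \<longleftrightarrow> (\<lambda>\<omega>. point_dist (cylinder_dist \<nu>) X (?flow (real n) (shift r \<omega>) ` B (shift r \<omega>))) \<in> borel_measurable ?M"
      by (intro measurable_cong eq[symmetric])
    finally show "(\<lambda>\<omega>. point_dist (cylinder_dist \<nu>) X (?flow (real n) (shift (- real n) \<omega>) ` B (shift (- real n) \<omega>)))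
        \<in> borel_measurable ?M"
      unfolding r_def .
  next
    fix \<omega> and D :: "('j \<Rightarrow> real \<Rightarrow> real) \<Rightarrow> ('j phase set \<times> 'j phase) set" and X0
    assume "\<omega> \<in> space ?M" and D: "\<And>\<omega>. \<omega> \<in> space ?M \<Longrightarrow> D \<omega> \<subseteq> cylinder \<alpha> \<kappa>" and "X0 \<in> cylinder \<alpha> \<kappa>"
      and temp: "tempered_at shift (cylinder_dist \<nu>) D X0 \<omega>"
    then obtain y0 where \<omega>: "\<omega> \<in> \<Omega>" and X0: "X0 = \<pi> y0" by (auto simp: space_noise cylinder_range)
    obtain a where a: "a > 0" "\<And>x. a * norm x \<le> \<nu> x" using is_norm_bounded_below[OF norm_\<nu>] by blast
    \<comment> \<open>the rate \<open>\<delta> / 4\<close> leaves the squared norms of initial values a growth of \<open>exp (\<delta> / 2 * t)\<close>\<close>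
    define h where "h t = ennreal (exp (- (\<delta> / 4) * t)) * (SUP X\<in>D (shift (- t) \<omega>). ennreal (cylinder_dist \<nu> X X0))" for t
    have "(h \<longlongrightarrow> 0) at_top"
      using temp \<delta> unfolding tempered_at_def h_def by (auto dest: spec[of _ "\<delta> / 4"])
    then have "eventually (\<lambda>t. h t < 1) at_top" by (rule order_tendstoD) simp
    moreover define C where "C = Bq * (norm y0 + 2 / a)\<^sup>2"
    have "filterlim (\<lambda>t. exp (\<delta> / 2 * t)) at_top at_top" 
    using \<delta> by (intro filterlim_compose[OF exp_at_top] filterlim_tendsto_pos_mult_at_top[OF tendsto_const] filterlim_ident) simp
    then have "eventually (\<lambda>t. C \<le> exp (\<delta> / 2 * t)) at_top"
      by (simp add: filterlim_at_top)
    ultimately have "eventually (\<lambda>t. h t < 1 \<and> C \<le> exp (\<delta> / 2 * t)) at_top" by (rule eventually_conj)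
    then obtain T where T: "\<And>t. T \<le> t \<Longrightarrow> h t < 1 \<and> C \<le> exp (\<delta> / 2 * t)"
      unfolding eventually_at_top_linorder by blast
    have "?flow t (shift (- t) \<omega>) ` D (shift (- t) \<omega>) \<subseteq> B \<omega>" if t: "max 0 T \<le> t" for t
    proof (intro image_subsetI)
      fix X assume X: "X \<in> D (shift (- t) \<omega>)"
      have \<omega>t: "shift (- t) \<omega> \<in> \<Omega>" by (rule shift_in[OF \<omega>])
      obtain y1 where y1: "X = \<pi> y1"
        using D[of "shift (- t) \<omega>"] X \<omega>t by (auto simp: space_noise cylinder_range)
      have "ennreal (exp (- (\<delta> / 4) * t)) * ennreal (cylinder_dist \<nu> X X0) \<le> h t"
        unfolding h_def by (intro mult_left_mono SUP_upper X) simp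
      also have "h t < 1" using T t by simp
      finally have "ennreal (exp (- (\<delta> / 4) * t) * cylinder_dist \<nu> X X0) < ennreal 1"
        by (simp add: ennreal_mult quot.d_nonneg)
      then have "exp (- (\<delta> / 4) * t) * cylinder_dist \<nu> X X0 < 1"
        by (simp add: ennreal_less_iff quot.d_nonneg)
      then have "exp (\<delta> / 4 * t) * (exp (- (\<delta> / 4) * t) * cylinder_dist \<nu> X X0) < exp (\<delta> / 4 * t) * 1"
        by (intro mult_strict_left_mono) auto
      then have "cylinder_dist \<nu> X X0 < exp (\<delta> / 4 * t)"
        by (simp add: mult.assoc[symmetric] exp_add[symmetric])
      then have "cylinder_dist \<nu> (\<pi> y0) (\<pi> y1) < exp (\<delta> / 4 * t)"
        by (simp add: X0 y1 quot.d_commute)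
      then obtain y where y: "\<pi> y = X" "\<nu> (y0 - y) < exp (\<delta> / 4 * t)"
        using y1 by (metis quot.d_lift)
      have "a * norm (y0 - y) \<le> exp (\<delta> / 4 * t)" using a(2)[of "y0 - y"] y(2) by linarith
      then have "norm (y0 - y) \<le> exp (\<delta> / 4 * t) / a" using a(1) by (simp add: field_simps)
      moreover have "norm y \<le> norm y0 + norm (y0 - y)"
        using norm_triangle_ineq4[of y0 "y0 - y"] by simp
      moreover have "1 \<le> exp (\<delta> / 4 * t)" using t \<delta> by simp
      then have "norm y0 \<le> norm y0 * exp (\<delta> / 4 * t)" using mult_left_mono[of 1 "exp (\<delta> / 4 * t)" "norm y0"] by simp
      ultimately have "norm y \<le> norm y0 * exp (\<delta> / 4 * t) + exp (\<delta> / 4 * t) / a" by linarith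
      also have "\<dots> \<le> (norm y0 + 2 / a) * exp (\<delta> / 4 * t)"
        using a(1) by (simp add: field_simps)
      finally have "(norm y)\<^sup>2 \<le> ((norm y0 + 2 / a) * exp (\<delta> / 4 * t))\<^sup>2" by (rule power_mono) simp
      also have "\<dots> = (norm y0 + 2 / a)\<^sup>2 * exp (\<delta> / 2 * t)"
        by (simp add: power_mult_distrib exp_double[symmetric])
      finally have "Bq * (norm y)\<^sup>2 \<le> Bq * ((norm y0 + 2 / a)\<^sup>2 * exp (\<delta> / 2 * t))"
        using Bq(1) by (intro mult_left_mono) auto
      then have "Q y \<le> C * exp (\<delta> / 2 * t)" using Q_upper[of y] by (simp add: C_def mult.assoc)
      also have "\<dots> \<le> exp (\<delta> / 2 * t) * exp (\<delta> / 2 * t)" using T t by (intro mult_right_mono) auto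
      also have "\<dots> = exp (\<delta> * t)" by (simp add: exp_add[symmetric])
      also have "\<dots> \<le> (b * exp (\<delta> / 2 * t) + exp (\<delta> * t)) * 1" using b by simp
      also have "\<dots> \<le> (b * exp (\<delta> / 2 * t) + exp (\<delta> * t)) * noise_sup (\<delta> / 2) (shift t (shift (- t) \<omega>))"
        using b by (intro mult_left_mono noise_1 shift_in \<omega>t) simp
      finally have "Q (Y t (shift (- t) \<omega>) y) \<le> R (shift t (shift (- t) \<omega>))"
        using t by (intro Q_decay[OF \<omega>t]) auto
      then have "\<pi> (Y t (shift (- t) \<omega>) y) \<in> B \<omega>"
        using \<omega> by (simp add: B_def shift_shift shift_0)
      then show "?flow t (shift (- t) \<omega>) X \<in> B \<omega>"
        using y(1) t cylinder_flow_mod[OF \<omega>t, of t y] by simp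
    qed
    then show "\<exists>T\<ge>0. \<forall>t\<ge>T. ?flow t (shift (- t) \<omega>) ` D (shift (- t) \<omega>) \<subseteq> B \<omega>"
      by (intro exI[of _ "max 0 T"]) auto
  qed
qed

end

section \<open>The random attractor\<close>

theorem theorem4p2:
  fixes \<alpha> K \<beta> \<kappa> c1 c2 :: real
    and f \<epsilon> :: "real^('n::finite^'d::finite)"
    and A :: "real^('n^'d)^('n^'d)"
    and lam :: "nat \<Rightarrow> real"
    and g :: "real \<Rightarrow> real"
    and P :: "(real \<Rightarrow> real) measure"
    and \<Omega> :: "('n^'d \<Rightarrow> real \<Rightarrow> real) set"
    and Y :: "real \<Rightarrow> ('n^'d \<Rightarrow> real \<Rightarrow> real) \<Rightarrow> ('n^'d) phase \<Rightarrow> ('n^'d) phase"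
    and \<nu> :: "('n^'d) phase \<Rightarrow> real"
  assumes "CARD('n) \<ge> 2"
    and "\<alpha> > 0" and "K > 0"
    and "transpose A = A" and "\<forall>x. 0 \<le> x \<bullet> (A *v x)"
    and "eigenvalues_with_mult A lam"
    and "lam 0 = 0" and "0 < lam 1"
    and "\<forall>i j. 1 \<le> i \<and> i \<le> j \<and> j < CARD('n^'d) \<longrightarrow> lam i \<le> lam j"
    and "A *v (\<chi> j. 1) = 0"
    and "\<forall>x. g differentiable (at x)" and "continuous_on UNIV (deriv g)"
    and "c1 > 0" and "\<forall>x. \<bar>g x\<bar> \<le> c1"
    and "c2 > 0" and "\<forall>x. \<bar>deriv g x\<bar> \<le> c2"
    and "\<kappa> > 0" and "\<forall>x. g (x + \<kappa>) = g x"
    and "\<forall>p. 0 < p \<and> p < \<kappa> \<longrightarrow> \<not> (\<forall>x. g (x + p) = g x)"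
    and "wiener_measure P"
    and "good_noise_set P \<epsilon> \<Omega>"
    and "\<forall>\<omega>\<in>\<Omega>. \<forall>Y0. random_solution A K \<alpha> \<beta> f g \<epsilon> \<omega> Y0 (\<lambda>t. Y t \<omega> Y0)"
    and "is_norm \<nu>"
  shows "rds (noise_space P \<Omega>) shift (cylinder \<alpha> \<kappa>) (cylinder_dist \<nu>) (cylinder_flow \<alpha> \<kappa> Y) \<and>
    (\<exists>A0. global_random_attractor (noise_space P \<Omega>) shift (cylinder \<alpha> \<kappa>) (cylinder_dist \<nu>)
            (cylinder_flow \<alpha> \<kappa> Y) A0)"
proof -
  have ones: "A *v ones = 0" using assms(10) by (simp add: ones_def)
  have ones_nz: "ones \<noteq> (0 :: real^('n^'d))" by (simp add: ones_def vec_eq_iff)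
  have lam_pos: "0 < lam i" if "1 \<le> i" "i < CARD('n^'d)" for i
    using assms(8,9) that by (metis less_le_trans order_refl)
  have ker: "u = 0" if "A *v u = 0" "u \<bullet> ones = 0" for u
    using simple_zero_eigenvalue_kernel[OF assms(4,6,7) lam_pos ones_nz ones that] .
  have "\<bar>g r - g s\<bar> \<le> c2 * \<bar>r - s\<bar>" for r s
    using field_differentiable_bound[of UNIV g "deriv g" c2 r s] assms(11,16)
    by (simp add: DERIV_deriv_iff_real_differentiable)
  then interpret cylinder_system P \<epsilon> \<Omega> A K \<alpha> \<beta> \<kappa> c1 c2 f g Y \<nu>
    using assms ones ker by unfold_locales auto
  show ?thesis using rds_cylinder_flow attractor_exists by blast
qed

end
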